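(* Let $\mathcal I=(-1,1)$ and let $\mathcal B\subset L^2(\mathcal I,\mathbb R^{q})$, $q=m+p$, be a controllable linear differential behavior with $m$ inputs, $p$ outputs and McMillan degree $\mathfrak n(\mathcal B)$. Then there exists a polynomial matrix $M\in\mathbb R^{q\times m}[s]$ with $\deg(M)\le\mathfrak n(\mathcal B)+1$ such that $$\mathcal B=\Bigl\{w=\operatorname{col}(u,y)\in L^2(\mathcal I,\mathbb R^{m+p})\ \Big|\ \exists\,\ell\in L^2(\mathcal I,\mathbb R^m)\text{ such that } w=M\bigl(\tfrac{d}{dt}\bigr)\ell\Bigr\}.$$ Moreover, for this $M$: if $w\in H^k(\mathcal I,\mathbb R^q)$ for some $k\in\mathbb N$, then the latent variable $\ell$ in $w=M(\frac{d}{dt})\ell$ satisfies $\ell\in H^{k+1}(\mathcal I,\mathbb R^m)$.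
   Context: $\mathbb N$ includes $0$; $\mathcal I=(-1,1)$. $H^k$ is the $L^2$-based Sobolev space of order $k$ ($H^0=L^2$). Differential equations are meant weakly: for $M(s)=\sum_i M_is^i$, $w=M(\frac{d}{dt})\ell$ means $\int_{\mathcal I}w^\top\phi\,dt=\sum_i(-1)^i\int_{\mathcal I}\ell^\top M_i^\top\phi^{(i)}dt$ for all $\phi\in C_c^\infty(\mathcal I,\mathbb R^q)$. A linear differential behavior is a set $\mathcal B=\{w\in L^2(\mathcal I,\mathbb R^q)\mid R(\frac{d}{dt})w=0\}$ with $R(s)=R_0+\dots+R_rs^r\in\mathbb R^{g\times q}[s]$, where $R(\frac{d}{dt})w=0$ means $\sum_{i=0}^r(-1)^i\int_{\mathcal I}w^\top R_i^\top\phi^{(i)}\,dt=0$ for all $\phi\in C_c^\infty(\mathcal I,\mathbb R^g)$. Trajectories are partitioned as $w=\operatorname{col}(u,y)$ with input $u$ ($m$ components) and output $y$ ($p$ components) such that $\mathcal B$ admits an input-state-output representation: matrices $A\in\mathbb R^{n\times n}$, $B\in\mathbb R^{n\times m}$, $C\in\mathbb R^{p\times n}$, $D\in\mathbb R^{p\times m}$ such that $w=\operatorname{col}(u,y)\in C^\infty(\overline{\mathcal I},\mathbb R^q)$ belongs to $\mathcal B$ if and only if there is $x\in C^\infty(\overline{\mathcal I},\mathbb R^n)$ with $\frac{d}{dt}x=Ax+Bu$, $y=Cx+Du$. The McMillan degree $\mathfrak n(\mathcal B)$ is the minimal state dimension $n$ among all such representations. $\mathcal B$ is controllable if for all $w_0,w_1\in\mathcal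 B$ there are $t_1\in(0,1)$ and $w\in\mathcal B$ with $w(t)=w_0(t)$ for (a.e.) $t\in(-1,0]$ and $w(t)=w_1(t-t_1)$ for (a.e.) $t\in[t_1,1)$. *)

theory Defs
  imports "HOL-Analysis.Analysis" "Jordan_Normal_Form.Matrix"
begin

unbundle no vec_syntax
unbundle no inner_syntax

text \<open>
  All sizes (signal, equation and state dimensions) are natural numbers that may be zero, and some
  of them are quantified over inside the definitions. Trajectories are therefore functions from the
  reals to vectors with an explicit dimension. Only their values on the interval matter, and
  function spaces are sets of representatives, closed under changes on null sets and outside
  the interval.
\<close>

abbreviation I :: "real set" where
  "I \<equiv> {-1<..<1}"

abbreviation clI :: "real set" where
  "clI \<equiv> {-1..1}"

abbreviation integral_I :: "(real \<Rightarrow> real) \<Rightarrow> real" where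
  "integral_I f \<equiv> integral\<^sup>L (lebesgue_on I) f"


section \<open>Function spaces\<close>

definition test_fun :: "(real \<Rightarrow> real) set" where
  "test_fun = {\<phi>. (\<forall>j t. (deriv ^^ j) \<phi> differentiable (at t)) \<and> closure {t. \<phi> t \<noteq> 0} \<subseteq> I}"

definition test_fun_vec :: "nat \<Rightarrow> (real \<Rightarrow> real Matrix.vec) set" where
  "test_fun_vec d = {\<phi>. (\<forall>t. \<phi> t \<in> carrier_vec d) \<and> (\<forall>i<d. (\<lambda>t. \<phi> t $ i) \<in> test_fun)}"

definition deriv_vec :: "nat \<Rightarrow> (real \<Rightarrow> real Matrix.vec) \<Rightarrow> real \<Rightarrow> real Matrix.vec" where
  "deriv_vec j \<phi> t = Matrix.vec (dim_vec (\<phi> t)) (\<lambda>i. (deriv ^^ j) (\<lambda>s. \<phi> s $ i) t)"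

definition L2 :: "(real \<Rightarrow> real) set" where
  "L2 = {f. f \<in> borel_measurable (lebesgue_on I) \<and> integrable (lebesgue_on I) (\<lambda>t. (f t)\<^sup>2)}"

definition sobolev :: "nat \<Rightarrow> (real \<Rightarrow> real) set" where
  "sobolev k = {f \<in> L2. \<forall>j\<le>k. \<exists>g\<in>L2. \<forall>\<phi>\<in>test_fun.
     integral_I (\<lambda>t. g t * \<phi> t) = (-1) ^ j * integral_I (\<lambda>t. f t * (deriv ^^ j) \<phi> t)}"

definition L2_vec :: "nat \<Rightarrow> (real \<Rightarrow> real Matrix.vec) set" where
  "L2_vec d = {w. (\<forall>t\<in>I. w t \<in> carrier_vec d) \<and> (\<forall>i<d. (\<lambda>t. w t $ i) \<in> L2)}"

definition sobolev_vec :: "nat \<Rightarrow> nat \<Rightarrow> (real \<Rightarrow> real Matrix.vec) set" where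
  "sobolev_vec k d = {w. (\<forall>t\<in>I. w t \<in> carrier_vec d) \<and> (\<forall>i<d. (\<lambda>t. w t $ i) \<in> sobolev k)}"

text \<open>
  Smoothness up to the boundary: \<open>F n\<close> is the \<open>n\<close>-th derivative, one-sided at the end points.
\<close>

definition smooth_clI :: "(real \<Rightarrow> real) set" where
  "smooth_clI = {f. \<exists>F. (\<forall>t\<in>clI. F 0 t = f t) \<and>
     (\<forall>n. \<forall>t\<in>clI. (F n has_real_derivative F (Suc n) t) (at t within clI))}"

definition smooth_clI_vec :: "nat \<Rightarrow> (real \<Rightarrow> real Matrix.vec) set" where
  "smooth_clI_vec d =
     {w. (\<forall>t\<in>clI. w t \<in> carrier_vec d) \<and> (\<forall>i<d. (\<lambda>t. w t $ i) \<in> smooth_clI)}"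


section \<open>Polynomial differential operators\<close>

definition coeff_mat :: "real poly mat \<Rightarrow> nat \<Rightarrow> real mat" where
  "coeff_mat P i = map_mat (\<lambda>a. coeff a i) P"

text \<open>The element 0 covers matrices without entries.\<close>

definition degree_mat :: "real poly mat \<Rightarrow> nat" where
  "degree_mat P = Max (insert 0 (degree ` elements_mat P))"

text \<open>\<open>weak_diff_eq P l w\<close> is the weak form of \<open>w = P(d/dt) l\<close>.\<close>

definition weak_diff_eq ::
  "real poly mat \<Rightarrow> (real \<Rightarrow> real Matrix.vec) \<Rightarrow> (real \<Rightarrow> real Matrix.vec) \<Rightarrow> bool" where
  "weak_diff_eq P l w \<longleftrightarrow> (\<forall>\<phi>\<in>test_fun_vec (dim_row P).
     integral_I (\<lambda>t. w t \<bullet> \<phi> t) =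
     (\<Sum>i\<le>degree_mat P.
        (-1) ^ i * integral_I (\<lambda>t. l t \<bullet> (transpose_mat (coeff_mat P i) *\<^sub>v deriv_vec i \<phi> t))))"


section \<open>Behaviors\<close>

definition linear_differential_behavior :: "nat \<Rightarrow> (real \<Rightarrow> real Matrix.vec) set \<Rightarrow> bool" where
  "linear_differential_behavior q \<BB> \<longleftrightarrow>
     (\<exists>g. \<exists>R \<in> carrier_mat g q. \<BB> = {w \<in> L2_vec q. weak_diff_eq R w (\<lambda>t. 0\<^sub>v g)})"

definition iso_representation ::
  "nat \<Rightarrow> nat \<Rightarrow> (real \<Rightarrow> real Matrix.vec) set \<Rightarrow> nat \<Rightarrow>
   real mat \<Rightarrow> real mat \<Rightarrow> real mat \<Rightarrow> real mat \<Rightarrow> bool" where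
  "iso_representation m p \<BB> n A B C D \<longleftrightarrow>
     A \<in> carrier_mat n n \<and> B \<in> carrier_mat n m \<and> C \<in> carrier_mat p n \<and> D \<in> carrier_mat p m \<and>
     (\<forall>u\<in>smooth_clI_vec m. \<forall>y\<in>smooth_clI_vec p.
        (\<lambda>t. u t @\<^sub>v y t) \<in> \<BB> \<longleftrightarrow>
        (\<exists>x\<in>smooth_clI_vec n. \<forall>t\<in>clI.
           (\<forall>i<n. ((\<lambda>s. x s $ i) has_real_derivative (A *\<^sub>v x t + B *\<^sub>v u t) $ i) (at t within clI)) \<and>
           y t = C *\<^sub>v x t + D *\<^sub>v u t))"

definition has_iso_representation :: "nat \<Rightarrow> nat \<Rightarrow> (real \<Rightarrow> real Matrix.vec) set \<Rightarrow> nat \<Rightarrow> bool" where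
  "has_iso_representation m p \<BB> n \<longleftrightarrow> (\<exists>A B C D. iso_representation m p \<BB> n A B C D)"

definition mcmillan_degree :: "nat \<Rightarrow> nat \<Rightarrow> (real \<Rightarrow> real Matrix.vec) set \<Rightarrow> nat" where
  "mcmillan_degree m p \<BB> = (LEAST n. has_iso_representation m p \<BB> n)"

definition controllable :: "(real \<Rightarrow> real Matrix.vec) set \<Rightarrow> bool" where
  "controllable \<BB> \<longleftrightarrow> (\<forall>w0\<in>\<BB>. \<forall>w1\<in>\<BB>. \<exists>t1\<in>{0<..<1}. \<exists>w\<in>\<BB>.
     (AE t in lebesgue_on {-1<..0}. w t = w0 t) \<and>
     (AE t in lebesgue_on {t1..<1}. w t = w1 (t - t1)))"

end

theory Submission
  imports Defs "HOL-Library.Function_Algebras" "Jordan_Normal_Form.Determinant"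
begin

text \<open>
  All equations are read in the module of distributions on the interval, on which a polynomial acts
  by differentiation; a weak equation \<open>w = P(d/dt) l\<close> is then an identity of module elements, and the
  polynomial algebra of behaviors applies to \<open>L\<^sup>2\<close> trajectories. Passing to the observable quotient of
  a minimal representation gives matrices \<open>A, B, C, D\<close> of size at most the McMillan degree. A
  trajectory of the behavior minus a particular solution of the state equation is a weak solution with
  zero input; it is smooth, because the output part of the kernel matrix has full column rank, so it
  is a free response. Hence the \<open>L\<^sup>2\<close> trajectories are exactly the outputs of the state equation.
  Controllability of the behavior makes \<open>(A, B)\<close> reachable, and a chain of state vectors as in
  Heymann's lemma yields outputs \<open>f = Lx x + Lu u\<close>, constant combinations of state and input, such
  that \<open>x = X(d/dt) f\<close> and \<open>u = U(d/dt) f\<close> with \<open>X, U\<close> of degree at most the state dimension. The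
  latent variable is a primitive of \<open>f\<close>. This costs one more degree and gains one derivative: \<open>f\<close> is as
  regular as \<open>w\<close>, since \<open>x\<close> is.
\<close>

section \<open>Smooth functions and test functions\<close>

text \<open>The hypotheses concern two classes of trajectories: the state equations are assumed only
  for trajectories smooth up to the boundary, while the kernel equations and the claim concern weak
  solutions in \<open>L2\<close>. The bridge is algebraic. Explicit smooth trajectories (free
  responses and exponentials of every real rate) force identities between polynomial matrices, and
  such identities hold in every module over the polynomials, in particular on distributions.
  Conversely, a polynomial left inverse of the output block reduces weak solutions with zero input
  to scalar equations.

  The observable quotient replaces a proof that minimal representations are observable: it can only
  shrink the state, the right direction for a degree bound. Observability then serves twice, to read
  states off outputs when controllability is transferred, and to compare an arbitrary latent
  variable with the constructed one.

  A Heymann chain runs through the whole state space whatever the number of inputs. The state is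
  recovered from the end of the chain with at most n - 1 differentiations and the input with one
  more; this is the degree n before the primitive is taken.\<close>

definition smooth :: "(real \<Rightarrow> real) \<Rightarrow> bool" where
  "smooth f \<longleftrightarrow> (\<forall>j t. (deriv ^^ j) f differentiable (at t))"

text \<open>Smoothness is a greatest fixed point: any set that contains a derivative of each of its
  members consists of smooth functions. This gives smoothness without closed formulas for higher
  derivatives.\<close>

lemma smooth_coinduct:
  assumes "f \<in> S"
    and step: "\<And>g. g \<in> S \<Longrightarrow> \<exists>g'\<in>S. \<forall>t. (g has_real_derivative g' t) (at t)"
  shows "smooth f"
proof -
  have "(deriv ^^ j) f \<in> S" for j
  proof (induction j)
    case (Suc j)
    then obtain g' where g': "g' \<in> S" "\<forall>t. ((deriv ^^ j) f has_real_derivative g' t) (at t)"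
      using step by blast
    then have "deriv ((deriv ^^ j) f) = g'"
      by (intro ext DERIV_imp_deriv) auto
    with g' show ?case by simp
  qed (use assms in simp)
  then show ?thesis
    unfolding smooth_def using step real_differentiable_def by blast
qed

lemma smooth_has_deriv: "smooth f \<Longrightarrow> (f has_real_derivative deriv f t) (at t)"
  unfolding smooth_def DERIV_deriv_iff_real_differentiable
  by (drule spec[of _ 0]) simp

lemma smooth_deriv: "smooth f \<Longrightarrow> smooth (deriv f)"
  unfolding smooth_def
proof (intro allI)
  fix j t assume "\<forall>j t. (deriv ^^ j) f differentiable (at t)"
  then have "(deriv ^^ Suc j) f differentiable (at t)" by blast
  then show "(deriv ^^ j) (deriv f) differentiable (at t)" by (simp only: funpow_Suc_right o_apply)
qed

lemma smoothI:
  assumes "\<And>t. (f has_real_derivative f' t) (at t)" "smooth f'"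
  shows "smooth f"
proof (rule smooth_coinduct[where S = "insert f (Collect smooth)"])
  fix g assume "g \<in> insert f (Collect smooth)"
  then show "\<exists>g'\<in>insert f (Collect smooth). \<forall>t. (g has_real_derivative g' t) (at t)"
    using assms smooth_has_deriv smooth_deriv by blast
qed simp

text \<open>The derivative of a product is a sum of products, so products alone are not closed under
  differentiation. The algebra generated by the smooth functions is, which makes it a witness for
  \<open>smooth_coinduct\<close>.\<close>

inductive_set smooth_alg :: "(real \<Rightarrow> real) set" where
  base: "smooth f \<Longrightarrow> f \<in> smooth_alg"
| add: "f \<in> smooth_alg \<Longrightarrow> g \<in> smooth_alg \<Longrightarrow> (\<lambda>t. f t + g t) \<in> smooth_alg"
| mult: "f \<in> smooth_alg \<Longrightarrow> g \<in> smooth_alg \<Longrightarrow> (\<lambda>t. f t * g t) \<in> smooth_alg"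

lemma smooth_alg_deriv:
  "f \<in> smooth_alg \<Longrightarrow> \<exists>f'\<in>smooth_alg. \<forall>t. (f has_real_derivative f' t) (at t)"
proof (induction rule: smooth_alg.induct)
  case (base f)
  then show ?case using smooth_has_deriv smooth_deriv smooth_alg.base by blast
next
  case (add f g)
  then obtain f' g' where "f' \<in> smooth_alg" "\<forall>t. (f has_real_derivative f' t) (at t)"
    "g' \<in> smooth_alg" "\<forall>t. (g has_real_derivative g' t) (at t)" by blast
  then show ?case
    by (intro bexI[of _ "\<lambda>t. f' t + g' t"]) (auto intro: DERIV_add smooth_alg.add)
next
  case (mult f g)
  then obtain f' g' where *: "f' \<in> smooth_alg" "\<forall>t. (f has_real_derivative f' t) (at t)"
    "g' \<in> smooth_alg" "\<forall>t. (g has_real_derivative g' t) (at t)" by blast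
  show ?case
  proof (intro bexI[of _ "\<lambda>t. f' t * g t + g' t * f t"])
    show "\<forall>t. ((\<lambda>t. f t * g t) has_real_derivative f' t * g t + g' t * f t) (at t)"
      using * DERIV_mult by blast
    show "(\<lambda>t. f' t * g t + g' t * f t) \<in> smooth_alg"
      by (rule smooth_alg.add[OF smooth_alg.mult smooth_alg.mult]) (use mult * in auto)
  qed
qed

lemma smooth_alg_smooth: "f \<in> smooth_alg \<Longrightarrow> smooth f"
  using smooth_coinduct smooth_alg_deriv by blast

lemma smooth_add: "smooth f \<Longrightarrow> smooth g \<Longrightarrow> smooth (\<lambda>t. f t + g t)"
  by (rule smooth_alg_smooth[OF smooth_alg.add[OF smooth_alg.base smooth_alg.base]])

lemma smooth_mult: "smooth f \<Longrightarrow> smooth g \<Longrightarrow> smooth (\<lambda>t. f t * g t)"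
  by (rule smooth_alg_smooth[OF smooth_alg.mult[OF smooth_alg.base smooth_alg.base]])

lemma smooth_const: "smooth (\<lambda>_. c)"
  by (rule smooth_coinduct[where S = "range (\<lambda>c _. c)"]) (auto intro!: exI[of _ 0] DERIV_const)

lemma smooth_minus: "smooth f \<Longrightarrow> smooth (\<lambda>t. - f t)"
  using smooth_mult[OF smooth_const[of "-1"], of f] by simp

lemma smooth_sum: "(\<And>i. i \<in> A \<Longrightarrow> smooth (f i)) \<Longrightarrow> smooth (\<lambda>t. \<Sum>i\<in>A. f i t)"
  by (induction A rule: infinite_finite_induct) (simp_all add: smooth_const smooth_add)

lemma smooth_affine:
  assumes "smooth f" shows "smooth (\<lambda>t. f (c * t + d))"
\<comment> \<open>The scalar \<open>e\<close> absorbs the powers of \<open>c\<close> that the chain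
  rule produces.\<close>
proof (rule smooth_coinduct[where S = "{\<lambda>t. e * g (c * t + d) |g e. smooth g}"])
  show "(\<lambda>t. f (c * t + d)) \<in> {\<lambda>t. e * g (c * t + d) |g e. smooth g}"
    by (rule CollectI, rule exI[of _ f], rule exI[of _ 1]) (use assms in simp)
next
  fix h assume "h \<in> {\<lambda>t. e * g (c * t + d) |g e. smooth g}"
  then obtain g e where h: "h = (\<lambda>t. e * g (c * t + d))" "smooth g" by blast
  have "(h has_real_derivative (e * c) * deriv g (c * t + d)) (at t)" for t
    unfolding h(1)
    by (auto intro!: derivative_eq_intros DERIV_chain'[OF _ smooth_has_deriv[OF h(2)]])
  moreover have "(\<lambda>t. (e * c) * deriv g (c * t + d)) \<in> {\<lambda>t. e * g (c * t + d) |g e. smooth g}"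
    using smooth_deriv[OF h(2)] by blast
  ultimately show "\<exists>g'\<in>{\<lambda>t. e * g (c * t + d) |g e. smooth g}. \<forall>t. (h has_real_derivative g' t) (at t)"
    by (intro bexI[of _ "\<lambda>t. (e * c) * deriv g (c * t + d)"]) auto
qed

lemma smooth_exp: "smooth (\<lambda>t. exp (c * t))"
proof (rule smooth_coinduct[where S = "range (\<lambda>d t. d * exp (c * t))"])
  show "(\<lambda>t. exp (c * t)) \<in> range (\<lambda>d t. d * exp (c * t))"
    by (auto intro!: image_eqI[of _ _ 1])
next
  fix g assume "g \<in> range (\<lambda>d t. d * exp (c * t))"
  then obtain d where "g = (\<lambda>t. d * exp (c * t))" by blast
  then show "\<exists>g'\<in>range (\<lambda>d t. d * exp (c * t)). \<forall>t. (g has_real_derivative g' t) (at t)"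
    by (intro bexI[of _ "\<lambda>t. (d * c) * exp (c * t)"]) (auto intro!: derivative_eq_intros)
qed

lemma smooth_continuous: "smooth f \<Longrightarrow> continuous_on A f"
  using DERIV_isCont[OF smooth_has_deriv] by (simp add: continuous_at_imp_continuous_on)

section \<open>A flat function and bump functions\<close>

definition exp_flat :: "real poly \<Rightarrow> real \<Rightarrow> real" where
  "exp_flat p t = (if t > 0 then poly p (inverse t) * exp (- inverse t) else 0)"

lemma poly_exp_tendsto_0: "((\<lambda>s. poly p s * exp (- s)) \<longlongrightarrow> (0::real)) at_top"
proof -
  have "((\<lambda>s. coeff p i * (s ^ i / exp s)) \<longlongrightarrow> coeff p i * 0) at_top" for i
    by (intro tendsto_intros tendsto_power_div_exp_0)
  then have "((\<lambda>s. \<Sum>i\<le>degree p. coeff p i * (s ^ i / exp s)) \<longlongrightarrow> (\<Sum>i\<le>degree p. coeff p i * 0)) at_top"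
    by (intro tendsto_sum)
  then show ?thesis
    by (simp add: poly_altdef exp_minus field_simps sum_divide_distrib)
qed

text \<open>With s = 1/t the functions p(s) exp(-s) are closed under differentiation: p is replaced
  by s^2 times the difference of p and its derivative. Hence \<open>range exp_flat\<close> is a
  witness for \<open>smooth_coinduct\<close>.\<close>

lemma exp_flat_has_deriv:
  "(exp_flat p has_real_derivative exp_flat (monom 1 2 * (p - pderiv p)) t) (at t)"
proof (cases t "0 :: real" rule: linorder_cases)
  case less
  have "((\<lambda>_. 0) has_real_derivative 0) (at t)" by simp
  then have "(exp_flat p has_real_derivative 0) (at t)"
    by (rule has_field_derivative_transform_within_open[where S = "{..<0}"])
      (use less in \<open>auto simp: exp_flat_def\<close>)
  then show ?thesis using less by (simp add: exp_flat_def)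
next
  case greater
  have "((\<lambda>t. poly p (inverse t) * exp (- inverse t)) has_real_derivative
      exp_flat (monom 1 2 * (p - pderiv p)) t) (at t)"
    using greater unfolding exp_flat_def
    by (auto intro!: derivative_eq_intros DERIV_chain'[OF _ poly_DERIV]
        simp: poly_monom power2_eq_square algebra_simps)
  then show ?thesis
    by (rule has_field_derivative_transform_within_open[where S = "{0<..}"])
      (use greater in \<open>auto simp: exp_flat_def\<close>)
next
  case equal
  \<comment> \<open>The difference quotient at 0 has the same form: division by h multiplies the
    polynomial by its variable, which is \<open>pCons 0 p\<close>.\<close>
  have "((\<lambda>h. poly (pCons 0 p) (inverse h) * exp (- inverse h)) \<longlongrightarrow> 0) (at_right 0)"
    by (rule filterlim_compose[OF poly_exp_tendsto_0 filterlim_inverse_at_top_right])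
  then have "((\<lambda>h. exp_flat p h / h) \<longlongrightarrow> 0) (at_right 0)"
    by (rule tendsto_cong[THEN iffD1, rotated])
      (auto simp: eventually_at_filter exp_flat_def field_simps intro!: always_eventually)
  moreover have "((\<lambda>h. exp_flat p h / h) \<longlongrightarrow> 0) (at_left 0)"
    by (rule tendsto_eventually) (auto simp: eventually_at_filter exp_flat_def)
  ultimately have "((\<lambda>h. exp_flat p h / h) \<longlongrightarrow> 0) (at 0)"
    by (simp add: filterlim_at_split)
  then show ?thesis using equal by (simp add: DERIV_def exp_flat_def)
qed

lemma smooth_exp_flat: "smooth (exp_flat p)"
  by (rule smooth_coinduct[where S = "range exp_flat"]) (use exp_flat_has_deriv in blast)+

text \<open>As \<open>k\<close> tends to infinity, these test functions converge boundedly to the indicator of \<open>{a<..<b}\<close>.\<close>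

definition bump :: "real \<Rightarrow> real \<Rightarrow> real \<Rightarrow> real \<Rightarrow> real" where
  "bump a b k t = exp_flat 1 (k * (t - a) - 1) * exp_flat 1 (k * (b - t) - 1)"

lemma smooth_bump: "smooth (bump a b k)"
proof -
  have "smooth (\<lambda>t. exp_flat 1 (k * t + (- k * a - 1)) * exp_flat 1 ((- k) * t + (k * b - 1)))"
    by (intro smooth_mult smooth_affine smooth_exp_flat)
  moreover have "bump a b k = (\<lambda>t. exp_flat 1 (k * t + (- k * a - 1)) * exp_flat 1 ((- k) * t + (k * b - 1)))"
    by (auto simp: bump_def algebra_simps)
  ultimately show ?thesis by simp
qed

text \<open>The shift by 1 in \<open>bump\<close> keeps the support at distance \<open>1 / k\<close>
  from \<open>a\<close> and \<open>b\<close>. Therefore \<open>bump\<close> is a test function even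
  for \<open>a = -1\<close> and \<open>b = 1\<close>.\<close>

lemma bump_eq_0:
  assumes "k > 0" "t \<notin> {a + 1 / k..b - 1 / k}" shows "bump a b k t = 0"
proof -
  have "k * (t - a) - 1 < 0 \<or> k * (b - t) - 1 < 0"
    using assms by (auto simp: not_le field_simps)
  then show ?thesis by (auto simp: bump_def exp_flat_def)
qed

lemma bump_bounds: "\<bar>bump a b k t\<bar> \<le> 1"
proof -
  have "0 \<le> exp_flat 1 s \<and> exp_flat 1 s \<le> 1" for s by (auto simp: exp_flat_def)
  then show ?thesis unfolding bump_def by (auto simp: abs_mult mult_le_one)
qed

lemma bump_tendsto:
  "(\<lambda>k. bump a b (real (Suc k)) t) \<longlonglongrightarrow> indicator {a<..<b} t"
proof (cases "t \<in> {a<..<b}")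
  case False
  have "t \<notin> {a + 1 / real (Suc k)..b - 1 / real (Suc k)}" for k
  proof -
    define d where "d = 1 / real (Suc k)"
    have "d > 0" by (simp add: d_def)
    then show ?thesis unfolding d_def[symmetric] using False by auto
  qed
  then show ?thesis using False by (simp add: bump_eq_0)
next
  case True
  have "((\<lambda>s::real. exp (- inverse s)) \<longlongrightarrow> exp (- 0)) at_top"
    by (intro tendsto_intros tendsto_inverse_0_at_top filterlim_ident)
  then have "((\<lambda>s::real. exp (- inverse s)) \<longlongrightarrow> 1) at_top" by simp
  then have exp_flat: "(exp_flat 1 \<longlongrightarrow> 1) at_top"
    by (rule Lim_transform_eventually)
      (auto simp: exp_flat_def intro!: eventually_mono[OF eventually_gt_at_top[of 0]])
  have "(\<lambda>k. exp_flat 1 (real (Suc k) * c - 1)) \<longlonglongrightarrow> 1" if "c > 0" for c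
  proof (rule filterlim_compose[OF exp_flat])
    have "filterlim (\<lambda>k. - 1 + c * real (Suc k)) at_top sequentially"
      by (intro filterlim_tendsto_add_at_top[OF tendsto_const]
          filterlim_tendsto_pos_mult_at_top[OF tendsto_const that]
          filterlim_compose[OF filterlim_real_sequentially filterlim_Suc])
    then show "filterlim (\<lambda>k. real (Suc k) * c - 1) at_top sequentially"
      by (simp add: algebra_simps)
  qed
  then have "(\<lambda>k. bump a b (real (Suc k)) t) \<longlonglongrightarrow> 1 * 1"
    unfolding bump_def using True by (intro tendsto_mult) auto
  then show ?thesis using True by simp
qed

section \<open>Closure properties of test functions\<close>

lemma test_fun_iff: "\<phi> \<in> test_fun \<longleftrightarrow> smooth \<phi> \<and> closure {t. \<phi> t \<noteq> 0} \<subseteq> I"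
  by (simp add: test_fun_def smooth_def)

lemma test_fun_closure_I: "smooth \<phi> \<Longrightarrow> (\<And>t. t \<notin> {a..b} \<Longrightarrow> \<phi> t = 0) \<Longrightarrow> {a..b} \<subseteq> I \<Longrightarrow> \<phi> \<in> test_fun"
  unfolding test_fun_iff using closure_minimal[of "{t. \<phi> t \<noteq> 0}" "{a..b}"] by blast

lemma test_fun_support:
  assumes "\<phi> \<in> test_fun"
  shows "\<exists>a b. -1 < a \<and> a < b \<and> b < 1 \<and> (\<forall>t. t \<notin> {a..b} \<longrightarrow> \<phi> t = 0)"
proof -
  let ?K = "closure {t. \<phi> t \<noteq> 0}"
  have K: "?K \<subseteq> I" using assms by (simp add: test_fun_iff)
  then have "compact ?K"
    using bounded_subset[of I ?K] by (simp add: compact_eq_bounded_closed)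
  have "\<exists>a b. -1 < a \<and> a < b \<and> b < 1 \<and> ?K \<subseteq> {a..b}"
  proof (cases "?K = {}")
    case True
    then show ?thesis by (intro exI[of _ 0] exI[of _ "1/2"]) auto
  next
    case False
    from compact_attains_inf[OF \<open>compact ?K\<close> False] obtain a where a: "a \<in> ?K" "\<And>t. t \<in> ?K \<Longrightarrow> a \<le> t" by blast
    from compact_attains_sup[OF \<open>compact ?K\<close> False] obtain b where b: "b \<in> ?K" "\<And>t. t \<in> ?K \<Longrightarrow> t \<le> b" by blast
    from a b K have "-1 < a" "a \<le> b" "b < 1" by auto
    \<comment> \<open>Moving the right end halfway towards 1 gives a strict inequality between the
      end points without a look at the shape of the support.\<close>
    moreover have "?K \<subseteq> {a..(b + 1)/2}"
    proof
      fix t assume "t \<in> ?K"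
      then have "a \<le> t" "t \<le> b" using a b by blast+
      then show "t \<in> {a..(b + 1)/2}" using \<open>b < 1\<close> by simp
    qed
    ultimately have "-1 < a \<and> a < (b + 1)/2 \<and> (b + 1)/2 < 1 \<and> ?K \<subseteq> {a..(b + 1)/2}" by auto
    then show ?thesis by (intro exI)
  qed
  then obtain a b where ab: "-1 < a" "a < b" "b < 1" "?K \<subseteq> {a..b}" by blast
  then have "\<phi> t = 0" if "t \<notin> {a..b}" for t
    using that closure_subset[of "{t. \<phi> t \<noteq> 0}"] by auto
  with ab show ?thesis by blast
qed

lemma test_fun_smooth: "\<phi> \<in> test_fun \<Longrightarrow> smooth \<phi>"
  by (simp add: test_fun_iff)

lemma test_fun_mult: 
  assumes "smooth a" "\<phi> \<in> test_fun" shows "(\<lambda>t. a t * \<phi> t) \<in> test_fun"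
proof -
  obtain c d where "-1 < c" "c < d" "d < 1" "\<forall>t. t \<notin> {c..d} \<longrightarrow> \<phi> t = 0"
    using test_fun_support[OF assms(2)] by blast
  then show ?thesis
    by (intro test_fun_closure_I[of _ c d] smooth_mult test_fun_smooth[OF assms(2)] assms(1)) auto
qed

lemma test_fun_add: 
  assumes "\<psi> \<in> test_fun" "\<phi> \<in> test_fun" shows "(\<lambda>t. \<psi> t + \<phi> t) \<in> test_fun"
proof -
  obtain a b where 1: "-1 < a" "a < b" "b < 1" "\<forall>t. t \<notin> {a..b} \<longrightarrow> \<phi> t = 0"
    using test_fun_support[OF assms(2)] by blast
  obtain c d where 2: "-1 < c" "c < d" "d < 1" "\<forall>t. t \<notin> {c..d} \<longrightarrow> \<psi> t = 0"
    using test_fun_support[OF assms(1)] by blast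
  have "\<psi> t + \<phi> t = 0" if "t \<notin> {min a c..max b d}" for t
    using 1(4)[rule_format, of t] 2(4)[rule_format, of t] that by (auto simp: not_le)
  moreover have "{min a c..max b d} \<subseteq> I" using 1(1,3) 2(1,3) by auto
  ultimately show ?thesis
    by (intro test_fun_closure_I[of _ "min a c" "max b d"] smooth_add test_fun_smooth[OF assms(1)]
        test_fun_smooth[OF assms(2)])
qed

lemma test_fun_deriv:
  assumes "\<phi> \<in> test_fun" shows "deriv \<phi> \<in> test_fun"
proof -
  obtain a b where *: "-1 < a" "a < b" "b < 1" "\<forall>t. t \<notin> {a..b} \<longrightarrow> \<phi> t = 0"
    using test_fun_support[OF assms] by blast
  have "deriv \<phi> t = 0" if "t \<notin> {a..b}" for t
  proof -
    have "((\<lambda>_. 0) has_real_derivative 0) (at t)" by simp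
    then have "(\<phi> has_real_derivative 0) (at t)"
      by (rule has_field_derivative_transform_within_open[where S = "- {a..b}"])
        (use *(4) that in auto)
    then show ?thesis by (rule DERIV_imp_deriv)
  qed
  then show ?thesis using *(1,3)
    by (intro test_fun_closure_I[of _ a b] smooth_deriv test_fun_smooth[OF assms]) auto
qed

lemma test_fun_bump:
  assumes "-1 \<le> a" "b \<le> 1" "k > 0" shows "bump a b k \<in> test_fun"
proof (rule test_fun_closure_I[of _ "a + 1 / k" "b - 1 / k"])
  define d where "d = 1 / k"
  have "d > 0" using assms by (simp add: d_def)
  then show "{a + 1 / k..b - 1 / k} \<subseteq> I"
    unfolding d_def[symmetric] using assms(1,2) by auto
qed (use assms in \<open>auto intro: smooth_bump bump_eq_0\<close>)

lemma test_fun_zero: "(\<lambda>_. 0) \<in> test_fun"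
  by (rule test_fun_closure_I[of _ 0 0]) (auto intro: smooth_const)

lemma test_fun_bounded:
  assumes "\<phi> \<in> test_fun" obtains c where "\<And>t. \<bar>\<phi> t\<bar> \<le> c"
proof -
  obtain a b where *: "-1 < a" "a < b" "b < 1" "\<forall>t. t \<notin> {a..b} \<longrightarrow> \<phi> t = 0"
    using test_fun_support[OF assms] by blast
  have "bounded (\<phi> ` {a..b})"
    by (intro compact_imp_bounded compact_continuous_image smooth_continuous test_fun_smooth[OF assms]) auto
  then obtain c where c: "\<forall>y\<in>\<phi> ` {a..b}. \<bar>y\<bar> \<le> c" by (auto simp: bounded_iff)
  have "\<bar>\<phi> t\<bar> \<le> max c 0" for t
    using *(4)[rule_format, of t] c by (cases "t \<in> {a..b}") (auto simp: le_max_iff_disj)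
  then show ?thesis using that by blast
qed

section \<open>Distributions\<close>

text \<open>As a type, the test functions form a real vector space, so that \<open>linear\<close> is
  available for functionals on them and distributions become plain functions.\<close>

typedef testfn = test_fun using test_fun_zero by blast

setup_lifting type_definition_testfn

lemma test_fun_scale: "\<phi> \<in> test_fun \<Longrightarrow> (\<lambda>t. c * \<phi> t) \<in> test_fun"
  by (rule test_fun_mult[OF smooth_const])

instantiation testfn :: real_vector begin
lift_definition zero_testfn :: testfn is "\<lambda>_. 0" by (rule test_fun_zero)
lift_definition plus_testfn :: "testfn \<Rightarrow> testfn \<Rightarrow> testfn" is "\<lambda>\<phi> \<psi> t. \<phi> t + \<psi> t"
  by (rule test_fun_add)
lift_definition scaleR_testfn :: "real \<Rightarrow> testfn \<Rightarrow> testfn" is "\<lambda>c \<phi> t. c * \<phi> t"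
  by (rule test_fun_scale)
lift_definition uminus_testfn :: "testfn \<Rightarrow> testfn" is "\<lambda>\<phi> t. - \<phi> t"
  using test_fun_scale[of _ "-1"] by simp
lift_definition minus_testfn :: "testfn \<Rightarrow> testfn \<Rightarrow> testfn" is "\<lambda>\<phi> \<psi> t. \<phi> t - \<psi> t"
  using test_fun_add[OF _ test_fun_scale[of _ "-1"]] by simp
instance
  by standard (transfer; auto simp: algebra_simps fun_eq_iff)+
end

lift_definition dtest :: "testfn \<Rightarrow> testfn" is deriv by (rule test_fun_deriv)

lemma Rep_dtest_pow: "Rep_testfn ((dtest ^^ i) \<phi>) = (deriv ^^ i) (Rep_testfn \<phi>)"
  by (induction i) (auto simp: dtest.rep_eq)

lemma Rep_smooth: "smooth (Rep_testfn \<phi>)"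
  using Rep_testfn test_fun_smooth by blast

type_synonym distribution = "testfn \<Rightarrow> real"

definition ddiff :: "distribution \<Rightarrow> distribution" where
  "ddiff T \<phi> = - T (dtest \<phi>)"

lemma ddiff_pow: "(ddiff ^^ i) T \<phi> = (-1) ^ i * T ((dtest ^^ i) \<phi>)"
proof (induction i arbitrary: \<phi>)
  case (Suc i)
  have "(ddiff ^^ Suc i) T \<phi> = - (ddiff ^^ i) T (dtest \<phi>)" by (simp add: ddiff_def)
  then show ?case by (simp add: Suc.IH funpow_swap1)
qed simp

definition act :: "real poly \<Rightarrow> distribution \<Rightarrow> distribution" where
  "act p T = (\<lambda>\<phi>. \<Sum>i\<le>degree p. coeff p i * (ddiff ^^ i) T \<phi>)"

lemma act_bound: "degree p \<le> N \<Longrightarrow> act p T \<phi> = (\<Sum>i\<le>N. coeff p i * (ddiff ^^ i) T \<phi>)"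
  unfolding act_def by (intro sum.mono_neutral_left) (auto simp: coeff_eq_0)

lemma act_add_left: "act (p + q) T = act p T + act q T"
proof
  fix \<phi>
  let ?N = "max (degree p) (degree q)"
  have "degree (p + q) \<le> ?N" by (rule degree_add_le_max)
  then show "act (p + q) T \<phi> = (act p T + act q T) \<phi>"
    by (simp add: act_bound[of _ ?N] sum.distrib algebra_simps)
qed

lemma ddiff_pow_add: "(ddiff ^^ i) (S + T) = (ddiff ^^ i) S + (ddiff ^^ i) T"
  by (auto simp: ddiff_pow algebra_simps)

lemma act_add_right: "act p (S + T) = act p S + act p T"
  by (auto simp: act_def ddiff_pow_add sum.distrib algebra_simps)

lemma act_pCons: "act (pCons a p) T = (\<lambda>\<phi>. a * T \<phi> + ddiff (act p T) \<phi>)"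
proof
  fix \<phi>
  have "act (pCons a p) T \<phi> = (\<Sum>i\<le>Suc (degree p). coeff (pCons a p) i * (ddiff ^^ i) T \<phi>)"
    by (rule act_bound) (simp add: degree_pCons_le)
  also have "\<dots> = a * T \<phi> + ddiff (act p T) \<phi>"
    by (subst sum.atMost_Suc_shift) (simp add: ddiff_def act_def sum_negf)
  finally show "act (pCons a p) T \<phi> = a * T \<phi> + ddiff (act p T) \<phi>" .
qed

lemma act_0: "act 0 T = 0" by (auto simp: act_def)

lemma act_const: "act [:c:] T = (\<lambda>\<phi>. c * T \<phi>)" by (auto simp: act_def)

lemma act_s: "act [:0, 1:] T = ddiff T"
  by (simp add: act_pCons act_0) (simp add: ddiff_def act_pCons act_0 fun_eq_iff)

lemma act_smult: "act (Polynomial.smult c p) T = (\<lambda>\<phi>. c * act p T \<phi>)"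
  by (auto simp: act_bound[OF degree_smult_le] act_def sum_distrib_left mult.assoc)

lemma act_mult: "act (p * q) T = act p (act q T)"
  by (induction p) (auto simp: act_0 act_add_left act_smult act_pCons)

text \<open>From here on a polynomial matrix acts on vectors of distributions, and an identity
  between polynomial matrices becomes an identity between weak differential operators.\<close>

interpretation act: Modules.module act
  by standard (auto simp: act_add_left act_add_right act_mult, simp add: one_pCons act_const)

lemma act_s_pow: "act (monom 1 k) T = (ddiff ^^ k) T"
proof (induction k)
  case (Suc k)
  have "act (monom 1 (Suc k)) T = ddiff (act (monom 1 k) T)"
    by (simp add: monom_Suc act_pCons fun_eq_iff)
  then show ?case by (simp add: Suc.IH)
qed (simp add: monom_0 act_const)

section \<open>Square-integrable functions as regular distributions\<close>

definition reg :: "(real \<Rightarrow> real) \<Rightarrow> distribution" where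
  "reg f \<phi> = integral_I (\<lambda>t. f t * Rep_testfn \<phi> t)"

lemma I_lebesgue [simp, intro]: "I \<in> sets lebesgue" by simp

lemma finite_lebesgue_I: "finite_measure (lebesgue_on I)"
  by (rule finite_measure_lebesgue_on) simp

lemma L2_integrable: assumes "f \<in> L2" shows "integrable (lebesgue_on I) f"
proof -
  interpret finite_measure "lebesgue_on I" by (rule finite_lebesgue_I)
  have "integrable (lebesgue_on I) (\<lambda>t. 1 + (f t)\<^sup>2)"
    using assms by (auto simp: L2_def)
  then show ?thesis
  proof (rule Bochner_Integration.integrable_bound)
    have "\<bar>x\<bar> \<le> 1 + x\<^sup>2" for x :: real
      using sum_squares_bound[of 1 "\<bar>x\<bar>"] by simp
    then show "AE t in lebesgue_on I. norm (f t) \<le> norm (1 + (f t)\<^sup>2)"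
      by (auto intro!: AE_I2)
  qed (use assms in \<open>simp add: L2_def\<close>)
qed

lemma L2_measurable: "f \<in> L2 \<Longrightarrow> f \<in> borel_measurable (lebesgue_on I)"
  by (simp add: L2_def)

lemma L2_bounded_mult:
  assumes "f \<in> L2" "a \<in> borel_measurable (lebesgue_on I)" "\<And>t. t \<in> I \<Longrightarrow> \<bar>a t\<bar> \<le> c"
  shows "(\<lambda>t. a t * f t) \<in> L2"
proof -
  have "integrable (lebesgue_on I) (\<lambda>t. c\<^sup>2 * (f t)\<^sup>2)" using assms by (simp add: L2_def)
  then have "integrable (lebesgue_on I) (\<lambda>t. (a t * f t)\<^sup>2)"
  proof (rule Bochner_Integration.integrable_bound)
    show "AE t in lebesgue_on I. norm ((a t * f t)\<^sup>2) \<le> norm (c\<^sup>2 * (f t)\<^sup>2)"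
      using assms(3) by (intro AE_I2) (auto simp: power_mult_distrib intro!: mult_right_mono abs_le_square_iff[THEN iffD1] order.trans[OF _ abs_ge_self])
    show "(\<lambda>t. (a t * f t)\<^sup>2) \<in> borel_measurable (lebesgue_on I)"
      by (intro borel_measurable_power borel_measurable_times assms(2) L2_measurable[OF assms(1)])
  qed
  then show ?thesis using assms by (auto simp: L2_def)
qed

lemma L2_const: "(\<lambda>_. c) \<in> L2"
proof -
  interpret finite_measure "lebesgue_on I" by (rule finite_lebesgue_I)
  show ?thesis by (simp add: L2_def)
qed

lemma L2_bounded:
  assumes "a \<in> borel_measurable (lebesgue_on I)" "\<And>t. t \<in> I \<Longrightarrow> \<bar>a t\<bar> \<le> c" shows "a \<in> L2"
  using L2_bounded_mult[OF L2_const[of 1] assms] by simp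

lemma L2_add: assumes "f \<in> L2" "g \<in> L2" shows "(\<lambda>t. f t + g t) \<in> L2"
proof -
  have "integrable (lebesgue_on I) (\<lambda>t. 2 * (f t)\<^sup>2 + 2 * (g t)\<^sup>2)" using assms by (simp add: L2_def)
  then have "integrable (lebesgue_on I) (\<lambda>t. (f t + g t)\<^sup>2)"
  proof (rule Bochner_Integration.integrable_bound)
    have "(x + y)\<^sup>2 \<le> 2 * x\<^sup>2 + 2 * y\<^sup>2" for x y :: real
      using sum_squares_bound[of x y] by (simp add: power2_sum)
    then show "AE t in lebesgue_on I. norm ((f t + g t)\<^sup>2) \<le> norm (2 * (f t)\<^sup>2 + 2 * (g t)\<^sup>2)"
      by (auto intro!: AE_I2)
    show "(\<lambda>t. (f t + g t)\<^sup>2) \<in> borel_measurable (lebesgue_on I)"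
      by (intro borel_measurable_power borel_measurable_add L2_measurable assms)
  qed
  then show ?thesis using assms by (auto simp: L2_def)
qed

lemma continuous_measurable_I: "continuous_on I f \<Longrightarrow> f \<in> borel_measurable (lebesgue_on I)" for f :: "real \<Rightarrow> real"
  by (intro continuous_imp_measurable_on_sets_lebesgue) auto

lemma continuous_bounded_I:
  assumes "continuous_on clI f" shows "\<exists>c. \<forall>t\<in>clI. \<bar>f t :: real\<bar> \<le> c"
proof -
  have "bounded (f ` clI)" using assms by (intro compact_imp_bounded compact_continuous_image) auto
  then show ?thesis by (auto simp: bounded_iff)
qed

lemma L2_continuous_mult:
  assumes "continuous_on clI a" "f \<in> L2" shows "(\<lambda>t. a t * f t) \<in> L2"
proof -
  obtain c where "\<forall>t\<in>clI. \<bar>a t\<bar> \<le> c" using continuous_bounded_I[OF assms(1)] by blast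
  moreover have "continuous_on I a" by (rule continuous_on_subset[OF assms(1)]) auto
  ultimately show ?thesis
    by (intro L2_bounded_mult[of _ _ c] continuous_measurable_I assms(2)) auto
qed

lemma L2_continuous: "continuous_on clI a \<Longrightarrow> a \<in> L2"
  using L2_continuous_mult[OF _ L2_const[of 1]] by simp

lemma L2_smooth_mult: "smooth a \<Longrightarrow> f \<in> L2 \<Longrightarrow> (\<lambda>t. a t * f t) \<in> L2"
  by (intro L2_continuous_mult smooth_continuous)

lemma L2_cmult: "f \<in> L2 \<Longrightarrow> (\<lambda>t. c * f t) \<in> L2"
  by (intro L2_smooth_mult smooth_const)

lemma L2_sum: "(\<And>i. i \<in> A \<Longrightarrow> f i \<in> L2) \<Longrightarrow> (\<lambda>t. \<Sum>i\<in>A. f i t) \<in> L2"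
  by (induction A rule: infinite_finite_induct) (simp_all add: L2_const L2_add)

lemma L2_test_integrable:
  assumes "f \<in> L2" shows "integrable (lebesgue_on I) (\<lambda>t. f t * Rep_testfn \<phi> t)"
proof -
  have "(\<lambda>t. Rep_testfn \<phi> t * f t) \<in> L2" by (intro L2_smooth_mult Rep_smooth assms)
  then show ?thesis using L2_integrable by (simp add: mult.commute)
qed

lemma reg_add: "f \<in> L2 \<Longrightarrow> g \<in> L2 \<Longrightarrow> reg (\<lambda>t. f t + g t) = reg f + reg g"
  by (auto simp: reg_def algebra_simps L2_test_integrable)

lemma reg_cmult: "reg (\<lambda>t. c * f t) = act [:c:] (reg f)"
  by (auto simp: reg_def act_const mult.assoc)

lemma reg_zero: "reg (\<lambda>_. 0) = 0"
  by (auto simp: reg_def)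

lemma reg_sum: "(\<And>i. i \<in> A \<Longrightarrow> f i \<in> L2) \<Longrightarrow> reg (\<lambda>t. \<Sum>i\<in>A. f i t) = (\<Sum>i\<in>A. reg (f i))"
  by (induction A rule: infinite_finite_induct) (simp_all add: reg_zero reg_add L2_sum)

lemma reg_cong: "(\<And>t. t \<in> I \<Longrightarrow> f t = g t) \<Longrightarrow> reg f = reg g"
  unfolding reg_def by (intro ext Bochner_Integration.integral_cong) auto

lemma linear_reg: "f \<in> L2 \<Longrightarrow> linear (reg f)"
  by (intro linearI) (auto simp: reg_def plus_testfn.rep_eq scaleR_testfn.rep_eq algebra_simps L2_test_integrable mult.left_commute)

lemma linear_ddiff: "linear T \<Longrightarrow> linear (ddiff T)"
proof -
  assume T: "linear T"
  have "dtest (\<phi> + \<psi>) = dtest \<phi> + dtest \<psi>" "dtest (c *\<^sub>R \<phi>) = c *\<^sub>R dtest \<phi>" for \<phi> \<psi> c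
    by (auto simp: Rep_testfn_inject[symmetric] dtest.rep_eq plus_testfn.rep_eq scaleR_testfn.rep_eq
        fun_eq_iff intro!: DERIV_imp_deriv DERIV_add DERIV_cmult smooth_has_deriv Rep_smooth)
  then show ?thesis
    by (intro linearI) (auto simp: ddiff_def linear_add[OF T] linear_scale[OF T])
qed

lemma linear_ddiff_pow: "linear T \<Longrightarrow> linear ((ddiff ^^ i) T)"
  by (induction i) (auto intro: linear_ddiff)

text \<open>The integrals of the problem are over Lebesgue measure restricted to \<open>I\<close>,
  whereas Fubini and generator arguments are at home with Borel functions and \<open>lborel\<close>.
  This lemma moves any integrable function there, extended by zero.\<close>

lemma borel_representative:
  assumes "integrable (lebesgue_on I) f"
  obtains h where "integrable lborel h" "\<And>t. t \<notin> I \<Longrightarrow> h t = 0"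
    "AE t in lebesgue_on I. f t = h t"
    "\<And>\<phi>. \<phi> \<in> borel_measurable borel \<Longrightarrow> integral_I (\<lambda>t. f t * \<phi> t) = integral\<^sup>L lborel (\<lambda>t. h t * \<phi> t)"
proof -
  let ?g = "\<lambda>t. if t \<in> I then f t else 0"
  have g: "integrable lebesgue ?g"
  proof -
    have "integrable lebesgue (\<lambda>t. indicat_real I t *\<^sub>R f t)"
      using assms integrable_restrict_space[of I lebesgue f] by simp
    moreover have "(\<lambda>t. indicat_real I t *\<^sub>R f t) = ?g" by (auto simp: indicator_def)
    ultimately show ?thesis by simp
  qed
  obtain h0 where h0: "h0 \<in> borel_measurable lborel" "AE t in lborel. ?g t = h0 t"
    using completion_ex_borel_measurable_real[OF borel_measurable_integrable[OF g]] by blast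
  define h where "h t = indicator I t * h0 t" for t
  have [measurable]: "h \<in> borel_measurable borel" unfolding h_def using h0(1) by measurable
  have AE: "AE t in lborel. ?g t = h t" using h0(2) by eventually_elim (auto simp: h_def indicator_def split: if_splits)
  then have AE': "AE t in lebesgue. ?g t = h t" by (rule AE_completion)
  have "integrable lebesgue h"
    by (rule integrable_cong_AE_imp[OF g])
      (use AE' measurable_completion[of h lborel borel] in \<open>auto elim: eventually_mono\<close>)
  then have 1: "integrable lborel h" by (simp add: integrable_completion)
  have 2: "AE t in lebesgue_on I. f t = h t"
    unfolding AE_restrict_space_iff[of I lebesgue, simplified] using AE' by eventually_elim auto
  have 3: "integral_I (\<lambda>t. f t * \<phi> t) = integral\<^sup>L lborel (\<lambda>t. h t * \<phi> t)" if \<phi>[measurable]: "\<phi> \<in> borel_measurable borel" for \<phi>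
  proof -
    have "\<phi> \<in> borel_measurable lebesgue" using measurable_completion[of \<phi> lborel borel] by simp
    have "integral_I (\<lambda>t. f t * \<phi> t) = integral\<^sup>L lebesgue (\<lambda>t. ?g t * \<phi> t)"
      by (subst integral_restrict_space) (auto intro!: Bochner_Integration.integral_cong simp: indicator_def)
    also have "\<dots> = integral\<^sup>L lebesgue (\<lambda>t. h t * \<phi> t)"
    proof (rule integral_cong_AE)
      show "AE t in lebesgue. ?g t * \<phi> t = h t * \<phi> t" using AE' by eventually_elim simp
      show "(\<lambda>t. ?g t * \<phi> t) \<in> borel_measurable lebesgue"
        by (intro borel_measurable_times borel_measurable_integrable[OF g] \<open>\<phi> \<in> borel_measurable lebesgue\<close>)
      show "(\<lambda>t. h t * \<phi> t) \<in> borel_measurable lebesgue"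
        by (intro borel_measurable_times borel_measurable_integrable[OF \<open>integrable lebesgue h\<close>] \<open>\<phi> \<in> borel_measurable lebesgue\<close>)
    qed
    also have "\<dots> = integral\<^sup>L lborel (\<lambda>t. h t * \<phi> t)"
      by (rule integral_completion) simp
    finally show ?thesis .
  qed
  show ?thesis by (rule that[OF 1 _ 2 3]) (auto simp: h_def)
qed

lemma borel_Rep: "Rep_testfn \<phi> \<in> borel_measurable borel"
  by (intro borel_measurable_continuous_onI smooth_continuous Rep_smooth)

text \<open>The Borel sets over which \<open>h\<close> integrates to zero form a Dynkin system
  (\<open>total\<close> handles complements), and the open intervals are an intersection-stable
  generator of the Borel sets.\<close>

lemma lborel_eq_0_by_intervals:
  fixes h :: "real \<Rightarrow> real"
  assumes h: "integrable lborel h"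
    and zero: "\<And>a b. a < b \<Longrightarrow> integral\<^sup>L lborel (\<lambda>t. h t * indicator {a<..<b} t) = 0"
    and total: "integral\<^sup>L lborel h = 0"
  shows "AE t in lborel. h t = 0"
proof -
  have int: "integrable lborel (\<lambda>t. h t * indicator A t)" if "A \<in> sets borel" for A
    using integrable_mult_indicator[of A lborel h] h that by (simp add: mult.commute)
  let ?G = "range (\<lambda>(a, b). {a<..<b :: real})"
  have G: "sets borel = sigma_sets UNIV ?G"
    by (subst borel_eq_box) (simp add: case_prod_beta')
  have "integral\<^sup>L lborel (\<lambda>t. h t * indicator A t) = 0" if "A \<in> sigma_sets UNIV ?G" for A
  proof (rule sigma_sets_induct_disjoint[OF _ _ that, where P = "\<lambda>A. integral\<^sup>L lborel (\<lambda>t. h t * indicator A t) = 0"])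
    show "Int_stable ?G"
    proof (rule Int_stableI)
      fix A B assume "A \<in> ?G" "B \<in> ?G"
      then obtain a b c d where "A = {a<..<b}" "B = {c<..<d}" by auto
      then have "A \<inter> B = {max a c<..<min b d}" by auto
      then show "A \<inter> B \<in> ?G" by auto
    qed
    show "?G \<subseteq> Pow UNIV" by auto
  next
    fix A assume "A \<in> ?G"
    then obtain a b where A: "A = {a<..<b}" by auto
    show "integral\<^sup>L lborel (\<lambda>t. h t * indicator A t) = 0"
      using zero[of a b] by (cases "a < b") (simp_all add: A)
  next
    fix A assume A: "A \<in> sigma_sets UNIV ?G" "integral\<^sup>L lborel (\<lambda>t. h t * indicator A t) = 0"
    have "A \<in> sets borel" using A(1) by (simp add: G)
    then have "integral\<^sup>L lborel (\<lambda>t. h t - h t * indicator A t) = 0"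
      using A(2) total h int by (subst Bochner_Integration.integral_diff) auto
    moreover have "(\<lambda>t. h t - h t * indicator A t) = (\<lambda>t. h t * indicator (UNIV - A) t)"
      by (auto simp: indicator_def)
    ultimately show "integral\<^sup>L lborel (\<lambda>t. h t * indicator (UNIV - A) t) = 0" by simp
  next
    fix A :: "nat \<Rightarrow> real set"
    assume A: "disjoint_family A" "range A \<subseteq> sigma_sets UNIV ?G"
      "\<And>i. integral\<^sup>L lborel (\<lambda>t. h t * indicator (A i) t) = 0"
    have sets: "A i \<in> sets borel" for i using A(2) by (auto simp: G)
    have U: "(\<Union>i. A i) \<in> sets borel" using sets by auto
    have "(LINT t:(\<Union>i. A i)|lborel. h t) = (\<Sum>i. LINT t:A i|lborel. h t)"
    proof (rule lebesgue_integral_countable_add)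
      show "set_integrable lborel (\<Union>i. A i) h"
        using int[OF U] by (simp add: set_integrable_def mult.commute)
    qed (use sets A(1) in \<open>auto simp: disjoint_family_on_def\<close>)
    also have "\<dots> = 0" using A(3) by (simp add: set_lebesgue_integral_def mult.commute)
    finally show "integral\<^sup>L lborel (\<lambda>t. h t * indicator (\<Union>i. A i) t) = 0"
      by (simp add: set_lebesgue_integral_def mult.commute)
  qed simp
  then have "integral\<^sup>L lborel (\<lambda>t. h t * indicator A t) = 0" if "A \<in> sets borel" for A
    using that by (simp add: G)
  then show ?thesis
    by (intro density_unique_real h)
      (auto simp: set_lebesgue_integral_def mult.commute)
qed

text \<open>The fundamental lemma of the calculus of variations: bumps converge to indicators of
  intervals, dominated by 1, so the integral over every interval vanishes.\<close>

lemma reg_eq_0_imp_AE: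
  assumes f: "f \<in> L2" and zero: "reg f = 0"
  shows "AE t in lebesgue_on I. f t = 0"
proof -
  obtain h where h: "integrable lborel h" "\<And>t. t \<notin> I \<Longrightarrow> h t = 0" "AE t in lebesgue_on I. f t = h t"
    "\<And>\<phi>. \<phi> \<in> borel_measurable borel \<Longrightarrow> integral_I (\<lambda>t. f t * \<phi> t) = integral\<^sup>L lborel (\<lambda>t. h t * \<phi> t)"
    using borel_representative[OF L2_integrable[OF f]] by blast
  have *: "integral\<^sup>L lborel (\<lambda>t. h t * indicator {a<..<b} t) = 0" if "-1 \<le> a" "b \<le> 1" for a b
  proof -
    have test: "bump a b (real (Suc k)) \<in> test_fun" for k by (rule test_fun_bump) (use that in auto)
    have meas: "bump a b (real (Suc k)) \<in> borel_measurable borel" for k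
      by (intro borel_measurable_continuous_onI smooth_continuous smooth_bump)
    have "integral\<^sup>L lborel (\<lambda>t. h t * bump a b (real (Suc k)) t) = 0" for k
    proof -
      have "reg f (Abs_testfn (bump a b (real (Suc k)))) = 0" using zero by simp
      then show ?thesis
        unfolding reg_def Abs_testfn_inverse[OF test] h(4)[OF meas] .
    qed
    moreover have "(\<lambda>k. integral\<^sup>L lborel (\<lambda>t. h t * bump a b (real (Suc k)) t))
        \<longlonglongrightarrow> integral\<^sup>L lborel (\<lambda>t. h t * indicator {a<..<b} t)"
    proof (rule integral_dominated_convergence[where w = "\<lambda>t. \<bar>h t\<bar>"])
      show "(\<lambda>t. h t * indicator {a<..<b} t) \<in> borel_measurable lborel"
        using h(1) by (intro borel_measurable_times) auto
      show "(\<lambda>t. h t * bump a b (real (Suc k)) t) \<in> borel_measurable lborel" for k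
        using h(1) meas by (intro borel_measurable_times) auto
      show "AE t in lborel. (\<lambda>k. h t * bump a b (real (Suc k)) t) \<longlonglongrightarrow> h t * indicator {a<..<b} t"
        by (intro AE_I2 tendsto_mult tendsto_const bump_tendsto)
      show "AE t in lborel. norm (h t * bump a b (real (Suc k)) t) \<le> \<bar>h t\<bar>" for k
        using bump_bounds by (intro AE_I2) (auto simp: abs_mult mult_left_le)
    qed (use h(1) in simp)
    ultimately show ?thesis by (simp add: LIMSEQ_const_iff)
  qed
  have "AE t in lborel. h t = 0"
  proof (rule lborel_eq_0_by_intervals[OF h(1)])
    fix a b :: real
    \<comment> \<open>Since \<open>h\<close> vanishes outside \<open>I\<close>, an arbitrary
      interval may be clipped to \<open>I\<close>, where bumps are test functions.\<close>
    have "h t * indicator {a<..<b} t = h t * indicator {max a (-1)<..<min b 1} t" for t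
      by (cases "t \<in> I") (auto simp: indicator_def h(2))
    then show "integral\<^sup>L lborel (\<lambda>t. h t * indicator {a<..<b} t) = 0"
      using *[of "max a (-1)" "min b 1"] by (simp only: max.cobounded2 min.cobounded2)
  next
    have "h t = h t * indicator {-1<..<1} t" for t
      by (cases "t \<in> I") (auto simp: indicator_def h(2))
    then have "integral\<^sup>L lborel h = integral\<^sup>L lborel (\<lambda>t. h t * indicator {-1<..<1} t)"
      by (intro Bochner_Integration.integral_cong) auto
    then show "integral\<^sup>L lborel h = 0" using *[of "-1" 1] by simp
  qed
  then have "AE t in lebesgue. h t = 0" by (rule AE_completion)
  then have "AE t in lebesgue_on I. h t = 0"
    unfolding AE_restrict_space_iff[of I lebesgue, simplified] by eventually_elim auto
  with h(3) show ?thesis by eventually_elim simp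
qed

lemma reg_eq_imp_AE:
  assumes "f \<in> L2" "g \<in> L2" "reg f = reg g"
  shows "AE t in lebesgue_on I. f t = g t"
proof -
  have g: "(\<lambda>t. (-1) * g t) \<in> L2" by (rule L2_cmult[OF assms(2)])
  have "reg (\<lambda>t. f t + (-1) * g t) = 0"
    unfolding reg_add[OF assms(1) g] reg_cmult act_const assms(3) by (simp add: fun_eq_iff)
  then have "AE t in lebesgue_on I. f t + (-1) * g t = 0"
    by (intro reg_eq_0_imp_AE L2_add assms(1) g)
  then show ?thesis by eventually_elim simp
qed

lemma reg_cong_AE:
  assumes "f \<in> L2" "g \<in> L2" "AE t in lebesgue_on I. f t = g t" shows "reg f = reg g"
  unfolding reg_def using L2_test_integrable[OF assms(1)] L2_test_integrable[OF assms(2)] assms(3)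
  by (intro ext integral_cong_AE) (auto elim: eventually_mono)

text \<open>The fundamental theorem in distributional form: the derivative of the unit jump at
  \<open>s\<close> is evaluation at \<open>s\<close>. It is the inner integral in the Fubini
  argument for primitives.\<close>

lemma integral_deriv_test:
  assumes "s \<le> 1"
  shows "integral\<^sup>L lborel (\<lambda>t. indicator {s<..} t * Rep_testfn (dtest \<phi>) t) = - Rep_testfn \<phi> s"
    and "integrable lborel (\<lambda>t. indicator {s<..} t * Rep_testfn (dtest \<phi>) t)"
proof -
  have supp: "Rep_testfn \<phi> t = 0" if "t \<notin> I" for t \<phi>
    using test_fun_support[of "Rep_testfn \<phi>"] Rep_testfn that by fastforce
  let ?f = "\<lambda>t. Rep_testfn (dtest \<phi>) t * indicator {s..1} t"
  have "has_bochner_integral lborel ?f (Rep_testfn \<phi> 1 - Rep_testfn \<phi> s)"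
    using assms
    by (intro has_bochner_integral_FTC_Icc_real)
      (auto simp: dtest.rep_eq intro!: smooth_has_deriv Rep_smooth DERIV_isCont[OF smooth_has_deriv] smooth_deriv)
  then have f: "integrable lborel ?f" "integral\<^sup>L lborel ?f = - Rep_testfn \<phi> s"
    by (auto simp: has_bochner_integral_iff supp)
  have AE: "AE t in lborel. ?f t = indicator {s<..} t * Rep_testfn (dtest \<phi>) t"
    using AE_lborel_singleton[of s] by eventually_elim (auto simp: indicator_def supp)
  have meas: "(\<lambda>t. indicator {s<..} t * Rep_testfn (dtest \<phi>) t) \<in> borel_measurable lborel"
    using borel_Rep[of "dtest \<phi>"] by (intro borel_measurable_times) auto
  show "integrable lborel (\<lambda>t. indicator {s<..} t * Rep_testfn (dtest \<phi>) t)"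
    by (rule integrable_cong_AE_imp[OF f(1) meas]) (use AE in \<open>auto elim: eventually_mono\<close>)
  show "integral\<^sup>L lborel (\<lambda>t. indicator {s<..} t * Rep_testfn (dtest \<phi>) t) = - Rep_testfn \<phi> s"
    unfolding f(2)[symmetric]
    by (rule integral_cong_AE) (use AE meas borel_measurable_integrable[OF f(1)] in \<open>auto elim: eventually_mono\<close>)
qed

definition primitive :: "(real \<Rightarrow> real) \<Rightarrow> real \<Rightarrow> real" where
  "primitive f t = integral_I (\<lambda>s. f s * indicator {..<t} s)"

text \<open>Testing the derivative gives a double integral over the region s < t. Fubini integrates
  the test function first, where \<open>integral_deriv_test\<close> produces its value at s.\<close>

lemma primitive_props:
  assumes f: "f \<in> L2"
  shows "primitive f \<in> L2" "ddiff (reg (primitive f)) = reg f"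
proof -
  obtain h where h: "integrable lborel h" "\<And>t. t \<notin> I \<Longrightarrow> h t = 0" "AE t in lebesgue_on I. f t = h t"
    and rep: "\<And>\<phi>. \<phi> \<in> borel_measurable borel \<Longrightarrow> integral_I (\<lambda>t. f t * \<phi> t) = integral\<^sup>L lborel (\<lambda>t. h t * \<phi> t)"
    using borel_representative[OF L2_integrable[OF f]] by blast
  have [measurable]: "h \<in> borel_measurable borel" using h(1) by auto
  have V: "primitive f t = integral\<^sup>L lborel (\<lambda>s. h s * (if s < t then 1 else 0))" for t
    unfolding primitive_def by (subst rep) (auto simp: indicator_def intro!: Bochner_Integration.integral_cong)
  have meas: "primitive f \<in> borel_measurable borel" unfolding V by measurable
  have "primitive f \<in> borel_measurable lebesgue" using meas measurable_completion[of _ lborel borel] by simp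
  then have "primitive f \<in> borel_measurable (lebesgue_on I)" by (rule measurable_restrict_space1)
  moreover have "\<bar>primitive f t\<bar> \<le> integral\<^sup>L lborel (\<lambda>s. \<bar>h s\<bar>)" for t
  proof -
    have "norm (primitive f t) \<le> integral\<^sup>L lborel (\<lambda>s. norm (h s * (if s < t then 1 else 0)))"
      unfolding V by (rule integral_norm_bound)
    also have "\<dots> \<le> integral\<^sup>L lborel (\<lambda>s. \<bar>h s\<bar>)"
      by (rule integral_mono') (use h(1) in auto)
    finally show ?thesis by simp
  qed
  ultimately show "primitive f \<in> L2" by (rule L2_bounded)
  show "ddiff (reg (primitive f)) = reg f"
  proof
    fix \<phi>
    let ?\<psi> = "Rep_testfn (dtest \<phi>)"
    let ?F = "\<lambda>s t. h s * (indicator {s<..} t * ?\<psi> t)"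
    have [measurable]: "?\<psi> \<in> borel_measurable borel" "Rep_testfn \<phi> \<in> borel_measurable borel" by (rule borel_Rep)+
    obtain c where c: "\<And>t. \<bar>?\<psi> t\<bar> \<le> c" using test_fun_bounded[OF Rep_testfn] by blast
    have supp: "Rep_testfn \<phi> t = 0" if "t \<notin> I" for t \<phi>
      using test_fun_support[of "Rep_testfn \<phi>"] Rep_testfn that by fastforce
    have m: "(\<lambda>(s, t). ?F s t) \<in> borel_measurable (lborel \<Otimes>\<^sub>M lborel)"
    proof -
      have "(\<lambda>(s, t). h s * ((if s < t then 1 else 0) * ?\<psi> t)) \<in> borel_measurable (lborel \<Otimes>\<^sub>M lborel)"
        by measurable
      moreover have "(\<lambda>(s, t). h s * ((if s < t then 1 else 0) * ?\<psi> t)) = (\<lambda>(s, t). ?F s t)"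
        by (auto simp: indicator_def)
      ultimately show ?thesis by simp
    qed
    have inner: "integrable lborel (?F s)" for s
    proof (cases "s \<in> I")
      case True
      then show ?thesis by (intro Bochner_Integration.integrable_mult_right integral_deriv_test) auto
    qed (simp add: h(2))
    \<comment> \<open>\<open>c\<close> bounds the test function and 2 is the length of
      \<open>{-1..1}\<close>, outside of which it vanishes.\<close>
    have inner_bound: "integral\<^sup>L lborel (\<lambda>t. norm (?F s t)) \<le> \<bar>h s\<bar> * (2 * c)" for s
    proof -
      have "integral\<^sup>L lborel (\<lambda>t. norm (?F s t)) \<le> integral\<^sup>L lborel (\<lambda>t. \<bar>h s\<bar> * (c * indicator {-1..1::real} t))"
      proof (rule integral_mono')
        show "norm (?F s t) \<le> \<bar>h s\<bar> * (c * indicator {-1..1} t)" for t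
        proof -
          have "\<bar>indicator {s<..} t * ?\<psi> t\<bar> \<le> c * indicator {-1..1} t"
          proof (cases "t \<in> I")
            case True
            then show ?thesis using c[of t] order.trans[OF abs_ge_zero c] by (auto simp: indicator_def)
          next
            case False
            then show ?thesis using supp[OF False, of "dtest \<phi>"] order.trans[OF abs_ge_zero c] by simp
          qed
          then show ?thesis by (simp add: abs_mult mult_left_mono)
        qed
      qed (auto simp: mult_nonneg_nonneg order.trans[OF abs_ge_zero c])
      also have "\<dots> = \<bar>h s\<bar> * (2 * c)" by simp
      finally show ?thesis .
    qed
    have int: "integrable (lborel \<Otimes>\<^sub>M lborel) (\<lambda>(s, t). ?F s t)"
    proof (rule lborel_pair.Fubini_integrable[OF m])
      show "integrable lborel (\<lambda>s. LBINT t. norm (case (s, t) of (s, t) \<Rightarrow> ?F s t))"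
      proof (rule Bochner_Integration.integrable_bound[where f = "\<lambda>s. \<bar>h s\<bar> * (2 * c)"])
        show "integrable lborel (\<lambda>s. \<bar>h s\<bar> * (2 * c))" using h(1) by auto
        show "(\<lambda>s. LBINT t. norm (case (s, t) of (s, t) \<Rightarrow> ?F s t)) \<in> borel_measurable lborel"
          using m by measurable
        show "AE s in lborel. norm (LBINT t. norm (case (s, t) of (s, t) \<Rightarrow> ?F s t)) \<le> norm (\<bar>h s\<bar> * (2 * c))"
          using inner_bound by (intro AE_I2) (auto intro: order.trans[OF _ abs_ge_self])
      qed
      show "AE s in lborel. integrable lborel (\<lambda>t. case (s, t) of (s, t) \<Rightarrow> ?F s t)"
        using inner by simp
    qed
    have "reg (primitive f) (dtest \<phi>) = integral\<^sup>L lborel (\<lambda>t. primitive f t * ?\<psi> t)"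
    proof -
      have meas': "(\<lambda>t. primitive f t * ?\<psi> t) \<in> borel_measurable borel" using meas by measurable
      have "reg (primitive f) (dtest \<phi>) = integral\<^sup>L lebesgue (\<lambda>t. indicator I t *\<^sub>R (primitive f t * ?\<psi> t))"
        unfolding reg_def by (rule integral_restrict_space) simp
      also have "\<dots> = integral\<^sup>L lebesgue (\<lambda>t. primitive f t * ?\<psi> t)"
        using supp[of _ "dtest \<phi>"] by (intro Bochner_Integration.integral_cong) (auto simp: indicator_def)
      also have "\<dots> = integral\<^sup>L lborel (\<lambda>t. primitive f t * ?\<psi> t)"
        using meas' by (intro integral_completion) simp
      finally show ?thesis .
    qed
    also have "\<dots> = integral\<^sup>L lborel (\<lambda>t. integral\<^sup>L lborel (\<lambda>s. ?F s t))"
    proof (intro Bochner_Integration.integral_cong refl)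
      fix t
      have "primitive f t * ?\<psi> t = integral\<^sup>L lborel (\<lambda>s. h s * (if s < t then 1 else 0) * ?\<psi> t)"
        unfolding V by simp
      also have "\<dots> = integral\<^sup>L lborel (\<lambda>s. ?F s t)"
        by (intro Bochner_Integration.integral_cong) (auto simp: indicator_def)
      finally show "primitive f t * ?\<psi> t = integral\<^sup>L lborel (\<lambda>s. ?F s t)" .
    qed
    also have "\<dots> = integral\<^sup>L lborel (\<lambda>s. integral\<^sup>L lborel (?F s))"
      by (rule lborel_pair.Fubini_integral[OF int])
    also have "\<dots> = integral\<^sup>L lborel (\<lambda>s. h s * (- Rep_testfn \<phi> s))"
    proof (intro Bochner_Integration.integral_cong refl)
      fix s show "integral\<^sup>L lborel (?F s) = h s * (- Rep_testfn \<phi> s)"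
      proof (cases "s \<in> I")
        case True
        then show ?thesis by (simp add: integral_deriv_test)
      qed (simp add: h(2))
    qed
    also have "\<dots> = - reg f \<phi>" unfolding reg_def by (simp add: rep)
    finally show "ddiff (reg (primitive f)) \<phi> = reg f \<phi>" by (simp add: ddiff_def)
  qed
qed

lemma ddiff_reg_const: "ddiff (reg (\<lambda>_. c)) = 0"
proof
  fix \<phi>
  have supp: "Rep_testfn \<phi> t = 0" if "t \<notin> I" for t \<phi>
    using test_fun_support[of "Rep_testfn \<phi>"] Rep_testfn that by fastforce
  have "reg (\<lambda>_. c) (dtest \<phi>) = integral\<^sup>L lebesgue (\<lambda>t. indicator I t *\<^sub>R (c * Rep_testfn (dtest \<phi>) t))"
    unfolding reg_def by (rule integral_restrict_space) simp
  also have "\<dots> = integral\<^sup>L lebesgue (\<lambda>t. c * (indicator {-1<..} t * Rep_testfn (dtest \<phi>) t))"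
    using supp[of _ "dtest \<phi>"] by (intro Bochner_Integration.integral_cong) (auto simp: indicator_def)
  also have "\<dots> = integral\<^sup>L lborel (\<lambda>t. c * (indicator {-1<..} t * Rep_testfn (dtest \<phi>) t))"
    using borel_Rep[of "dtest \<phi>"] by (intro integral_completion) measurable
  also have "\<dots> = 0" using integral_deriv_test(1)[of "-1" \<phi>] supp[of "-1" \<phi>] by simp
  finally show "ddiff (reg (\<lambda>_. c)) \<phi> = 0 \<phi>" by (simp add: ddiff_def)
qed

section \<open>Linear differential systems\<close>

lemma AE_I_False: "\<not> (AE t in lebesgue_on I. False)"
proof
  assume "AE t in lebesgue_on I. False"
  then have "AE t in lebesgue. t \<notin> I" by (simp add: AE_restrict_space_iff[of I lebesgue, simplified])
  then have "I \<in> null_sets lebesgue" by (subst AE_iff_null_sets) auto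
  then have "emeasure lborel I = 0" by auto
  then show False by simp
qed

lemma Rep_outside: "t \<notin> I \<Longrightarrow> Rep_testfn \<phi> t = 0"
  using test_fun_support[of "Rep_testfn \<phi>"] Rep_testfn by fastforce

lemma testfn_eqI: "(\<And>t. Rep_testfn \<phi> t = Rep_testfn \<psi> t) \<Longrightarrow> \<phi> = \<psi>"
  by (simp add: Rep_testfn_inject[symmetric] fun_eq_iff)

text \<open>A vanishing total integral makes the primitive return to zero on the right of the
  support, so that the primitive has compact support in \<open>I\<close> as well.\<close>

lemma testfn_primitive:
  assumes zero: "reg (\<lambda>_. 1) \<chi> = 0"
  obtains \<theta> where "\<chi> = dtest \<theta>"
proof -
  let ?f = "Rep_testfn \<chi>"
  obtain a b where ab: "-1 < a" "a < b" "b < 1" "\<forall>t. t \<notin> {a..b} \<longrightarrow> ?f t = 0"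
    using test_fun_support[of ?f] Rep_testfn by blast
  \<comment> \<open>The base point -2 lies to the left of \<open>I\<close>, and
    \<open>{-2<..<2}\<close> contains the support, so the derivative within \<open>{-2..2}\<close>
    is an ordinary one there.\<close>
  define \<theta> where "\<theta> t = integral {-2..t} ?f" for t
  have "integrable (lebesgue_on I) ?f" using L2_test_integrable[OF L2_const[of 1], of \<chi>] by simp
  then have "(?f has_integral (integral_I ?f)) I" by (rule has_integral_integral_lebesgue_on) simp
  then have "(?f has_integral 0) I" using zero by (simp add: reg_def)
  then have "((\<lambda>t. if t \<in> I then ?f t else 0) has_integral 0) UNIV" by (simp only: has_integral_restrict_UNIV)
  moreover have "(\<lambda>t. if t \<in> I then ?f t else 0) = ?f" using Rep_outside[of _ \<chi>] by (auto simp: fun_eq_iff)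
  ultimately have U: "(?f has_integral 0) UNIV" by simp
  have right: "\<theta> t = 0" if "t > b" for t
  proof -
    have "(\<lambda>s. if s \<in> {-2..t} then ?f s else 0) = ?f"
    proof
      fix s show "(if s \<in> {-2..t} then ?f s else 0) = ?f s" using ab(4)[rule_format, of s] ab(1) that by auto
    qed
    then have "((\<lambda>s. if s \<in> {-2..t} then ?f s else 0) has_integral 0) UNIV" using U by simp
    then have "(?f has_integral 0) {-2..t}" by (simp only: has_integral_restrict_UNIV)
    then show ?thesis unfolding \<theta>_def by (rule integral_unique)
  qed
  have left: "\<theta> t = 0" if "t < a" for t
    unfolding \<theta>_def
  proof (rule integral_unique[OF has_integral_is_0])
    fix s assume "s \<in> {-2..t}"
    then show "?f s = 0" using ab(4) that by auto
  qed
  have deriv: "(\<theta> has_real_derivative ?f t) (at t)" for t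
  proof -
    consider "t < a" | "t > b" | "t \<in> {-2<..<2}" using ab(1-3) by force
    then show ?thesis
    proof cases
      case 1
      have "((\<lambda>_. 0) has_real_derivative ?f t) (at t)" using ab(4) 1 by auto
      then show ?thesis
        by (rule has_field_derivative_transform_within_open[where S = "{..<a}"]) (use 1 left in auto)
    next
      case 2
      have "((\<lambda>_. 0) has_real_derivative ?f t) (at t)" using ab(4) 2 by auto
      then show ?thesis
        by (rule has_field_derivative_transform_within_open[where S = "{b<..}"]) (use 2 right in auto)
    next
      case 3
      have "(\<theta> has_real_derivative ?f t) (at t within {-2..2})"
        unfolding \<theta>_def[abs_def]
        by (rule integral_has_real_derivative) (use 3 in \<open>auto intro: smooth_continuous Rep_smooth\<close>)
      then have "(\<theta> has_real_derivative ?f t) (at t within {-2<..<2})"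
        by (rule DERIV_subset) auto
      then show ?thesis by (simp only: at_within_open[OF 3 open_greaterThanLessThan])
    qed
  qed
  then have "smooth \<theta>" by (rule smoothI[OF _ Rep_smooth])
  then have "\<theta> \<in> test_fun"
  proof (rule test_fun_closure_I[of _ a b])
    show "\<theta> t = 0" if "t \<notin> {a..b}" for t using left[of t] right[of t] that by force
    show "{a..b} \<subseteq> I" using ab(1,3) by auto
  qed
  then have "\<chi> = dtest (Abs_testfn \<theta>)"
    by (intro testfn_eqI) (simp add: dtest.rep_eq Abs_testfn_inverse DERIV_imp_deriv[OF deriv])
  then show ?thesis by (rule that)
qed

text \<open>Such a functional vanishes on all derivatives of test functions, that is, on all test
  functions of integral zero. Subtracting from any test function a multiple of a fixed one with
  nonzero integral leads to this case, so a single value determines \<open>T\<close>.\<close>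

lemma ddiff_eq_0_imp_const:
  assumes T: "linear T" "ddiff T = 0"
  obtains c where "T = reg (\<lambda>_. c)"
proof -
  have one: "linear (reg (\<lambda>_. 1))" by (rule linear_reg[OF L2_const])
  obtain \<psi> where \<psi>: "reg (\<lambda>_. 1) \<psi> \<noteq> 0"
  proof (rule ccontr)
    assume "\<not> thesis"
    then have "reg (\<lambda>_. 1) = 0" using that by (auto simp: fun_eq_iff)
    then have "AE t in lebesgue_on I. (1 :: real) = 0" by (rule reg_eq_0_imp_AE[OF L2_const])
    then show False using AE_I_False by simp
  qed
  have "T \<phi> = reg (\<lambda>_. T \<psi> / reg (\<lambda>_. 1) \<psi>) \<phi>" for \<phi>
  proof -
    define m where "m = reg (\<lambda>_. 1) \<phi> / reg (\<lambda>_. 1) \<psi>"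
    have "reg (\<lambda>_. 1) (\<phi> - m *\<^sub>R \<psi>) = 0"
      using \<psi> by (simp add: linear_diff[OF one] linear_scale[OF one] m_def)
    then obtain \<theta> where "\<phi> - m *\<^sub>R \<psi> = dtest \<theta>" by (rule testfn_primitive)
    then have "T (\<phi> - m *\<^sub>R \<psi>) = 0"
      using fun_cong[OF T(2), of \<theta>] by (simp add: ddiff_def)
    then have "T \<phi> = T \<psi> / reg (\<lambda>_. 1) \<psi> * reg (\<lambda>_. 1) \<phi>"
      by (simp add: linear_diff[OF T(1)] linear_scale[OF T(1)] m_def)
    then show ?thesis by (simp add: reg_def)
  qed
  then show ?thesis using that by blast
qed

text \<open>Multiplication of a distribution by a smooth function is done on its argument.
  \<open>Abs_testfn\<close> returns the intended function only for smooth \<open>a\<close>, hence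
  the smoothness conditions in the rules for \<open>smul\<close>.\<close>

definition smul :: "(real \<Rightarrow> real) \<Rightarrow> testfn \<Rightarrow> testfn" where
  "smul a \<phi> = Abs_testfn (\<lambda>t. a t * Rep_testfn \<phi> t)"

lemma Rep_smul: "smooth a \<Longrightarrow> Rep_testfn (smul a \<phi>) t = a t * Rep_testfn \<phi> t"
  unfolding smul_def by (subst Abs_testfn_inverse) (auto intro: test_fun_mult Rep_testfn)

lemma linear_smul: "smooth a \<Longrightarrow> linear (smul a)"
  by (intro linearI testfn_eqI) (auto simp: Rep_smul plus_testfn.rep_eq scaleR_testfn.rep_eq algebra_simps)

lemma smul_smul: "smooth a \<Longrightarrow> smooth b \<Longrightarrow> smul a (smul b \<phi>) = smul (\<lambda>t. a t * b t) \<phi>"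
  by (intro testfn_eqI) (auto simp: Rep_smul smooth_mult)

lemma Rep_sum: "Rep_testfn (\<Sum>i\<in>A. f i) t = (\<Sum>i\<in>A. Rep_testfn (f i) t)"
  by (induction A rule: infinite_finite_induct) (auto simp: zero_testfn.rep_eq plus_testfn.rep_eq)

lemma smul_dtest:
  assumes "smooth a" "\<And>t. (a has_real_derivative a' t) (at t)" "smooth a'"
  shows "smul a (dtest \<phi>) = dtest (smul a \<phi>) - smul a' \<phi>"
proof (rule testfn_eqI)
  fix t
  have "((\<lambda>t. a t * Rep_testfn \<phi> t) has_real_derivative
      a' t * Rep_testfn \<phi> t + deriv (Rep_testfn \<phi>) t * a t) (at t)"
    by (intro DERIV_mult assms smooth_has_deriv Rep_smooth)
  then have "deriv (Rep_testfn (smul a \<phi>)) t = a' t * Rep_testfn \<phi> t + deriv (Rep_testfn \<phi>) t * a t"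
    by (intro DERIV_imp_deriv) (simp add: Rep_smul[OF assms(1), THEN ext, of "\<lambda>_. \<phi>", simplified])
  then show "Rep_testfn (smul a (dtest \<phi>)) t = Rep_testfn (dtest (smul a \<phi>) - smul a' \<phi>) t"
    using assms by (simp add: Rep_smul minus_testfn.rep_eq dtest.rep_eq algebra_simps)
qed

lemma reg_smul: "smooth a \<Longrightarrow> reg f (smul a \<phi>) = reg (\<lambda>t. a t * f t) \<phi>"
  by (simp add: reg_def Rep_smul mult_ac)

text \<open>The classical product rule for the test function, read as \<open>smul_dtest\<close>, is
  transposed to the functional.\<close>

lemma ddiff_smooth_mult:
  assumes a: "smooth a" "\<And>t. (a has_real_derivative a' t) (at t)" "smooth a'"
    and G: "G \<in> L2" "ddiff (reg G) = reg g"
  shows "ddiff (reg (\<lambda>t. a t * G t)) = reg (\<lambda>t. a' t * G t) + reg (\<lambda>t. a t * g t)"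
proof
  fix \<phi>
  have "ddiff (reg (\<lambda>t. a t * G t)) \<phi> = - reg G (dtest (smul a \<phi>) - smul a' \<phi>)"
    unfolding ddiff_def reg_smul[OF a(1), symmetric] smul_dtest[OF a] ..
  also have "\<dots> = ddiff (reg G) (smul a \<phi>) + reg G (smul a' \<phi>)"
    by (simp add: linear_diff[OF linear_reg[OF G(1)]] ddiff_def)
  finally show "ddiff (reg (\<lambda>t. a t * G t)) \<phi> = (reg (\<lambda>t. a' t * G t) + reg (\<lambda>t. a t * g t)) \<phi>"
    using a by (simp add: G(2) reg_smul)
qed

section \<open>Matrices as functions of indices and the matrix exponential\<close>

definition mm :: "nat \<Rightarrow> (nat \<Rightarrow> nat \<Rightarrow> 'a) \<Rightarrow> (nat \<Rightarrow> nat \<Rightarrow> 'a) \<Rightarrow> nat \<Rightarrow> nat \<Rightarrow> 'a :: comm_ring_1" where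
  "mm n A B i j = (\<Sum>l<n. A i l * B l j)"

definition idm :: "nat \<Rightarrow> nat \<Rightarrow> 'a :: comm_ring_1" where
  "idm i j = (if i = j then 1 else 0)"

text \<open>\<open>mm n\<close> carries only the inner dimension, so associativity holds for all
  indices. Bounds on indices enter where \<open>idm\<close> meets a finite range.\<close>

lemma mm_assoc: "mm n A (mm k B C) = mm k (mm n A B) C"
  by (intro ext) (simp add: mm_def sum_distrib_left sum_distrib_right mult.assoc, rule sum.swap)

lemma mm_idm_left: "i < n \<Longrightarrow> mm n idm B i j = B i j"
  by (simp add: mm_def idm_def if_distrib[of "\<lambda>x. x * _"] sum.delta cong: if_cong)

lemma mm_idm_right: "j < n \<Longrightarrow> mm n A idm i j = A i j"
  by (simp add: mm_def idm_def if_distrib[of "\<lambda>x. _ * x"] sum.delta cong: if_cong)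

lemma mm_cong: "(\<And>l. l < n \<Longrightarrow> A i l = A' i l) \<Longrightarrow> (\<And>l. l < n \<Longrightarrow> B l j = B' l j) \<Longrightarrow> mm n A B i j = mm n A' B' i j"
  unfolding mm_def by (intro sum.cong) auto

primrec mpow :: "nat \<Rightarrow> (nat \<Rightarrow> nat \<Rightarrow> 'a) \<Rightarrow> nat \<Rightarrow> nat \<Rightarrow> nat \<Rightarrow> 'a :: comm_ring_1" where
  "mpow n A 0 = idm"
| "mpow n A (Suc k) = mm n A (mpow n A k)"

lemma mpow_Suc2: "i < n \<Longrightarrow> j < n \<Longrightarrow> mpow n A (Suc k) i j = mm n (mpow n A k) A i j"
proof (induction k arbitrary: i j)
  case 0
  then show ?case by (simp add: mm_idm_left mm_idm_right)
next
  case (Suc k)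
  have "mpow n A (Suc (Suc k)) i j = mm n A (mpow n A (Suc k)) i j" by simp
  also have "\<dots> = mm n A (mm n (mpow n A k) A) i j" by (rule mm_cong) (use Suc in auto)
  finally show ?case by (simp add: mm_assoc)
qed

text \<open>An entry of the matrix exponential of t A, kept as a scalar power series so that
  termwise differentiation of real series applies.\<close>

definition mexp :: "nat \<Rightarrow> (nat \<Rightarrow> nat \<Rightarrow> real) \<Rightarrow> nat \<Rightarrow> nat \<Rightarrow> real \<Rightarrow> real" where
  "mexp n A i j t = (\<Sum>k. mpow n A k i j / fact k * t ^ k)"

lemma mpow_bound:
  obtains c :: real where "c \<ge> 0" "\<And>k i j. i < n \<Longrightarrow> \<bar>mpow n A k i j\<bar> \<le> c ^ k"
proof -
  \<comment> \<open>The sum of all absolute entries dominates every row sum, hence the growth of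
    powers.\<close>
  define c where "c = (\<Sum>i<n. \<Sum>l<n. \<bar>A i l\<bar>)"
  have c: "c \<ge> 0" unfolding c_def by (intro sum_nonneg) auto
  have row: "(\<Sum>l<n. \<bar>A i l\<bar>) \<le> c" if "i < n" for i
    unfolding c_def using member_le_sum[of i "{..<n}" "\<lambda>i. \<Sum>l<n. \<bar>A i l\<bar>"] that by (auto intro: sum_nonneg)
  have "\<bar>mpow n A k i j\<bar> \<le> c ^ k" if "i < n" for k i j
    using that
  proof (induction k arbitrary: i j)
    case (Suc k)
    have "\<bar>mpow n A (Suc k) i j\<bar> \<le> (\<Sum>l<n. \<bar>A i l * mpow n A k l j\<bar>)"
      by (simp add: mm_def sum_abs)
    also have "\<dots> \<le> (\<Sum>l<n. \<bar>A i l\<bar> * c ^ k)"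
      by (intro sum_mono) (auto simp: abs_mult intro!: mult_left_mono Suc.IH)
    also have "\<dots> = (\<Sum>l<n. \<bar>A i l\<bar>) * c ^ k" by (simp add: sum_distrib_right)
    also have "\<dots> \<le> c * c ^ k" using row[OF Suc.prems] c by (intro mult_right_mono) auto
    finally show ?case by simp
  qed (simp add: idm_def)
  then show ?thesis using that c by blast
qed

lemma mexp_summable:
  assumes "i < n" shows "summable (\<lambda>k. mpow n A k i j / fact k * t ^ k :: real)"
proof -
  obtain c where c: "c \<ge> 0" "\<And>k i j. i < n \<Longrightarrow> \<bar>mpow n A k i j\<bar> \<le> c ^ k" using mpow_bound by blast
  show ?thesis
  proof (rule summable_comparison_test'[of "\<lambda>k. (c * \<bar>t\<bar>) ^ k / fact k" 0])
    show "summable (\<lambda>k. (c * \<bar>t\<bar>) ^ k / fact k)"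
      using summable_exp[of "c * \<bar>t\<bar>"] by (simp add: divide_inverse mult.commute)
    show "norm (mpow n A k i j / fact k * t ^ k) \<le> (c * \<bar>t\<bar>) ^ k / fact k" for k
      using c(2)[OF assms, of k j]
      by (auto simp: abs_mult power_mult_distrib power_abs intro!: divide_right_mono mult_right_mono)
  qed
qed

lemma mexp_has_deriv_aux:
  assumes "i < n"
  shows "(mexp n A i j has_real_derivative (\<Sum>k. mpow n A (Suc k) i j / fact k * t ^ k)) (at t)"
proof -
  have "((\<lambda>t. \<Sum>k. mpow n A k i j / fact k * t ^ k) has_real_derivative
      (\<Sum>k. diffs (\<lambda>k. mpow n A k i j / fact k) k * t ^ k)) (at t)"
    by (rule termdiffs_strong_converges_everywhere) (rule mexp_summable[OF assms])
  moreover have "diffs (\<lambda>k. mpow n A k i j / fact k) = (\<lambda>k. mpow n A (Suc k) i j / fact k)"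
    by (auto simp: diffs_def fun_eq_iff field_simps simp del: mpow.simps of_nat_Suc)
  ultimately show ?thesis by (simp add: mexp_def[abs_def] del: mpow.simps)
qed

lemma mexp_has_deriv:
  assumes "i < n"
  shows "(mexp n A i j has_real_derivative (\<Sum>l<n. A i l * mexp n A l j t)) (at t)"
proof -
  have "(\<Sum>k. mpow n A (Suc k) i j / fact k * t ^ k) = (\<Sum>k. \<Sum>l<n. A i l * (mpow n A k l j / fact k * t ^ k))"
    by (simp add: mm_def sum_distrib_right sum_divide_distrib mult.assoc)
  also have "\<dots> = (\<Sum>l<n. \<Sum>k. A i l * (mpow n A k l j / fact k * t ^ k))"
    by (intro suminf_sum summable_mult mexp_summable) auto
  also have "\<dots> = (\<Sum>l<n. A i l * mexp n A l j t)"
    unfolding mexp_def by (intro sum.cong refl suminf_mult mexp_summable) auto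
  finally show ?thesis using mexp_has_deriv_aux[OF assms, of A j t] by (simp only:)
qed

lemma mexp_has_deriv2:
  assumes "i < n" "j < n"
  shows "(mexp n A i j has_real_derivative (\<Sum>l<n. mexp n A i l t * A l j)) (at t)"
proof -
  have "(\<Sum>k. mpow n A (Suc k) i j / fact k * t ^ k) = (\<Sum>k. \<Sum>l<n. A l j * (mpow n A k i l / fact k * t ^ k))"
    by (simp only: mpow_Suc2[OF assms]) (simp add: mm_def sum_distrib_right sum_divide_distrib mult_ac sum_distrib_left)
  also have "\<dots> = (\<Sum>l<n. \<Sum>k. A l j * (mpow n A k i l / fact k * t ^ k))"
    by (intro suminf_sum summable_mult mexp_summable assms)
  also have "\<dots> = (\<Sum>l<n. A l j * mexp n A i l t)"
    unfolding mexp_def by (intro sum.cong refl suminf_mult mexp_summable assms)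
  also have "\<dots> = (\<Sum>l<n. mexp n A i l t * A l j)" by (simp add: mult.commute)
  finally show ?thesis using mexp_has_deriv_aux[OF assms(1), of A j t] by (simp only:)
qed

lemma mexp_0: "mexp n A i j 0 = idm i j"
  unfolding mexp_def powser_zero by simp

lemma smooth_mexp:
  assumes "i < n" shows "smooth (mexp n A i j)"
proof (rule smooth_coinduct[where S = "range (\<lambda>a t. \<Sum>l<n. a l * mexp n A l j t)"])
  show "mexp n A i j \<in> range (\<lambda>a t. \<Sum>l<n. a l * mexp n A l j t)"
    using assms by (intro image_eqI[of _ _ "\<lambda>l. idm i l"])
      (auto simp: idm_def if_distrib[of "\<lambda>x. x * _"] sum.delta cong: if_cong)
next
  fix g assume "g \<in> range (\<lambda>a t. \<Sum>l<n. a l * mexp n A l j t)"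
  then obtain a where g: "g = (\<lambda>t. \<Sum>l<n. a l * mexp n A l j t)" by blast
  have "(g has_real_derivative (\<Sum>l<n. a l * (\<Sum>k<n. A l k * mexp n A k j t))) (at t)" for t
    unfolding g by (intro DERIV_sum DERIV_cmult mexp_has_deriv) auto
  moreover have "(\<Sum>l<n. a l * (\<Sum>k<n. A l k * mexp n A k j t)) = (\<Sum>k<n. (\<Sum>l<n. a l * A l k) * mexp n A k j t)" for t
    by (simp add: sum_distrib_left sum_distrib_right mult_ac) (rule sum.swap)
  ultimately show "\<exists>g'\<in>range (\<lambda>a t. \<Sum>l<n. a l * mexp n A l j t). \<forall>t. (g has_real_derivative g' t) (at t)"
    by (intro bexI[of _ "\<lambda>t. \<Sum>k<n. (\<Sum>l<n. a l * A l k) * mexp n A k j t"]) auto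
qed

lemma smooth_mexp_neg: "i < n \<Longrightarrow> smooth (\<lambda>t. mexp n A i j (- t))"
  using smooth_affine[OF smooth_mexp, of i n A j "-1" 0] by simp

lemma mexp_neg_has_deriv:
  assumes "i < n" "j < n"
  shows "((\<lambda>t. mexp n A i j (- t)) has_real_derivative (- (\<Sum>l<n. mexp n A i l (- t) * A l j))) (at t)"
  using DERIV_chain'[OF DERIV_minus[OF DERIV_ident] mexp_has_deriv2[OF assms, of A "- t"]] by simp

text \<open>The product of exp(-t A) and exp((t + s) A) has zero derivative in t and equals exp(s A)
  at t = 0. The addition law and the inverse both follow by choosing t and s.\<close>

lemma mexp_inverse_shift:
  assumes "i < n" "j < n"
  shows "(\<Sum>l<n. mexp n A i l (- t) * mexp n A l j (t + s)) = mexp n A i j s"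
proof -
  define f where "f t = (\<Sum>l<n. mexp n A i l (- t) * mexp n A l j (t + s))" for t
  have "(f has_real_derivative 0) (at t)" for t
  proof -
    have "((\<lambda>t. mexp n A l j (t + s)) has_real_derivative (\<Sum>k<n. A l k * mexp n A k j (t + s))) (at t)"
      if "l < n" for l
      using DERIV_chain'[OF DERIV_add[OF DERIV_ident DERIV_const[of s]] mexp_has_deriv[OF that, of A j "t + s"]]
      by simp
    then have "(f has_real_derivative (\<Sum>l<n. - (\<Sum>k<n. mexp n A i k (- t) * A k l) * mexp n A l j (t + s)
        + (\<Sum>k<n. A l k * mexp n A k j (t + s)) * mexp n A i l (- t))) (at t)"
      unfolding f_def[abs_def] by (intro DERIV_sum DERIV_mult mexp_neg_has_deriv assms) auto
    moreover have "(\<Sum>l<n. \<Sum>k<n. mexp n A i k (- t) * A k l * mexp n A l j (t + s))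
       = (\<Sum>l<n. \<Sum>k<n. A l k * mexp n A k j (t + s) * mexp n A i l (- t))"
      by (subst sum.swap) (simp add: mult_ac)
    ultimately show ?thesis
      by (simp add: sum_subtractf sum_distrib_right)
  qed
  then have "f t = f 0" by (intro DERIV_isconst_all) auto
  also have "f 0 = mexp n A i j s"
    unfolding f_def using assms
    by (simp add: mexp_0 idm_def if_distrib[of "\<lambda>x. x * _"] sum.delta cong: if_cong)
  finally show ?thesis by (simp add: f_def)
qed

lemma mexp_add:
  assumes "i < n" "j < n"
  shows "(\<Sum>l<n. mexp n A i l t * mexp n A l j s) = mexp n A i j (t + s)"
  using mexp_inverse_shift[OF assms, of A "-t" "t + s"] by simp

lemma mexp_inverse:
  assumes "i < n" "j < n"
  shows "(\<Sum>l<n. mexp n A i l t * mexp n A l j (- t)) = idm i j"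
  using mexp_add[OF assms, of A t "-t"] by (simp add: mexp_0)

lemma mexp_inverse':
  assumes "i < n" "j < n"
  shows "(\<Sum>l<n. mexp n A i l (- t) * mexp n A l j t) = idm i j"
  using mexp_add[OF assms, of A "-t" t] by (simp add: mexp_0)

lemma sum_mult_idm: "i < n \<Longrightarrow> (\<Sum>l<n. idm i l * f l) = (f i :: 'a :: comm_ring_1)"
  by (simp add: idm_def if_distrib[of "\<lambda>x. x * _"] sum.delta cong: if_cong)

text \<open>If a row vector annihilates all powers of A applied to a column, this series shows that
  it annihilates the exponential applied to it. This is how the algebraic definition of reachability
  meets integrals of inputs.\<close>

lemma mexp_bilinear:
  "(\<Sum>i<n. \<Sum>j<m. r i * mexp n A i j t * v j) =
     (\<Sum>k. (\<Sum>i<n. \<Sum>j<m. r i * mpow n A k i j * v j) / fact k * t ^ k)"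
proof -
  have "(\<Sum>k. (\<Sum>i<n. \<Sum>j<m. r i * mpow n A k i j * v j) / fact k * t ^ k)
     = (\<Sum>k. \<Sum>i<n. \<Sum>j<m. (r i * v j) * (mpow n A k i j / fact k * t ^ k))"
    by (simp add: sum_divide_distrib sum_distrib_right sum_distrib_left mult_ac)
  also have "\<dots> = (\<Sum>i<n. \<Sum>j<m. \<Sum>k. (r i * v j) * (mpow n A k i j / fact k * t ^ k))"
  proof -
    have s: "summable (\<lambda>k. (r i * v j) * (mpow n A k i j / fact k * t ^ k))" if "i \<in> {..<n}" for i j
      using that by (intro summable_mult mexp_summable) auto
    show ?thesis
      by (subst suminf_sum) (intro summable_sum s sum.cong refl suminf_sum; assumption)+
  qed
  also have "\<dots> = (\<Sum>i<n. \<Sum>j<m. r i * mexp n A i j t * v j)"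
    unfolding mexp_def
    by (intro sum.cong refl, subst suminf_mult[OF mexp_summable]) (simp_all add: mult_ac)
  finally show ?thesis ..
qed

text \<open>The integrating factor exp(-t A) makes the solution constant. The one-sided derivatives
  at the ends of \<open>clI\<close> are enough, since the interval is convex.\<close>

lemma mexp_unique:
  assumes x: "\<And>i t. i < n \<Longrightarrow> t \<in> clI \<Longrightarrow> (x i has_real_derivative (\<Sum>l<n. A i l * x l t)) (at t within clI)"
    and i: "i < n" and t: "t \<in> clI"
  shows "x i t = (\<Sum>j<n. mexp n A i j t * x j 0)"
proof -
  define g where "g i t = (\<Sum>l<n. mexp n A i l (- t) * x l t)" for i t
  have g0: "g k t = x k 0" if k: "k < n" for k
  proof -
    have "(g k has_real_derivative 0) (at s within clI)" if s: "s \<in> clI" for s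
    proof -
      have "(g k has_real_derivative (\<Sum>l<n. - (\<Sum>j<n. mexp n A k j (- s) * A j l) * x l s
          + (\<Sum>j<n. A l j * x j s) * mexp n A k l (- s))) (at s within clI)"
        unfolding g_def[abs_def]
        by (intro DERIV_sum DERIV_mult x has_field_derivative_at_within[OF mexp_neg_has_deriv] k s) auto
      moreover have "(\<Sum>l<n. \<Sum>j<n. mexp n A k j (- s) * A j l * x l s)
         = (\<Sum>l<n. \<Sum>j<n. A l j * x j s * mexp n A k l (- s))"
        by (subst sum.swap) (simp add: mult_ac)
      ultimately show ?thesis by (simp add: sum_subtractf sum_distrib_right)
    qed
    then have "g k t = g k 0"
      using has_field_derivative_zero_constant[of clI "g k"] t by auto
    also have "\<dots> = x k 0" using k by (simp add: g_def mexp_0 sum_mult_idm)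
    finally show ?thesis .
  qed
  have "(\<Sum>j<n. mexp n A i j t * x j 0) = (\<Sum>j<n. mexp n A i j t * g j t)"
    by (simp add: g0)
  also have "\<dots> = (\<Sum>l<n. (\<Sum>j<n. mexp n A i j t * mexp n A j l (- t)) * x l t)"
    unfolding g_def sum_distrib_left sum_distrib_right by (subst sum.swap) (simp add: mult.assoc)
  also have "\<dots> = x i t" by (simp add: mexp_inverse i sum_mult_idm)
  finally show ?thesis by simp
qed

lemma sum_fun_apply: "(\<Sum>i\<in>A. f i) x = (\<Sum>i\<in>A. f i x)"
  by (induction A rule: infinite_finite_induct) auto

text \<open>The integrating factor exp(-t A) reduces the system to vanishing derivatives, whose
  solutions are constants; hence weak solutions are classical ones.\<close>

lemma distribution_linear_system:
  fixes T :: "nat \<Rightarrow> distribution"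
  assumes lin: "\<And>i. i < n \<Longrightarrow> linear (T i)"
    and ode: "\<And>i \<phi>. i < n \<Longrightarrow> ddiff (T i) \<phi> = (\<Sum>l<n. A i l * T l \<phi>)"
  shows "\<exists>c. \<forall>i<n. T i = reg (\<lambda>t. \<Sum>j<n. mexp n A i j t * c j)"
proof -
  \<comment> \<open>This is exp(-t A) applied to \<open>T\<close>, with the multiplication moved to
    the test function.\<close>
  define S where "S i \<phi> = (\<Sum>j<n. T j (smul (\<lambda>t. mexp n A i j (- t)) \<phi>))" for i \<phi>
  have linS: "linear (S i)" if "i < n" for i
  proof -
    have "linear (\<lambda>\<phi>. T j (smul (\<lambda>t. mexp n A i j (- t)) \<phi>))" if "j < n" for j
      using linear_compose[OF linear_smul[OF smooth_mexp_neg[OF \<open>i < n\<close>]] lin[OF that]]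
      by (simp add: o_def)
    then show ?thesis unfolding S_def[abs_def] by (intro linear_compose_sum) auto
  qed
  have "\<exists>c. S i = reg (\<lambda>_. c)" if i: "i < n" for i
  proof -
    have "ddiff (S i) \<phi> = 0" for \<phi>
    proof -
      let ?e = "\<lambda>j t. mexp n A i j (- t)"
      have sm: "smooth (?e j)" for j by (rule smooth_mexp_neg[OF i])
      have "T j (smul (?e j) (dtest \<phi>)) = - (\<Sum>l<n. A j l * T l (smul (?e j) \<phi>)) + (\<Sum>l<n. A l j * T j (smul (?e l) \<phi>))"
        if j: "j < n" for j
      proof -
        have sm': "smooth (\<lambda>t. - (\<Sum>l<n. ?e l t * A l j))"
          by (intro smooth_minus smooth_sum smooth_mult smooth_const sm)
        have "smul (\<lambda>t. - (\<Sum>l<n. ?e l t * A l j)) \<phi> = - (\<Sum>l<n. A l j *\<^sub>R smul (?e l) \<phi>)"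
          by (intro testfn_eqI)
            (simp only: Rep_smul[OF sm'], simp add: uminus_testfn.rep_eq Rep_sum scaleR_testfn.rep_eq
              Rep_smul[OF sm] sum_distrib_right sum_distrib_left mult_ac)
        then have "smul (?e j) (dtest \<phi>) = dtest (smul (?e j) \<phi>) + (\<Sum>l<n. A l j *\<^sub>R smul (?e l) \<phi>)"
          by (simp add: smul_dtest[OF sm mexp_neg_has_deriv[OF i j] sm'])
        then have "T j (smul (?e j) (dtest \<phi>)) = - ddiff (T j) (smul (?e j) \<phi>) + (\<Sum>l<n. A l j * T j (smul (?e l) \<phi>))"
          by (simp add: linear_add[OF lin[OF j]] linear_sum[OF lin[OF j]] linear_scale[OF lin[OF j]] ddiff_def)
        then show ?thesis by (simp add: ode j)
      qed
      then have "S i (dtest \<phi>) = - (\<Sum>j<n. \<Sum>l<n. A j l * T l (smul (?e j) \<phi>)) + (\<Sum>j<n. \<Sum>l<n. A l j * T j (smul (?e l) \<phi>))"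
        by (simp add: S_def sum_subtractf)
      also have "(\<Sum>j<n. \<Sum>l<n. A j l * T l (smul (?e j) \<phi>)) = (\<Sum>j<n. \<Sum>l<n. A l j * T j (smul (?e l) \<phi>))"
        by (rule sum.swap)
      finally show ?thesis by (simp add: ddiff_def)
    qed
    then have "ddiff (S i) = 0" by auto
    then show ?thesis using ddiff_eq_0_imp_const[OF linS[OF i]] by blast
  qed
  then have c: "S i = reg (\<lambda>_. SOME c. S i = reg (\<lambda>_. c))" if "i < n" for i
    using someI_ex[of "\<lambda>c. S i = reg (\<lambda>_. c)"] that by simp
  define c where "c i = (SOME c. S i = reg (\<lambda>_. c))" for i
  note c = c[folded c_def]
  have "T i \<phi> = reg (\<lambda>t. \<Sum>j<n. mexp n A i j t * c j) \<phi>" if i: "i < n" for i \<phi>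
  proof -
    have "(\<Sum>j<n. S j (smul (mexp n A i j) \<phi>)) = (\<Sum>j<n. \<Sum>k<n. T k (smul (\<lambda>t. mexp n A i j t * mexp n A j k (- t)) \<phi>))"
      unfolding S_def
      by (intro sum.cong refl) (simp add: smul_smul smooth_mexp i smooth_mexp_neg mult.commute)
    also have "\<dots> = (\<Sum>k<n. T k (\<Sum>j<n. smul (\<lambda>t. mexp n A i j t * mexp n A j k (- t)) \<phi>))"
      by (subst sum.swap) (intro sum.cong refl, simp add: linear_sum[OF lin])
    also have "\<dots> = (\<Sum>k<n. idm i k * T k \<phi>)"
    proof (intro sum.cong refl)
      fix k assume k: "k \<in> {..<n}"
      have "(\<Sum>j<n. smul (\<lambda>t. mexp n A i j t * mexp n A j k (- t)) \<phi>) = idm i k *\<^sub>R \<phi>"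
        by (rule testfn_eqI)
          (use mexp_inverse[OF i, of k A] k in \<open>simp add: Rep_sum Rep_smul smooth_mult smooth_mexp i smooth_mexp_neg
            sum_distrib_right[symmetric] scaleR_testfn.rep_eq\<close>)
      then show "T k (\<Sum>j<n. smul (\<lambda>t. mexp n A i j t * mexp n A j k (- t)) \<phi>) = idm i k * T k \<phi>"
        using k by (simp add: linear_scale[OF lin])
    qed
    also have "\<dots> = T i \<phi>" by (simp add: sum_mult_idm i)
    finally have "T i \<phi> = (\<Sum>j<n. reg (\<lambda>t. mexp n A i j t * c j) \<phi>)"
      by (simp add: c reg_smul smooth_mexp i)
    also have "\<dots> = (\<Sum>j<n. reg (\<lambda>t. mexp n A i j t * c j)) \<phi>"
      by (simp add: sum_fun_apply)
    also have "(\<Sum>j<n. reg (\<lambda>t. mexp n A i j t * c j)) = reg (\<lambda>t. \<Sum>j<n. mexp n A i j t * c j)"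
      by (rule reg_sum[symmetric]) (intro L2_smooth_mult smooth_mexp i L2_const)
    finally show ?thesis .
  qed
  then have "T i = reg (\<lambda>t. \<Sum>j<n. mexp n A i j t * c j)" if "i < n" for i
    using that by (intro ext)
  then show ?thesis by (intro exI[of _ c] allI impI)
qed

text \<open>Variation of constants. The integral starts at -1, so \<open>x0\<close> is not the state
  at time 0 in general: it is the value at time 0 of the free motion that agrees with the solution
  at -1.\<close>

definition trajectory ::
  "nat \<Rightarrow> (nat \<Rightarrow> nat \<Rightarrow> real) \<Rightarrow> (nat \<Rightarrow> real) \<Rightarrow> (nat \<Rightarrow> real \<Rightarrow> real) \<Rightarrow> nat \<Rightarrow> real \<Rightarrow> real" where
  "trajectory n A x0 b i t =
     (\<Sum>j<n. mexp n A i j t * (x0 j + primitive (\<lambda>s. \<Sum>l<n. mexp n A j l (- s) * b l s) t))"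

lemma trajectory_props:
  assumes b: "\<And>l. l < n \<Longrightarrow> b l \<in> L2" and i: "i < n"
  shows "trajectory n A x0 b i \<in> L2"
    "ddiff (reg (trajectory n A x0 b i)) = (\<Sum>l<n. act [:A i l:] (reg (trajectory n A x0 b l))) + reg (b i)"
proof -
  define h where "h j s = (\<Sum>l<n. mexp n A j l (- s) * b l s)" for j s
  define G where "G j t = x0 j + primitive (h j) t" for j t
  have h: "h j \<in> L2" if "j < n" for j
    unfolding h_def[abs_def] by (intro L2_sum L2_smooth_mult smooth_mexp_neg b that) auto
  have G: "G j \<in> L2" "ddiff (reg (G j)) = reg (h j)" if j: "j < n" for j
  proof -
    have "reg (G j) = reg (\<lambda>_. x0 j) + reg (primitive (h j))"
      unfolding G_def[abs_def] by (intro reg_add L2_const primitive_props(1) h j)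
    moreover have "ddiff (S + T) = ddiff S + ddiff T" for S T
      using ddiff_pow_add[of 1] by simp
    ultimately show "ddiff (reg (G j)) = reg (h j)"
      by (simp add: ddiff_reg_const primitive_props(2) h j)
    show "G j \<in> L2" unfolding G_def[abs_def] by (intro L2_add L2_const primitive_props(1) h j)
  qed
  have x: "trajectory n A x0 b i = (\<lambda>t. \<Sum>j<n. mexp n A i j t * G j t)" for i
    by (simp add: trajectory_def[abs_def] G_def h_def[abs_def])
  have EG: "(\<lambda>t. mexp n A i j t * G j t) \<in> L2" if "i < n" "j < n" for i j
    by (intro L2_smooth_mult smooth_mexp G that)
  have Eh: "(\<lambda>t. mexp n A i j t * h j t) \<in> L2" if "i < n" "j < n" for i j
    by (intro L2_smooth_mult smooth_mexp h that)
  show "trajectory n A x0 b i \<in> L2" unfolding x by (intro L2_sum EG i) auto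
  have ddiff_sum: "ddiff (\<Sum>j<n. S j) = (\<Sum>j<n. ddiff (S j))" for S
    using act.scale_sum_right[of "[:0,1:]" S "{..<n}"] by (simp add: act_s)
  have "ddiff (reg (trajectory n A x0 b i)) = (\<Sum>j<n. ddiff (reg (\<lambda>t. mexp n A i j t * G j t)))"
    unfolding x by (subst reg_sum) (auto simp: ddiff_sum EG i)
  also have "\<dots> = (\<Sum>j<n. (\<Sum>l<n. act [:A i l:] (reg (\<lambda>t. mexp n A l j t * G j t))) + reg (\<lambda>t. mexp n A i j t * h j t))"
  proof (intro sum.cong refl)
    fix j assume j: "j \<in> {..<n}"
    have "ddiff (reg (\<lambda>t. mexp n A i j t * G j t)) =
        reg (\<lambda>t. (\<Sum>l<n. A i l * mexp n A l j t) * G j t) + reg (\<lambda>t. mexp n A i j t * h j t)"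
      by (intro ddiff_smooth_mult mexp_has_deriv smooth_mexp smooth_sum smooth_mult smooth_const i)
        (use j G in auto)
    also have "reg (\<lambda>t. (\<Sum>l<n. A i l * mexp n A l j t) * G j t)
        = reg (\<lambda>t. \<Sum>l<n. A i l * (mexp n A l j t * G j t))"
      by (simp add: sum_distrib_right mult.assoc)
    also have "\<dots> = (\<Sum>l<n. reg (\<lambda>t. A i l * (mexp n A l j t * G j t)))"
      by (intro reg_sum L2_cmult EG) (use j in auto)
    finally show "ddiff (reg (\<lambda>t. mexp n A i j t * G j t)) = (\<Sum>l<n. act [:A i l:] (reg (\<lambda>t. mexp n A l j t * G j t)))
        + reg (\<lambda>t. mexp n A i j t * h j t)"
      by (simp only: reg_cmult)
  qed
  also have "\<dots> = (\<Sum>l<n. act [:A i l:] (\<Sum>j<n. reg (\<lambda>t. mexp n A l j t * G j t))) + (\<Sum>j<n. reg (\<lambda>t. mexp n A i j t * h j t))"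
    by (subst sum.distrib, subst sum.swap) (simp add: act.scale_sum_right)
  also have "(\<Sum>l<n. act [:A i l:] (\<Sum>j<n. reg (\<lambda>t. mexp n A l j t * G j t))) = (\<Sum>l<n. act [:A i l:] (reg (trajectory n A x0 b l)))"
    unfolding x by (intro sum.cong refl arg_cong[where f = "act _"] reg_sum[symmetric]) (auto intro: EG)
  also have "(\<Sum>j<n. reg (\<lambda>t. mexp n A i j t * h j t)) = reg (b i)"
  proof -
    have "(\<Sum>j<n. mexp n A i j t * h j t) = b i t" for t
    proof -
      have "(\<Sum>j<n. mexp n A i j t * h j t) = (\<Sum>l<n. (\<Sum>j<n. mexp n A i j t * mexp n A j l (- t)) * b l t)"
        unfolding h_def sum_distrib_left sum_distrib_right by (subst sum.swap) (simp add: mult.assoc)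
      also have "\<dots> = b i t" by (simp add: mexp_inverse i sum_mult_idm)
      finally show ?thesis .
    qed
    moreover have "reg (\<lambda>t. \<Sum>j<n. mexp n A i j t * h j t) = (\<Sum>j<n. reg (\<lambda>t. mexp n A i j t * h j t))"
      by (intro reg_sum Eh i) auto
    ultimately show ?thesis by simp
  qed
  finally show "ddiff (reg (trajectory n A x0 b i)) = (\<Sum>l<n. act [:A i l:] (reg (trajectory n A x0 b l))) + reg (b i)" .
qed

section \<open>Linear algebra and the observable quotient\<close>

text \<open>The determinant decides: if it is zero there is a kernel vector, otherwise the adjugate
  is an inverse up to the factor \<open>d\<close>. Over an integral domain this serves real and
  polynomial matrices alike.\<close>

lemma adjugate_or_kernel:
  fixes M :: "nat \<Rightarrow> nat \<Rightarrow> 'a :: idom"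
  shows "(\<exists>c. (\<exists>i<n. c i \<noteq> 0) \<and> (\<forall>i<n. (\<Sum>j<n. M i j * c j) = 0)) \<or>
    (\<exists>d W. d \<noteq> 0 \<and> (\<forall>i<n. \<forall>j<n. mm n W M i j = d * idm i j \<and> mm n M W i j = d * idm i j))"
proof -
  define Mm where "Mm = mat n n (\<lambda>(i, j). M i j)"
  have Mm: "Mm \<in> carrier_mat n n" by (simp add: Mm_def)
  show ?thesis
  proof (cases "det Mm = 0")
    case True
    then obtain v where v: "v \<in> carrier_vec n" "v \<noteq> 0\<^sub>v n" "Mm *\<^sub>v v = 0\<^sub>v n"
      using det_0_iff_vec_prod_zero[OF Mm] by blast
    have "(\<Sum>j<n. M i j * v $ j) = 0" if "i < n" for i
    proof -
      have "(Mm *\<^sub>v v) $ i = 0" using v(3) that by simp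
      then show ?thesis using that v(1) Mm
        by (auto simp: scalar_prod_def Mm_def atLeast0LessThan)
    qed
    moreover have "\<exists>i<n. v $ i \<noteq> 0" using v(1,2) by (metis carrier_vecD eq_vecI index_zero_vec)
    ultimately show ?thesis by blast
  next
    case False
    let ?W = "adj_mat Mm"
    have W: "?W \<in> carrier_mat n n" "Mm * ?W = det Mm \<cdot>\<^sub>m 1\<^sub>m n" "?W * Mm = det Mm \<cdot>\<^sub>m 1\<^sub>m n"
      using adj_mat[OF Mm] by auto
    have "mm n (\<lambda>i j. ?W $$ (i, j)) M i j = det Mm * idm i j \<and> mm n M (\<lambda>i j. ?W $$ (i, j)) i j = det Mm * idm i j"
      if ij: "i < n" "j < n" for i j
    proof -
      have "(Mm * ?W) $$ (i, j) = det Mm * idm i j" "(?W * Mm) $$ (i, j) = det Mm * idm i j"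
        unfolding W using ij by (auto simp: idm_def)
      then show ?thesis using ij W(1) Mm
        by (simp add: mm_def scalar_prod_def Mm_def atLeast0LessThan)
    qed
    with False show ?thesis by blast
  qed
qed

lemma orthogonal_vector:
  fixes v :: "nat \<Rightarrow> nat \<Rightarrow> real"
  assumes "k < n"
  obtains c where "\<exists>i<n. c i \<noteq> 0" "\<And>r. r < k \<Longrightarrow> (\<Sum>i<n. v r i * c i) = 0"
proof -
  \<comment> \<open>Zero rows pad the system to a square one. Row \<open>k\<close> of
    \<open>M\<close> is zero, which excludes the second alternative.\<close>
  define M where "M r i = (if r < k then v r i else 0)" for r i
  from adjugate_or_kernel[of n M] show ?thesis
  proof (elim disjE exE conjE)
    fix c i assume c: "i < n" "c i \<noteq> 0" "\<forall>i<n. (\<Sum>j<n. M i j * c j) = 0"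
    have "(\<Sum>i<n. v r i * c i) = 0" if "r < k" for r
      using c(3)[rule_format, of r] that assms by (simp add: M_def)
    with c show ?thesis using that by blast
  next
    fix d W assume "d \<noteq> 0" "\<forall>i<n. \<forall>j<n. mm n W M i j = d * idm i j \<and> mm n M W i j = d * idm i j"
    then have "mm n M W k k = d" using assms by (simp add: idm_def)
    with \<open>d \<noteq> 0\<close> show ?thesis by (simp add: mm_def M_def)
  qed
qed

section \<open>Independence, observability and the quotient by the unobservable states\<close>

definition indep :: "nat \<Rightarrow> nat \<Rightarrow> (nat \<Rightarrow> nat \<Rightarrow> real) \<Rightarrow> bool" where
  "indep n k v \<longleftrightarrow> (\<forall>c. (\<forall>i<n. (\<Sum>r<k. c r * v r i) = 0) \<longrightarrow> (\<forall>r<k. c r = 0))"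

lemma indep_le:
  assumes "indep n k v" shows "k \<le> n"
proof (rule ccontr)
  assume "\<not> k \<le> n"
  then obtain c where "\<exists>i<k. c i \<noteq> 0" "\<And>r. r < n \<Longrightarrow> (\<Sum>i<k. v i r * c i) = 0"
    using orthogonal_vector[of n k "\<lambda>i r. v r i"] by auto
  then show False using assms by (auto simp: indep_def mult.commute)
qed

text \<open>The functional \<open>c\<close> kills the old vectors but not the new one; applied to a
  vanishing combination it isolates the last coefficient.\<close>

lemma indep_Suc:
  assumes "indep n k v" "\<And>r. r < k \<Longrightarrow> (\<Sum>i<n. c i * v r i) = 0" "(\<Sum>i<n. c i * v k i) \<noteq> 0"
  shows "indep n (Suc k) v"
  unfolding indep_def
proof (intro allI impI)
  fix d r assume d: "\<forall>i<n. (\<Sum>r<Suc k. d r * v r i) = 0" and r: "r < Suc k"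
  have "0 = (\<Sum>i<n. c i * (\<Sum>r<Suc k. d r * v r i))" using d by simp
  also have "\<dots> = (\<Sum>r<Suc k. d r * (\<Sum>i<n. c i * v r i))"
    by (simp only: sum_distrib_left, subst sum.swap) (simp add: mult_ac)
  also have "\<dots> = d k * (\<Sum>i<n. c i * v k i)" by (simp add: assms(2))
  finally have "d k = 0" using assms(3) by simp
  then have "\<forall>r<k. d r = 0" using assms(1) d by (simp add: indep_def)
  with \<open>d k = 0\<close> show "d r = 0" using r by (auto simp: less_Suc_eq)
qed

text \<open>All powers of A are quantified, which matches repeated differentiation of an output that
  vanishes on an interval.\<close>

definition observable :: "nat \<Rightarrow> nat \<Rightarrow> (nat \<Rightarrow> nat \<Rightarrow> real) \<Rightarrow> (nat \<Rightarrow> nat \<Rightarrow> real) \<Rightarrow> bool" where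
  "observable n p A C \<longleftrightarrow> (\<forall>z. (\<forall>k. \<forall>i<p. (\<Sum>j<n. mm n C (mpow n A k) i j * z j) = 0) \<longrightarrow> (\<forall>i<n. z i = 0))"

lemma sum_mm_right: fixes P :: "nat \<Rightarrow> nat \<Rightarrow> 'a :: comm_ring_1" shows "(\<Sum>j<n. mm k P Q i j * z j) = (\<Sum>l<k. P i l * (\<Sum>j<n. Q l j * z j))"
  unfolding mm_def sum_distrib_left sum_distrib_right by (subst sum.swap) (simp add: mult.assoc)

text \<open>The unobservable states form an A-invariant subspace on which C vanishes, so A and C
  descend to the quotient. \<open>Pr\<close> is the projection in coordinates: its rows are a basis
  of the functionals that vanish on this subspace. \<open>S\<close> is a section.\<close>

lemma observable_quotient:
  fixes A C :: "nat \<Rightarrow> nat \<Rightarrow> real"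
  shows "\<exists>k Pr S A' C'. k \<le> n \<and> (\<forall>i<k. \<forall>j<n. mm n Pr A i j = mm k A' Pr i j) \<and>
    (\<forall>i<p. \<forall>j<n. C i j = mm k C' Pr i j) \<and> (\<forall>i<k. \<forall>j<k. mm n Pr S i j = idm i j) \<and>
    observable k p A' C'"
proof -
  \<comment> \<open>\<open>N\<close> is the unobservable subspace and \<open>inO\<close> its
    annihilator.\<close>
  define N where "N z \<longleftrightarrow> (\<forall>k. \<forall>i<p. (\<Sum>j<n. mm n C (mpow n A k) i j * z j) = 0)" for z
  define inO where "inO r \<longleftrightarrow> (\<forall>z. N z \<longrightarrow> (\<Sum>j<n. r j * z j) = 0)" for r :: "nat \<Rightarrow> real"
  \<comment> \<open>The dimension of the annihilator is obtained as the largest size of an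
    independent family in it; maximality then makes the family spanning.\<close>
  define P where "P k \<longleftrightarrow> (\<exists>v. indep n k v \<and> (\<forall>r<k. inO (v r)))" for k
  have P0: "P 0" by (simp add: P_def indep_def)
  have bound: "k \<le> n" if "P k" for k using that indep_le by (auto simp: P_def)
  have k: "P (Greatest P)" "l \<le> Greatest P" if "P l" for l
    using GreatestI_nat[of P l n] Greatest_le_nat[of P l n] bound that by auto
  note k = k(1)[OF P0] k(2)
  define k where "k = Greatest P"
  note k = k[folded k_def]
  then obtain Pr where Pr: "indep n k Pr" "\<And>r. r < k \<Longrightarrow> inO (Pr r)" by (auto simp: P_def)
  have span: "\<exists>c. \<forall>j<n. r j = (\<Sum>l<k. c l * Pr l j)" if r: "inO r" for r
  proof (rule ccontr)
    assume no: "\<not> ?thesis"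
    have "indep n (Suc k) (Pr(k := r))"
      unfolding indep_def
    proof (intro allI impI)
      fix d l assume d: "\<forall>i<n. (\<Sum>l<Suc k. d l * (Pr(k := r)) l i) = 0" and l: "l < Suc k"
      have e: "(\<Sum>l<k. d l * Pr l i) + d k * r i = 0" if "i < n" for i
        using d that by simp
      have "d k = 0"
      proof (rule ccontr)
        assume "d k \<noteq> 0"
        then have "r i = (\<Sum>l<k. (- d l / d k) * Pr l i)" if "i < n" for i
          using e[OF that] by (simp add: sum_negf sum_divide_distrib[symmetric] field_simps eq_neg_iff_add_eq_0)
        then have "\<exists>c. \<forall>j<n. r j = (\<Sum>l<k. c l * Pr l j)"
          by (intro exI[of _ "\<lambda>l. - d l / d k"] allI impI)
        with no show False by (rule notE)
      qed
      then have "\<forall>l<k. d l = 0" using e Pr(1) by (simp add: indep_def)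
      with \<open>d k = 0\<close> show "d l = 0" using l by (auto simp: less_Suc_eq)
    qed
    moreover have "\<forall>l<Suc k. inO ((Pr(k := r)) l)" using Pr(2) r by (auto simp: less_Suc_eq)
    ultimately have "P (Suc k)" unfolding P_def by blast
    then show False using k(2) by force
  qed
  have NA: "N (\<lambda>l. \<Sum>j<n. A l j * z j)" if z: "N z" for z
    unfolding N_def
  proof (intro allI impI)
    fix q i assume "i < p"
    have "(\<Sum>l<n. mm n C (mpow n A q) i l * (\<Sum>j<n. A l j * z j)) = (\<Sum>j<n. mm n (mm n C (mpow n A q)) A i j * z j)"
      by (rule sum_mm_right[symmetric])
    also have "\<dots> = (\<Sum>j<n. mm n C (mpow n A (Suc q)) i j * z j)"
    proof (intro sum.cong refl arg_cong2[where f = "(*)"])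
      fix j assume "j \<in> {..<n}"
      then show "mm n (mm n C (mpow n A q)) A i j = mm n C (mpow n A (Suc q)) i j"
        unfolding mm_assoc[symmetric] by (intro mm_cong mpow_Suc2[symmetric]) auto
    qed
    also have "\<dots> = 0" using z \<open>i < p\<close> unfolding N_def by blast
    finally show "(\<Sum>l<n. mm n C (mpow n A q) i l * (\<Sum>j<n. A l j * z j)) = 0" .
  qed
  have "inO (mm n Pr A i)" if "i < k" for i
    using Pr(2)[OF that] NA unfolding inO_def sum_mm_right by blast
  from someI_ex[OF span[OF this]]
  have A': "mm n Pr A i j = mm k (\<lambda>i. SOME c. \<forall>j<n. mm n Pr A i j = (\<Sum>l<k. c l * Pr l j)) Pr i j"
    if "i < k" "j < n" for i j
    unfolding mm_def[of k] using that by blast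
  define A' where "A' i = (SOME c. \<forall>j<n. mm n Pr A i j = (\<Sum>l<k. c l * Pr l j))" for i
  note A' = A'[folded A'_def]
  have "inO (C i)" if "i < p" for i
    unfolding inO_def
  proof (intro allI impI)
    fix z assume "N z"
    then have "(\<Sum>j<n. mm n C (mpow n A 0) i j * z j) = 0" using that unfolding N_def by blast
    then show "(\<Sum>j<n. C i j * z j) = 0" by (simp add: mm_idm_right)
  qed
  from someI_ex[OF span[OF this]]
  have C': "C i j = mm k (\<lambda>i. SOME c. \<forall>j<n. C i j = (\<Sum>l<k. c l * Pr l j)) Pr i j"
    if "i < p" "j < n" for i j
    unfolding mm_def using that by blast
  define C' where "C' i = (SOME c. \<forall>j<n. C i j = (\<Sum>l<k. c l * Pr l j))" for i
  note C' = C'[folded C'_def]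
  \<comment> \<open>The Gram matrix of the rows of \<open>Pr\<close>. It is nonsingular because a
    kernel vector would give a combination of rows of zero length, and its inverse yields the right
    inverse \<open>S\<close>.\<close>
  define G where "G = mm n Pr (\<lambda>i j. Pr j i)"
  have "\<exists>d W. d \<noteq> 0 \<and> (\<forall>i<k. \<forall>j<k. mm k W G i j = d * idm i j \<and> mm k G W i j = d * idm i j)"
  proof -
    have "\<not> (\<exists>c. (\<exists>i<k. c i \<noteq> 0) \<and> (\<forall>i<k. (\<Sum>j<k. G i j * c j) = 0))"
    proof (intro notI, elim exE conjE)
      fix c i assume c: "i < k" "c i \<noteq> 0" "\<forall>i<k. (\<Sum>j<k. G i j * c j) = 0"
      define y where "y l = (\<Sum>j<k. c j * Pr j l)" for l
      have "0 = (\<Sum>i<k. c i * (\<Sum>j<k. G i j * c j))" using c(3) by simp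
      also have "\<dots> = (\<Sum>i<k. c i * (\<Sum>l<n. Pr i l * y l))"
        unfolding G_def sum_mm_right y_def by (simp add: mult.commute)
      also have "\<dots> = (\<Sum>l<n. (y l)\<^sup>2)"
        unfolding power2_eq_square sum_distrib_left
        by (subst sum.swap) (simp add: y_def sum_distrib_right mult.assoc)
      finally have "\<forall>l<n. y l = 0" using sum_nonneg_eq_0_iff[of "{..<n}" "\<lambda>l. (y l)\<^sup>2"] by auto
      then show False using Pr(1) c(1,2) by (auto simp: indep_def y_def)
    qed
    then show ?thesis using adjugate_or_kernel[of k G] by blast
  qed
  then obtain d W where d: "d \<noteq> 0" "\<And>i j. i < k \<Longrightarrow> j < k \<Longrightarrow> mm k G W i j = d * idm i j" by blast
  define S where "S l j = (\<Sum>i<k. Pr i l * W i j) / d" for l j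
  have S: "mm n Pr S i j = idm i j" if "i < k" "j < k" for i j
  proof -
    have "mm n Pr S i j = mm k G W i j / d"
      unfolding G_def mm_assoc[symmetric] by (simp add: S_def mm_def sum_divide_distrib sum_distrib_left)
    then show ?thesis using d that by simp
  qed
  have PrA: "mm n Pr (mpow n A q) i j = mm k (mpow k A' q) Pr i j" if "i < k" "j < n" for i j q
    using that
  proof (induction q arbitrary: i j)
    case 0
    then show ?case by (simp add: mm_idm_left mm_idm_right)
  next
    case (Suc q)
    have "mm n Pr (mpow n A (Suc q)) i j = mm n (mm k A' Pr) (mpow n A q) i j"
      using Suc.prems A' by (simp add: mm_assoc) (intro mm_cong; simp)
    also have "\<dots> = mm k A' (mm k (mpow k A' q) Pr) i j"
      unfolding mm_assoc[symmetric] by (intro mm_cong Suc.IH Suc.prems refl)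
    finally show ?case by (simp add: mm_assoc)
  qed
  have "observable k p A' C'"
    unfolding observable_def
  proof (intro allI impI)
    fix z i assume z: "\<forall>q. \<forall>i<p. (\<Sum>j<k. mm k C' (mpow k A' q) i j * z j) = 0" and i: "i < k"
    \<comment> \<open>Lift \<open>z\<close> by the section. The lift is unobservable, so the rows of
      \<open>Pr\<close> vanish on it, but its projection is \<open>z\<close>.\<close>
    define x where "x l = (\<Sum>j<k. S l j * z j)" for l
    have Prx: "(\<Sum>l<n. Pr i l * x l) = z i" if "i < k" for i
    proof -
      have "(\<Sum>l<n. Pr i l * x l) = (\<Sum>j<k. mm n Pr S i j * z j)" unfolding x_def by (rule sum_mm_right[symmetric])
      also have "\<dots> = (\<Sum>j<k. idm i j * z j)" using S that by simp
      finally show ?thesis using that by (simp add: sum_mult_idm)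
    qed
    have "N x"
      unfolding N_def
    proof (intro allI impI)
      fix q i assume i: "i < p"
      have "(\<Sum>j<n. mm n C (mpow n A q) i j * x j) = (\<Sum>j<n. mm k (mm k C' (mpow k A' q)) Pr i j * x j)"
      proof (intro sum.cong refl arg_cong2[where f = "(*)"])
        fix j assume j: "j \<in> {..<n}"
        have "mm n C (mpow n A q) i j = mm n (mm k C' Pr) (mpow n A q) i j"
          using C' i by (intro mm_cong) auto
        also have "\<dots> = mm k C' (mm k (mpow k A' q) Pr) i j"
          unfolding mm_assoc[symmetric] by (intro mm_cong PrA refl) (use j in auto)
        finally show "mm n C (mpow n A q) i j = mm k (mm k C' (mpow k A' q)) Pr i j" by (simp add: mm_assoc)
      qed
      also have "\<dots> = (\<Sum>l<k. mm k C' (mpow k A' q) i l * z l)"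
        unfolding sum_mm_right[where k = k] by (simp add: Prx)
      finally show "(\<Sum>j<n. mm n C (mpow n A q) i j * x j) = 0" using z i by simp
    qed
    then have "(\<Sum>l<n. Pr i l * x l) = 0" using Pr(2)[OF i] by (simp add: inO_def)
    then show "z i = 0" using Prx[OF i] by simp
  qed
  moreover have "\<forall>i<k. \<forall>j<n. mm n Pr A i j = mm k A' Pr i j" by (intro allI impI A')
  moreover have "\<forall>i<p. \<forall>j<n. C i j = mm k C' Pr i j" by (intro allI impI C')
  moreover have "\<forall>i<k. \<forall>j<k. mm n Pr S i j = idm i j" by (intro allI impI S)
  ultimately show ?thesis using bound[OF k(1)]
    by (intro exI[of _ k] exI[of _ Pr] exI[of _ S] exI[of _ A'] exI[of _ C'] conjI)
qed

section \<open>Polynomial matrices\<close>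

definition cm :: "('a \<Rightarrow> 'b \<Rightarrow> real) \<Rightarrow> 'a \<Rightarrow> 'b \<Rightarrow> real poly" where
  "cm A i j = [:A i j:]"

text \<open>The characteristic matrix s I - A.\<close>

definition pencil :: "(nat \<Rightarrow> nat \<Rightarrow> real) \<Rightarrow> nat \<Rightarrow> nat \<Rightarrow> real poly" where
  "pencil A i j = [:0, 1:] * idm i j - cm A i j"

definition mv :: "nat \<Rightarrow> (nat \<Rightarrow> nat \<Rightarrow> real poly) \<Rightarrow> (nat \<Rightarrow> distribution) \<Rightarrow> nat \<Rightarrow> distribution" where
  "mv n P x i = (\<Sum>l<n. act (P i l) (x l))"

lemma mv_mm: "mv n P (mv k Q x) i = mv k (mm n P Q) x i"
proof -
  have "mv n P (mv k Q x) i = (\<Sum>l<n. \<Sum>j<k. act (P i l * Q l j) (x j))"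
    by (simp add: mv_def act.scale_sum_right)
  also have "\<dots> = mv k (mm n P Q) x i"
    by (subst sum.swap) (simp add: mv_def mm_def act.scale_sum_left)
  finally show ?thesis .
qed

lemma mv_cong: "(\<And>l. l < n \<Longrightarrow> P i l = Q i l) \<Longrightarrow> (\<And>l. l < n \<Longrightarrow> x l = y l) \<Longrightarrow> mv n P x i = mv n Q y i"
  unfolding mv_def by (intro sum.cong) auto

lemma mv_add_right: "mv n P (\<lambda>l. x l + y l) i = mv n P x i + mv n P y i"
  by (simp add: mv_def act.scale_right_distrib sum.distrib)

lemma mv_diff_right: "mv n P (\<lambda>l. x l - y l) i = mv n P x i - mv n P y i"
  by (simp add: mv_def act.scale_right_diff_distrib sum_subtractf)

lemma mv_add_left: "mv n (\<lambda>i j. P i j + Q i j) x i = mv n P x i + mv n Q x i"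
  by (simp add: mv_def act.scale_left_distrib sum.distrib)

lemma mv_zero_right: "(\<And>l. l < n \<Longrightarrow> x l = 0) \<Longrightarrow> mv n P x i = 0"
  by (simp add: mv_def)

lemma mv_idm: "i < n \<Longrightarrow> mv n idm x i = x i"
  by (simp add: mv_def idm_def if_distrib[of "\<lambda>p. act p _"] sum.delta cong: if_cong)

lemma mv_pencil: "i < n \<Longrightarrow> mv n (pencil A) x i = ddiff (x i) - mv n (cm A) x i"
proof -
  assume i: "i < n"
  have "mv n (pencil A) x i = (\<Sum>l<n. act ([:0, 1:] * idm i l) (x l)) - mv n (cm A) x i"
    by (simp add: mv_def pencil_def act.scale_left_diff_distrib sum_subtractf)
  also have "(\<Sum>l<n. act ([:0, 1:] * idm i l) (x l)) = act [:0, 1:] (mv n idm x i)"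
    by (simp only: mv_def act.scale_sum_right act_mult)
  finally show ?thesis unfolding mv_idm[OF i] act_s .
qed

section \<open>Division by the characteristic matrix\<close>

lemma const_sum: "[:\<Sum>x\<in>S. f x:] = (\<Sum>x\<in>S. [:f x:])"
proof (induction S rule: infinite_finite_induct)
  case (insert x F)
  have "[:f x + sum f F:] = [:f x:] + [:sum f F:]" by simp
  then show ?case using insert by simp
qed auto

text \<open>The leading coefficient of s I - A is the identity, so division with remainder from the
  right works over the matrices, and the remainder has degree zero.\<close>

lemma pencil_division:
  fixes r :: "nat \<Rightarrow> real poly"
  shows "\<exists>Y c. \<forall>j<n. r j = (\<Sum>l<n. Y l * pencil A l j) + [:c j:]"
proof -
  have *: "\<exists>Y c. \<forall>j<n. r j = (\<Sum>l<n. Y l * pencil A l j) + [:c j:]"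
    if "\<And>j. j < n \<Longrightarrow> degree (r j) < N" for N and r :: "nat \<Rightarrow> real poly"
    using that
  proof (induction N arbitrary: r)
    case 0
    then have "n = 0" by auto
    then show ?case by auto
  next
    case (Suc N)
    show ?case
    proof (cases N)
      case 0
      then have "r j = [:coeff (r j) 0:]" if "j < n" for j
        using Suc.prems[OF that] by (simp add: degree_0_id)
      then show ?thesis by (intro exI[of _ "\<lambda>_. 0"] exI[of _ "\<lambda>j. coeff (r j) 0"]) auto
    next
      case (Suc N')
      define q where "q j = poly_shift 1 (r j)" for j
      have r: "r j = pCons (coeff (r j) 0) (q j)" for j
        by (intro poly_eqI) (auto simp: q_def coeff_pCons coeff_poly_shift split: nat.split)
      have "degree (q j) < N" if "j < n" for j
      proof -
        have "degree (pCons (coeff (r j) 0) (q j)) < Suc N" using Suc.prems[OF that] r[of j] by simp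
        then show ?thesis using Suc by (cases "q j = 0") auto
      qed
      then obtain Y c where Y: "\<forall>j<n. q j = (\<Sum>l<n. Y l * pencil A l j) + [:c j:]"
        using Suc.IH by blast
      \<comment> \<open>If the row q has quotient Y and remainder c, then s q has quotient s Y + c
        and remainder c A, because s c = c (s I - A) + c A.\<close>
      define Y' where "Y' l = pCons (c l) (Y l)" for l
      define c' where "c' j = coeff (r j) 0 + (\<Sum>l<n. c l * A l j)" for j
      have "r j = (\<Sum>l<n. Y' l * pencil A l j) + [:c' j:]" if j: "j < n" for j
      proof -
        have "(\<Sum>l<n. Y' l * pencil A l j) = [:0, 1:] * (\<Sum>l<n. Y l * pencil A l j) + (\<Sum>l<n. [:c l:] * pencil A l j)"
          by (simp add: Y'_def sum_distrib_left sum.distrib[symmetric] algebra_simps)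
        also have "(\<Sum>l<n. [:c l:] * pencil A l j) = [:0, 1:] * (\<Sum>l<n. [:c l:] * idm l j) - [:\<Sum>l<n. c l * A l j:]"
        proof -
          have "[:c l:] * pencil A l j = [:0, 1:] * ([:c l:] * idm l j) - [:c l * A l j:]" for l
            by (simp only: pencil_def cm_def right_diff_distrib mult.left_commute[of "[:c l:]"]) simp
          then show ?thesis by (simp only: sum_subtractf sum_distrib_left[symmetric] const_sum)
        qed
        also have "(\<Sum>l<n. [:c l:] * idm l j) = [:c j:]"
          using j by (simp add: idm_def if_distrib[of "\<lambda>x. _ * x"] sum.delta cong: if_cong)
        finally have "(\<Sum>l<n. Y' l * pencil A l j) = [:0, 1:] * ((\<Sum>l<n. Y l * pencil A l j) + [:c j:]) - [:\<Sum>l<n. c l * A l j:]"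
          by (simp add: algebra_simps)
        also have "(\<Sum>l<n. Y l * pencil A l j) + [:c j:] = q j" using Y j by simp
        finally show ?thesis by (subst r) (simp add: c'_def)
      qed
      then show ?thesis by blast
    qed
  qed
  define N where "N = Suc (\<Sum>j<n. degree (r j))"
  have "degree (r j) < N" if "j < n" for j
    using member_le_sum[of j "{..<n}" "\<lambda>j. degree (r j)"] that by (simp add: N_def less_Suc_eq_le)
  then show ?thesis by (rule *)
qed

text \<open>Uniqueness of the division: comparing coefficients expresses each coefficient of Y by
  the next higher one, and the highest ones vanish. So Y is zero, and with it the remainder.\<close>

lemma pencil_left_cancel:
  assumes "\<And>j. j < n \<Longrightarrow> (\<Sum>l<n. Y l * pencil A l j) = [:c j:]"
  shows "\<And>j. j < n \<Longrightarrow> Y j = 0" "\<And>j. j < n \<Longrightarrow> c j = 0"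
proof -
  have eq: "coeff (Y j) k = (\<Sum>l<n. coeff (Y l) (Suc k) * A l j)" if j: "j < n" for j k
  proof -
    have "(\<Sum>l<n. Y l * pencil A l j) = [:0, 1:] * (\<Sum>l<n. Y l * idm l j) - (\<Sum>l<n. Y l * [:A l j:])"
      by (simp add: pencil_def cm_def algebra_simps sum_subtractf sum_distrib_left)
    also have "(\<Sum>l<n. Y l * idm l j) = Y j"
      using j by (simp add: idm_def if_distrib[of "\<lambda>x. _ * x"] sum.delta cong: if_cong)
    finally have "[:0, 1:] * Y j - (\<Sum>l<n. Y l * [:A l j:]) = [:c j:]" using assms[OF j] by simp
    then have "coeff ([:0, 1:] * Y j - (\<Sum>l<n. Y l * [:A l j:])) (Suc k) = 0" by simp
    then show ?thesis by (simp add: coeff_sum mult.commute)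
  qed
  define N where "N = Suc (\<Sum>j<n. degree (Y j))"
  have deg: "degree (Y j) < N" if "j < n" for j
    using member_le_sum[of j "{..<n}" "\<lambda>j. degree (Y j)"] that by (simp add: N_def less_Suc_eq_le)
  have zero: "\<forall>j<n. coeff (Y j) k = 0" for k
  proof (cases "k \<le> N")
    case True
    then show ?thesis
    proof (induction k rule: inc_induct)
      case base
      then show ?case using deg by (auto intro: coeff_eq_0)
    next
      case (step k)
      show ?case
      proof (intro allI impI)
        fix j assume "j < n"
        then show "coeff (Y j) k = 0" using step.IH by (subst eq) auto
      qed
    qed
  next
    case False
    have "degree (Y j) < k" if "j < n" for j using deg[OF that] False by simp
    then show ?thesis by (auto intro: coeff_eq_0)
  qed
  then show Y0: "Y j = 0" if "j < n" for j using that by (simp add: poly_eq_iff)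
  show "c j = 0" if "j < n" for j
    using assms[OF that] Y0 by (simp add: sum.neutral)
qed

lemma pencil_adjugate:
  "\<exists>d W. d \<noteq> 0 \<and> (\<forall>i<n. \<forall>j<n. mm n W (pencil A) i j = d * idm i j \<and> mm n (pencil A) W i j = d * idm i j)"
proof -
  \<comment> \<open>\<open>adjugate_or_kernel\<close> looks at right kernels while cancellation
    concerns left multipliers, hence the transpose.\<close>
  let ?M = "\<lambda>i j. pencil A j i"
  have "\<not> (\<exists>c. (\<exists>i<n. c i \<noteq> 0) \<and> (\<forall>i<n. (\<Sum>j<n. ?M i j * c j) = 0))"
  proof (intro notI, elim exE conjE)
    fix c i assume c: "i < n" "c i \<noteq> 0" "\<forall>i<n. (\<Sum>j<n. ?M i j * c j) = 0"
    have "c i = 0"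
      by (rule pencil_left_cancel(1)[of n c A "\<lambda>_. 0"]) (use c in \<open>auto simp: mult.commute\<close>)
    with c show False by simp
  qed
  then obtain d W where dW: "d \<noteq> 0" "\<forall>i<n. \<forall>j<n. mm n W ?M i j = d * idm i j \<and> mm n ?M W i j = d * idm i j"
    using adjugate_or_kernel[of n ?M] by blast
  have t: "mm n (\<lambda>i j. P j i) (\<lambda>i j. Q j i) i j = mm n Q P j i" for P Q :: "nat \<Rightarrow> nat \<Rightarrow> real poly" and i j
    by (simp add: mm_def mult.commute)
  have sym: "idm i j = (idm j i :: real poly)" for i j by (simp add: idm_def)
  have "mm n (\<lambda>i j. W j i) (pencil A) i j = d * idm i j \<and> mm n (pencil A) (\<lambda>i j. W j i) i j = d * idm i j"
    if "i < n" "j < n" for i j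
    using that dW(2) t[of W ?M i j] t[of ?M W i j] sym[of i j] by auto
  with dW(1) show ?thesis by (intro exI[of _ d] exI[of _ "\<lambda>i j. W j i"]) simp
qed

text \<open>The dual form of the rank condition: no nonzero row vector annihilates all columns of
  A^k B.\<close>

definition reachable :: "nat \<Rightarrow> nat \<Rightarrow> (nat \<Rightarrow> nat \<Rightarrow> real) \<Rightarrow> (nat \<Rightarrow> nat \<Rightarrow> real) \<Rightarrow> bool" where
  "reachable n m A B \<longleftrightarrow>
    (\<forall>c. (\<forall>k. \<forall>j<m. (\<Sum>i<n. c i * mm n (mpow n A k) B i j) = 0) \<longrightarrow> (\<forall>i<n. c i = 0))"

lemma reachableD:
  assumes "reachable n m A B" "\<And>k j. j < m \<Longrightarrow> (\<Sum>i<n. c i * mm n (mpow n A k) B i j) = 0" "i < n"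
  shows "c i = 0"
  using assms(1)[unfolded reachable_def, THEN spec[of _ c]] assms(2,3) by auto

lemma sum_left_mm: "(\<Sum>i<n. c i * mm k P Q i j) = (\<Sum>l<k. (\<Sum>i<n. c i * P i l) * Q l j)"
  unfolding mm_def sum_distrib_left sum_distrib_right by (subst sum.swap) (simp add: mult.assoc)

text \<open>A chain as in Heymann's lemma: every vector is obtained from the previous one by one step of
  the discrete-time system.\<close>

lemma reachable_chain:
  assumes reach: "reachable n m A B" and "0 < n"
  obtains j v u where "j < m" "\<And>i. v 0 i = B i j"
    "\<And>k i. Suc k < n \<Longrightarrow> v (Suc k) i = (\<Sum>l<n. A i l * v k l) + (\<Sum>a<m. B i a * u k a)"
    "indep n n v"
proof -
  have "\<exists>j<m. \<exists>i<n. B i j \<noteq> 0"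
  proof (rule ccontr)
    assume no: "\<not> ?thesis"
    have "mm n (mpow n A k) B i j = 0" if "j < m" for k i j
      unfolding mm_def using no that by (intro sum.neutral) auto
    then have "(\<Sum>i<n. 1 * mm n (mpow n A k) B i j) = 0" if "j < m" for k j
      using that by (intro sum.neutral) auto
    then have "(1 :: real) = 0" by (rule reachableD[OF reach _ \<open>0 < n\<close>])
    then show False by simp
  qed
  then obtain j i0 where j: "j < m" "i0 < n" "B i0 j \<noteq> 0" by blast
  define Q where "Q k v u \<longleftrightarrow> (\<forall>i. v 0 i = B i j) \<and>
    (\<forall>l i. Suc l < k \<longrightarrow> v (Suc l) i = (\<Sum>r<n. A i r * v l r) + (\<Sum>a<m. B i a * u l a)) \<and> indep n k v"
    for k and v u :: "nat \<Rightarrow> nat \<Rightarrow> real"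
  have "\<exists>v u. Q (Suc k) v u" if "Suc k \<le> n" for k
    using that
  proof (induction k)
    case 0
    have "indep n 0 (\<lambda>_ i. B i j)" by (simp add: indep_def)
    then have "indep n (Suc 0) (\<lambda>_ i. B i j)"
      by (rule indep_Suc[where c = "\<lambda>i. idm i0 i"]) (use j in \<open>simp_all add: sum_mult_idm\<close>)
    then show ?case by (intro exI[of _ "\<lambda>_ i. B i j"]) (auto simp: Q_def)
  next
    case (Suc k)
    then obtain v u where Q: "Q (Suc k) v u" by auto
    define orth where "orth c \<longleftrightarrow> (\<forall>r<Suc k. (\<Sum>i<n. c i * v r i) = 0)" for c
    \<comment> \<open>If every possible next vector stayed in the span of the chain, the annihilator
      of the chain would be invariant under the transpose of A and orthogonal to B. Reachability
      would make it zero, although fewer than \<open>n\<close> vectors have a nonzero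
      annihilator.\<close>
    have "\<exists>c w. orth c \<and> (\<Sum>i<n. c i * ((\<Sum>l<n. A i l * v k l) + (\<Sum>a<m. B i a * w a))) \<noteq> 0"
    proof (rule ccontr)
      assume "\<not> ?thesis"
      then have all: "(\<Sum>i<n. c i * ((\<Sum>l<n. A i l * v k l) + (\<Sum>a<m. B i a * w a))) = 0" if "orth c" for c w
        using that by blast
      have cAv: "(\<Sum>i<n. c i * (\<Sum>l<n. A i l * v k l)) = 0" if "orth c" for c
        using all[OF that, of "\<lambda>_. 0"] by simp
      have cBw: "(\<Sum>i<n. c i * (\<Sum>a<m. B i a * w a)) = 0" if "orth c" for c w
        using all[OF that, of w] cAv[OF that] by (simp add: distrib_left sum.distrib)
      have cB: "(\<Sum>i<n. c i * B i a) = 0" if "orth c" "a < m" for c a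
        using cBw[OF that(1), of "\<lambda>b. idm a b"] that(2) sum_mult_idm[of a m "B _"] by (simp add: mult.commute)
      have step: "orth (\<lambda>l. \<Sum>i<n. c i * A i l)" if c: "orth c" for c
        unfolding orth_def
      proof (intro allI impI)
        fix r assume r: "r < Suc k"
        have "(\<Sum>i<n. (\<Sum>l<n. c l * A l i) * v r i) = (\<Sum>i<n. c i * (\<Sum>l<n. A i l * v r l))"
          unfolding sum_distrib_left sum_distrib_right by (subst sum.swap) (simp add: mult.assoc)
        also have "\<dots> = 0"
        \<comment> \<open>For r < k the chain rewrites A v_r as the next vector minus an input term,
          both orthogonal to \<open>c\<close>. For r = k the assumption speaks about A v_k
          directly.\<close>
        proof (cases "r = k")
          case False
          then have "Suc r < Suc k" using r by simp
          then have "(\<Sum>l<n. A i l * v r l) = v (Suc r) i - (\<Sum>a<m. B i a * u r a)" for i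
            using Q by (simp add: Q_def)
          then show ?thesis using c cBw[OF c] \<open>Suc r < Suc k\<close>
            by (simp add: right_diff_distrib sum_subtractf orth_def)
        qed (use cAv[OF c] in simp)
        finally show "(\<Sum>i<n. (\<Sum>i'<n. c i' * A i' i) * v r i) = 0" .
      qed
      have pw: "orth (\<lambda>l. \<Sum>i<n. c i * mpow n A q i l)" if c: "orth c" for c q
      proof (induction q)
        case 0
        have "(\<Sum>l<n. (\<Sum>i<n. c i * idm i l) * v r l) = (\<Sum>l<n. c l * v r l)" for r
          by (intro sum.cong refl) (simp add: idm_def if_distrib[of "\<lambda>x. _ * x"] sum.delta cong: if_cong)
        then show ?case using c by (simp add: orth_def)
      next
        case (Suc q)
        have "(\<Sum>i<n. c i * mpow n A (Suc q) i l) = (\<Sum>i<n. (\<Sum>i'<n. c i' * mpow n A q i' i) * A i l)"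
          if "l < n" for l
        proof -
          have "(\<Sum>i<n. c i * mpow n A (Suc q) i l) = (\<Sum>i<n. c i * mm n (mpow n A q) A i l)"
            by (intro sum.cong refl) (use that in \<open>simp add: mpow_Suc2 del: mpow.simps\<close>)
          then show ?thesis by (simp only: sum_left_mm)
        qed
        then show ?case using step[OF Suc.IH] by (simp add: orth_def del: mpow.simps)
      qed
      obtain c where c: "\<exists>i<n. c i \<noteq> 0" "\<And>r. r < Suc k \<Longrightarrow> (\<Sum>i<n. v r i * c i) = 0"
        using orthogonal_vector[of "Suc k" n v] Suc.prems by auto
      then have "orth c" by (simp add: orth_def mult.commute)
      have "(\<Sum>i<n. c i * mm n (mpow n A q) B i a) = 0" if "a < m" for q a
        unfolding sum_left_mm using cB[OF pw[OF \<open>orth c\<close>] that] .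
      then have "c i = 0" if "i < n" for i by (rule reachableD[OF reach _ that])
      with c(1) show False by blast
    qed
    then obtain c w where c: "orth c"
      "(\<Sum>i<n. c i * ((\<Sum>l<n. A i l * v k l) + (\<Sum>a<m. B i a * w a))) \<noteq> 0" by blast
    define v' where "v' = v(Suc k := \<lambda>i. (\<Sum>l<n. A i l * v k l) + (\<Sum>a<m. B i a * w a))"
    have "indep n (Suc k) v'"
      using Q by (simp add: Q_def indep_def v'_def)
    then have "indep n (Suc (Suc k)) v'"
      by (rule indep_Suc[where c = c]) (use c in \<open>auto simp: v'_def orth_def\<close>)
    then have "Q (Suc (Suc k)) v' (u(k := w))"
      using Q by (auto simp: Q_def v'_def less_Suc_eq)
    then show ?case by blast
  qed
  from this[of "n - 1"] obtain v u where "Q n v u" using \<open>0 < n\<close> by auto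
  then have "\<And>i. v 0 i = B i j"
    "\<And>k i. Suc k < n \<Longrightarrow> v (Suc k) i = (\<Sum>l<n. A i l * v k l) + (\<Sum>a<m. B i a * u k a)"
    "indep n n v" unfolding Q_def by blast+
  then show ?thesis by (rule that[OF j(1)])
qed

section \<open>Flat outputs\<close>

text \<open>The parametrisation x = X f, u = U f of the solutions of the state equation by free
  functions f, with the left inverse \<open>Lx\<close>, \<open>Lu\<close>. The last clause says that
  a solution with zero flat output is zero; applied to the difference between a solution and its
  parametrised copy, it makes the parametrisation onto.\<close>

definition flat_data where
  "flat_data n m A B X U Lx Lu \<longleftrightarrow>
    (\<forall>i<n. \<forall>b<m. degree (X i b) \<le> n) \<and> (\<forall>i<m. \<forall>b<m. degree (U i b) \<le> n) \<and>
    (\<forall>i<n. \<forall>b<m. mm n (pencil A) X i b = mm m (cm B) U i b) \<and>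
    (\<forall>i<m. \<forall>b<m. mm n (cm Lx) X i b + mm m (cm Lu) U i b = idm i b) \<and>
    (\<forall>x u. (\<forall>i<n. \<forall>\<phi>. ddiff (x i) \<phi> = (\<Sum>l<n. A i l * x l \<phi>) + (\<Sum>b<m. B i b * u b \<phi>)) \<longrightarrow>
       (\<forall>i<m. \<forall>\<phi>. (\<Sum>l<n. Lx i l * x l \<phi>) + (\<Sum>b<m. Lu i b * u b \<phi>) = 0) \<longrightarrow>
       (\<forall>i<n. x i = 0) \<and> (\<forall>b<m. u b = 0))"

lemma sum_idm_mult: "j < n \<Longrightarrow> (\<Sum>l<n. f l * idm l j) = (f j :: 'a :: comm_ring_1)"
  by (simp add: idm_def if_distrib[of "\<lambda>x. _ * x"] sum.delta cong: if_cong)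

lemma degree_lessThan_sum_le: "(\<And>i. i < (k :: nat) \<Longrightarrow> degree (f i) \<le> n) \<Longrightarrow> degree (\<Sum>i<k. f i :: real poly) \<le> n"
  by (rule degree_sum_le) auto

text \<open>Write x in the basis of the chain with coordinates xi, and u = u' xi + z, where u' xi is
  the feedback read off the chain. Then the derivative of xi_k is xi_(k-1) + al_k xi_(n-1) plus the
  sum of be_k b z_b over b different from j, where z_j stands in for xi_(-1). The flat output
  consists of xi_(n-1) and the z_b with b different from j; solving from k = n - 1 downwards
  expresses all coordinates by it.\<close>

lemma flat_data_exists:
  assumes reach: "reachable n m A B"
  shows "\<exists>X U Lx Lu. flat_data n m A B X U Lx Lu"
proof (cases "n = 0")
  case True
  have "mm m (cm idm) idm i b = idm i b" if "i < m" "b < m" for i b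
    using mm_idm_right[OF that(2), of "cm idm" i] by (simp add: cm_def idm_def one_pCons)
  then have "flat_data n m A B (\<lambda>_ _. 0) idm (\<lambda>_ _. 0) idm"
    using True by (auto simp: flat_data_def mm_def[of 0] idm_def[of _ _ , where 'a = "real poly"] sum_mult_idm fun_eq_iff)
  then show ?thesis by blast
next
  case False
  then have n: "0 < n" by simp
  obtain j v w where j: "j < m" "\<And>i. v 0 i = B i j"
    and chain: "\<And>k i. Suc k < n \<Longrightarrow> v (Suc k) i = (\<Sum>l<n. A i l * v k l) + (\<Sum>a<m. B i a * w k a)"
    and ind: "indep n n v"
    using reachable_chain[OF reach n] by blast
  obtain W where W1: "\<And>k r. k < n \<Longrightarrow> r < n \<Longrightarrow> (\<Sum>l<n. W k l * v r l) = idm k r"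
    and W2: "\<And>i l. i < n \<Longrightarrow> l < n \<Longrightarrow> (\<Sum>k<n. v k i * W k l) = idm i l"
  proof -
    have "\<not> (\<exists>c. (\<exists>i<n. c i \<noteq> 0) \<and> (\<forall>i<n. (\<Sum>r<n. v r i * c r) = 0))"
      using ind by (auto simp: indep_def mult.commute)
    then obtain d W where d: "d \<noteq> 0"
      "\<forall>i<n. \<forall>l<n. mm n W (\<lambda>i r. v r i) i l = d * idm i l \<and> mm n (\<lambda>i r. v r i) W i l = d * idm i l"
      using adjugate_or_kernel[of n "\<lambda>i r. v r i"] by blast
    show ?thesis
    proof (rule that[of "\<lambda>k l. W k l / d"])
      fix k r assume "k < n" "r < n"
      then have "mm n W (\<lambda>i r. v r i) k r / d = idm k r" "mm n (\<lambda>i r. v r i) W k r / d = idm k r"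
        using d by auto
      then show "(\<Sum>l<n. W k l / d * v r l) = idm k r" "(\<Sum>l<n. v l k * (W l r / d)) = idm k r"
        by (simp_all add: mm_def sum_divide_distrib)
    qed
  qed
  \<comment> \<open>No vector follows the last one in the chain, so its feedback is set to
    zero.\<close>
  define u' where "u' k a = (if Suc k < n then w k a else 0)" for k a
  \<comment> \<open>Coordinates in the chain basis: \<open>al\<close> of A applied to the last
    vector, \<open>be\<close> of the columns of B.\<close>
  define al where "al k = (\<Sum>l<n. W k l * (\<Sum>q<n. A l q * v (n - 1) q))" for k
  define be where "be k b = (\<Sum>l<n. W k l * B l b)" for k b
  have expand: "(\<Sum>k<n. v k i * (\<Sum>l<n. W k l * f l)) = f i" if "i < n" for i f
  proof -
    have "(\<Sum>k<n. v k i * (\<Sum>l<n. W k l * f l)) = (\<Sum>l<n. (\<Sum>k<n. v k i * W k l) * f l)"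
      unfolding sum_distrib_left sum_distrib_right by (subst sum.swap) (simp add: mult.assoc)
    then show ?thesis using that by (simp add: W2 sum_mult_idm)
  qed
  have Av: "(\<Sum>l<n. A i l * v k l) = (if Suc k < n then v (Suc k) i else \<Sum>r<n. al r * v r i) - (\<Sum>b<m. B i b * u' k b)"
    if "i < n" "k < n" for i k
  proof (cases "Suc k < n")
    case True
    then show ?thesis using chain by (simp add: u'_def)
  next
    case False
    then have "k = n - 1" using that by simp
    then show ?thesis using expand[OF that(1), of "\<lambda>l. \<Sum>q<n. A l q * v (n - 1) q"] False
      by (simp add: al_def u'_def mult.commute)
  qed
  have Bv: "(\<Sum>k<n. v k i * be k b) = B i b" if "i < n" for i b
    unfolding be_def by (rule expand[OF that])
  \<comment> \<open>The index \<open>d\<close> counts the steps down from the top: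
    \<open>Pd d\<close> is the polynomial row that yields coordinate n - 1 - d from the flat output.
    Each step solves one equation of the chain and costs one differentiation.\<close>
  define Pd where "Pd = rec_nat (\<lambda>b. idm j b)
    (\<lambda>d P b. [:0, 1:] * P b - [:al (n - 1 - d):] * idm j b - (if b = j then 0 else [:be (n - 1 - d) b:]))"
  have Pd0: "Pd 0 b = idm j b" for b by (simp add: Pd_def)
  have PdS: "Pd (Suc d) b = [:0, 1:] * Pd d b - [:al (n - 1 - d):] * idm j b - (if b = j then 0 else [:be (n - 1 - d) b:])" for d b
    by (simp add: Pd_def)
  have degP: "degree (Pd d b) \<le> d" for d b
  proof (induction d)
    case 0
    then show ?case by (simp add: Pd0 idm_def)
  next
    case (Suc d)
    have "degree ([:0, 1:] * Pd d b) \<le> Suc d"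
      using degree_mult_le[of "[:0, 1:]" "Pd d b"] Suc by simp
    moreover have "degree ([:al (n - 1 - d):] * idm j b :: real poly) \<le> Suc d" by (simp add: idm_def)
    ultimately show ?case unfolding PdS by (intro degree_diff_le) auto
  qed
  define P where "P k = Pd (n - 1 - k)" for k
  \<comment> \<open>One step beyond coordinate 0 gives the input component z_j. This step raises the
    degree bound from n - 1 to n.\<close>
  define Vr where "Vr = Pd n"
  have sP: "[:0, 1:] * P k b = (if k = 0 then Vr b else P (k - 1) b) + [:al k:] * idm j b + (if b = j then 0 else [:be k b:])"
    if "k < n" for k b
  proof -
    define d where "d = n - 1 - k"
    have "n - 1 - d = k" using that by (simp add: d_def)
    moreover have "Pd (Suc d) = (if k = 0 then Vr else P (k - 1))"
    proof (cases "k = 0")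
      case True
      then show ?thesis using n by (simp add: d_def Vr_def)
    next
      case False
      then have "Suc d = n - 1 - (k - 1)" using that by (simp add: d_def)
      then show ?thesis using False by (simp add: P_def)
    qed
    ultimately show ?thesis using PdS[of d b] by (auto simp: P_def d_def algebra_simps)
  qed
  define X where "X i b = (\<Sum>k<n. [:v k i:] * P k b)" for i b
  define V where "V i b = (if i = j then Vr b else idm i b)" for i b
  define U where "U i b = V i b + (\<Sum>k<n. [:u' k i:] * P k b)" for i b
  \<comment> \<open>Component \<open>j\<close> of the flat output reads the last coordinate; each
    other component is the input with its feedback part removed.\<close>
  define Lx where "Lx i l = (if i = j then W (n - 1) l else - (\<Sum>k<n. u' k i * W k l))" for i l
  define Lu where "Lu i b = (if i = j then 0 else idm i b :: real)" for i b
  have degX: "degree (X i b) \<le> n" for i b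
    unfolding X_def
  proof (rule degree_lessThan_sum_le)
    fix k
    show "degree ([:v k i:] * P k b) \<le> n"
      using degree_mult_le[of "[:v k i:]" "P k b"] degP[of "n - 1 - k" b] by (simp add: P_def)
  qed
  have degU: "degree (U i b) \<le> n" for i b
    unfolding U_def
  proof (rule degree_add_le)
    show "degree (V i b) \<le> n" using degP[of n b] by (auto simp: V_def Vr_def idm_def)
    show "degree (\<Sum>k<n. [:u' k i:] * P k b) \<le> n"
    proof (rule degree_lessThan_sum_le)
      fix k
      show "degree ([:u' k i:] * P k b) \<le> n"
        using degree_mult_le[of "[:u' k i:]" "P k b"] degP[of "n - 1 - k" b] by (simp add: P_def)
    qed
  qed
  have WX: "(\<Sum>l<n. [:W k l:] * X l b) = P k b" if "k < n" for k b
  proof -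
    have "(\<Sum>l<n. [:W k l:] * X l b) = (\<Sum>r<n. [:\<Sum>l<n. W k l * v r l:] * P r b)"
      unfolding X_def sum_distrib_left const_sum sum_distrib_right by (subst sum.swap) (simp add: mult_ac)
    also have "\<dots> = (\<Sum>r<n. idm k r * P r b)"
      using that by (intro sum.cong) (auto simp: W1 idm_def)
    finally show ?thesis using that by (simp add: sum_mult_idm)
  qed
  have c: "mm n (pencil A) X i b = mm m (cm B) U i b" if i: "i < n" and b: "b < m" for i b
  proof -
    have "mm n (pencil A) X i b = [:0, 1:] * (\<Sum>l<n. idm i l * X l b) - (\<Sum>l<n. [:A i l:] * X l b)"
      by (simp only: mm_def pencil_def cm_def left_diff_distrib sum_subtractf sum_distrib_left mult.assoc)
    also have "(\<Sum>l<n. idm i l * X l b) = X i b" using i by (rule sum_mult_idm)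
    also have "(\<Sum>l<n. [:A i l:] * X l b) = (\<Sum>k<n. [:\<Sum>l<n. A i l * v k l:] * P k b)"
      unfolding X_def sum_distrib_left const_sum sum_distrib_right by (subst sum.swap) (simp add: mult_ac)
    also have "[:0, 1:] * X i b = (\<Sum>k<n. [:v k i:] * ([:0, 1:] * P k b))"
      unfolding X_def sum_distrib_left by (simp only: mult.left_commute)
    also have "(\<Sum>k<n. [:v k i:] * ([:0, 1:] * P k b)) =
        (\<Sum>k<n. [:v k i:] * (if k = 0 then Vr b else P (k - 1) b))
        + (\<Sum>k<n. [:al k * v k i:]) * idm j b + (\<Sum>k<n. if b = j then 0 else [:v k i * be k b:])"
      unfolding sum_distrib_right sum.distrib[symmetric]
    proof (intro sum.cong refl)
      fix k assume "k \<in> {..<n}"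
      then have k: "k < n" by simp
      show "[:v k i:] * ([:0, 1:] * P k b) = [:v k i:] * (if k = 0 then Vr b else P (k - 1) b)
          + [:al k * v k i:] * idm j b + (if b = j then 0 else [:v k i * be k b:])"
        unfolding sP[OF k] by (simp add: algebra_simps)
    qed
    also have "(\<Sum>k<n. [:v k i:] * (if k = 0 then Vr b else P (k - 1) b)) =
        [:B i j:] * Vr b + (\<Sum>k<n. (if Suc k < n then [:v (Suc k) i:] * P k b else 0))"
    proof -
      obtain n' where n': "n = Suc n'" using n by (cases n) auto
      show ?thesis unfolding n' by (subst sum.lessThan_Suc_shift) (simp add: j(2))
    qed
    also have "(\<Sum>k<n. if b = j then 0 else [:v k i * be k b:]) = (if b = j then 0 else [:B i b:])"
      using Bv[OF i, of b] by (simp add: const_sum[symmetric])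
    also have "(\<Sum>k<n. [:\<Sum>l<n. A i l * v k l:] * P k b) =
        (\<Sum>k<n. (if Suc k < n then [:v (Suc k) i:] * P k b else 0)) + [:\<Sum>r<n. al r * v r i:] * idm j b
        - (\<Sum>k<n. [:\<Sum>a<m. B i a * u' k a:] * P k b)"
    proof -
      have "(\<Sum>k<n. [:\<Sum>l<n. A i l * v k l:] * P k b) =
          (\<Sum>k<n. (if Suc k < n then [:v (Suc k) i:] * P k b else 0)
            + (if k = n - 1 then [:\<Sum>r<n. al r * v r i:] * P k b else 0) - [:\<Sum>a<m. B i a * u' k a:] * P k b)"
      proof (intro sum.cong refl)
        fix k assume "k \<in> {..<n}"
        then have k: "k < n" by simp
        then show "[:\<Sum>l<n. A i l * v k l:] * P k b = (if Suc k < n then [:v (Suc k) i:] * P k b else 0)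
            + (if k = n - 1 then [:\<Sum>r<n. al r * v r i:] * P k b else 0) - [:\<Sum>a<m. B i a * u' k a:] * P k b"
          unfolding Av[OF i k] by (auto simp: smult_diff_left)
      qed
      moreover have "(\<Sum>k<n. if k = n - 1 then [:\<Sum>r<n. al r * v r i:] * P k b else 0) = [:\<Sum>r<n. al r * v r i:] * idm j b"
        using n by (simp add: P_def Pd0)
      ultimately show ?thesis by (simp add: sum.distrib sum_subtractf)
    qed
    finally have "mm n (pencil A) X i b = [:B i j:] * Vr b + (if b = j then 0 else [:B i b:])
        + (\<Sum>k<n. [:\<Sum>a<m. B i a * u' k a:] * P k b)"
      by (simp add: const_sum)
    also have "[:B i j:] * Vr b + (if b = j then 0 else [:B i b:]) = (\<Sum>a<m. [:B i a:] * V a b)"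
    proof -
      have "(\<Sum>a<m. [:B i a:] * V a b) = (\<Sum>a<m. (if a = j then [:B i a:] * Vr b else 0) + [:B i a:] * idm a b * (if b = j then 0 else 1))"
        by (intro sum.cong refl) (auto simp: V_def idm_def)
      also have "\<dots> = [:B i j:] * Vr b + (\<Sum>a<m. [:B i a:] * idm a b) * (if b = j then 0 else 1)"
        using j(1) by (simp add: sum.distrib sum_distrib_right)
      also have "(\<Sum>a<m. [:B i a:] * idm a b) = [:B i b:]" using b by (rule sum_idm_mult)
      finally show ?thesis by auto
    qed
    also have "(\<Sum>k<n. [:\<Sum>a<m. B i a * u' k a:] * P k b) = (\<Sum>a<m. [:B i a:] * (\<Sum>k<n. [:u' k a:] * P k b))"
      unfolding sum_distrib_left const_sum sum_distrib_right by (subst sum.swap) (simp add: mult_ac)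
    finally show ?thesis by (simp add: mm_def cm_def U_def distrib_left sum.distrib)
  qed
  have d: "mm n (cm Lx) X i b + mm m (cm Lu) U i b = idm i b" if i: "i < m" and b: "b < m" for i b
  proof (cases "i = j")
    case True
    have "mm n (cm Lx) X i b = P (n - 1) b" using WX[of "n - 1" b] n True by (simp add: mm_def cm_def Lx_def)
    moreover have "mm m (cm Lu) U i b = 0" using True by (simp add: mm_def cm_def Lu_def)
    ultimately show ?thesis using True by (simp add: P_def Pd0)
  next
    case False
    have "mm n (cm Lx) X i b = - (\<Sum>l<n. (\<Sum>k<n. [:u' k i:] * ([:W k l:] * X l b)))"
    proof -
      have "[:Lx i l:] * X l b = - (\<Sum>k<n. [:u' k i:] * ([:W k l:] * X l b))" for l
      proof -
        have "[:Lx i l:] = - [:\<Sum>k<n. u' k i * W k l:]" using False by (simp add: Lx_def)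
        then show ?thesis unfolding const_sum by (simp add: sum_distrib_right sum_distrib_left mult.commute)
      qed
      then show ?thesis by (simp only: mm_def cm_def sum_negf)
    qed
    also have "\<dots> = - (\<Sum>k<n. [:u' k i:] * P k b)"
      by (subst sum.swap)
        (intro arg_cong[where f = uminus] sum.cong refl, simp only: sum_distrib_left[symmetric] WX lessThan_iff)
    finally have "mm n (cm Lx) X i b = - (\<Sum>k<n. [:u' k i:] * P k b)" .
    moreover have "mm m (cm Lu) U i b = (\<Sum>a<m. idm i a * U a b)"
      unfolding mm_def using False by (intro sum.cong refl) (auto simp: cm_def Lu_def idm_def one_pCons)
    ultimately show ?thesis using False i by (simp add: sum_mult_idm U_def V_def)
  qed
  have h: "(\<forall>i<n. x i = 0) \<and> (\<forall>b<m. u b = 0)"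
    if ode: "\<forall>i<n. \<forall>\<phi>. ddiff (x i) \<phi> = (\<Sum>l<n. A i l * x l \<phi>) + (\<Sum>b<m. B i b * u b \<phi>)"
      and L: "\<forall>i<m. \<forall>\<phi>. (\<Sum>l<n. Lx i l * x l \<phi>) + (\<Sum>b<m. Lu i b * u b \<phi>) = 0"
    for x u :: "nat \<Rightarrow> distribution"
  proof -
    define xi where "xi k \<phi> = (\<Sum>l<n. W k l * x l \<phi>)" for k \<phi>
    have x: "x i \<phi> = (\<Sum>k<n. v k i * xi k \<phi>)" if "i < n" for i \<phi>
      unfolding xi_def using expand[OF that] by simp
    \<comment> \<open>The part of input \<open>j\<close> left after removal of the feedback; the
      other inputs equal their feedback because their flat outputs are zero.\<close>
    define z where "z \<phi> = u j \<phi> - (\<Sum>k<n. u' k j * xi k \<phi>)" for \<phi>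
    have last: "xi (n - 1) \<phi> = 0" for \<phi>
      using L[rule_format, OF j(1), of \<phi>] by (simp add: xi_def Lx_def Lu_def)
    have u: "u b \<phi> = (\<Sum>k<n. u' k b * xi k \<phi>) + (if b = j then z \<phi> else 0)" if "b < m" for b \<phi>
    proof (cases "b = j")
      case False
      have "(\<Sum>l<n. Lx b l * x l \<phi>) + (\<Sum>a<m. idm b a * u a \<phi>) = 0"
        using L[rule_format, OF that, of \<phi>] False by (simp add: Lu_def)
      moreover have "(\<Sum>l<n. Lx b l * x l \<phi>) = - (\<Sum>k<n. u' k b * xi k \<phi>)"
        using False unfolding Lx_def xi_def sum_distrib_left
        by (simp add: sum_negf sum_distrib_right mult.assoc) (rule sum.swap)
      ultimately show ?thesis using False that by (simp add: sum_mult_idm)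
    qed (simp add: z_def)
    have rhs: "(\<Sum>l<n. A i l * x l \<phi>) + (\<Sum>b<m. B i b * u b \<phi>)
        = (\<Sum>k<n. (if Suc k < n then v (Suc k) i * xi k \<phi> else 0)) + B i j * z \<phi>" if i: "i < n" for i \<phi>
    proof -
      have "(\<Sum>l<n. A i l * x l \<phi>) = (\<Sum>k<n. (\<Sum>l<n. A i l * v k l) * xi k \<phi>)"
        by (simp add: x sum_distrib_left sum_distrib_right mult.assoc) (rule sum.swap)
      also have "\<dots> = (\<Sum>k<n. (if Suc k < n then v (Suc k) i * xi k \<phi> else 0) - (\<Sum>b<m. B i b * u' k b) * xi k \<phi>)"
      proof (intro sum.cong refl)
        fix k assume "k \<in> {..<n}"
        then have k: "k < n" by simp
        have "xi k \<phi> = 0" if "\<not> Suc k < n"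
        proof -
          have "k = n - 1" using that k by simp
          then show ?thesis using last by simp
        qed
        then show "(\<Sum>l<n. A i l * v k l) * xi k \<phi> = (if Suc k < n then v (Suc k) i * xi k \<phi> else 0) - (\<Sum>b<m. B i b * u' k b) * xi k \<phi>"
          unfolding Av[OF i k] by (auto simp: algebra_simps)
      qed
      also have "\<dots> = (\<Sum>k<n. (if Suc k < n then v (Suc k) i * xi k \<phi> else 0)) - (\<Sum>b<m. B i b * (\<Sum>k<n. u' k b * xi k \<phi>))"
        by (simp add: sum_subtractf sum_distrib_left sum_distrib_right mult.assoc) (rule sum.swap)
      finally have 1: "(\<Sum>l<n. A i l * x l \<phi>) = (\<Sum>k<n. (if Suc k < n then v (Suc k) i * xi k \<phi> else 0)) - (\<Sum>b<m. B i b * (\<Sum>k<n. u' k b * xi k \<phi>))" .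
      have "(\<Sum>b<m. B i b * u b \<phi>) = (\<Sum>b<m. B i b * (\<Sum>k<n. u' k b * xi k \<phi>) + (if b = j then B i b * z \<phi> else 0))"
        by (intro sum.cong refl) (auto simp: u distrib_left)
      also have "\<dots> = (\<Sum>b<m. B i b * (\<Sum>k<n. u' k b * xi k \<phi>)) + B i j * z \<phi>"
        using j(1) by (simp add: sum.distrib)
      finally show ?thesis using 1 by simp
    qed
    have dxi: "ddiff (xi r) \<phi> = (if r = 0 then z \<phi> else xi (r - 1) \<phi>)" if r: "r < n" for r \<phi>
    proof -
      have "ddiff (xi r) \<phi> = (\<Sum>i<n. W r i * ddiff (x i) \<phi>)"
        by (simp add: ddiff_def xi_def sum_negf)
      also have "\<dots> = (\<Sum>i<n. W r i * ((\<Sum>k<n. (if Suc k < n then v (Suc k) i * xi k \<phi> else 0)) + B i j * z \<phi>))"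
        using ode by (intro sum.cong refl) (simp add: rhs)
      also have "\<dots> = (\<Sum>k<n. (if Suc k < n then (\<Sum>i<n. W r i * v (Suc k) i) * xi k \<phi> else 0)) + (\<Sum>i<n. W r i * v 0 i) * z \<phi>"
      proof -
        have "(\<Sum>i<n. W r i * (\<Sum>k<n. (if Suc k < n then v (Suc k) i * xi k \<phi> else 0)))
            = (\<Sum>k<n. (if Suc k < n then (\<Sum>i<n. W r i * v (Suc k) i) * xi k \<phi> else 0))"
          unfolding sum_distrib_left
          by (subst sum.swap) (intro sum.cong refl, simp add: sum_distrib_right mult.assoc)
        then show ?thesis by (simp add: distrib_left sum.distrib sum_distrib_right j(2) mult.assoc)
      qed
      also have "\<dots> = (\<Sum>k<n. (if Suc k = r then xi k \<phi> else 0)) + idm r 0 * z \<phi>"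
        using r n by (intro arg_cong2[where f = "(+)"] sum.cong refl) (auto simp: W1 idm_def)
      also have "\<dots> = (if r = 0 then z \<phi> else xi (r - 1) \<phi>)"
      proof (cases r)
        case (Suc r')
        then show ?thesis using r by (simp add: idm_def)
      qed (simp add: idm_def)
      finally show ?thesis .
    qed
    \<comment> \<open>A vanishing coordinate has vanishing derivative, and by \<open>dxi\<close>
      that derivative is the preceding coordinate. The zeros run from the end of the chain to
      coordinate 0 and finally to \<open>z\<close>.\<close>
    have xi0: "\<forall>\<phi>. xi (n - 1 - k) \<phi> = 0" if "k < n" for k
      using that
    proof (induction k)
      case 0
      then show ?case using last by simp
    next
      case (Suc k)
      then have "ddiff (xi (n - 1 - k)) \<phi> = 0" for \<phi> by (simp add: ddiff_def)
      moreover have "n - 1 - k \<noteq> 0" "n - 1 - k - 1 = n - 1 - Suc k" "n - 1 - k < n" using Suc.prems by auto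
      ultimately show ?case using dxi[of "n - 1 - k"] by auto
    qed
    have xi: "xi k \<phi> = 0" if "k < n" for k \<phi>
      using xi0[of "n - 1 - k"] that by simp
    have "z \<phi> = 0" for \<phi> using dxi[OF n, of \<phi>] xi[OF n] by (simp add: ddiff_def)
    then show ?thesis using x u xi by (auto simp: fun_eq_iff)
  qed
  have "flat_data n m A B X U Lx Lu"
  proof -
    have 1: "\<forall>i<n. \<forall>b<m. degree (X i b) \<le> n" "\<forall>i<m. \<forall>b<m. degree (U i b) \<le> n"
      using degX degU by blast+
    have 2: "\<forall>i<n. \<forall>b<m. mm n (pencil A) X i b = mm m (cm B) U i b" by (intro allI impI c)
    have 3: "\<forall>i<m. \<forall>b<m. mm n (cm Lx) X i b + mm m (cm Lu) U i b = idm i b" by (intro allI impI d)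
    show ?thesis
      unfolding flat_data_def by (rule conjI[OF 1(1) conjI[OF 1(2) conjI[OF 2 conjI[OF 3]]]]) ((rule allI)+, (rule impI)+, rule h, assumption+)
  qed
  then show ?thesis by blast
qed

section \<open>Kernels and state equations\<close>

lemma ddiff_reg_smooth:
  assumes "smooth a" "\<And>t. (a has_real_derivative a' t) (at t)" "smooth a'"
  shows "ddiff (reg a) = reg a'"
  using ddiff_smooth_mult[OF assms, of "\<lambda>_. 1" "\<lambda>_. 0"] by (simp add: L2_const ddiff_reg_const reg_zero)

text \<open>On an eigenvector of differentiation polynomials act by evaluation. Applied to
  exponentials, it turns distributional identities into pointwise identities of polynomials.\<close>

lemma act_eigen: "(\<And>\<phi>. ddiff T \<phi> = c * T \<phi>) \<Longrightarrow> act p T \<phi> = poly p c * T \<phi>"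
proof (induction p arbitrary: \<phi>)
  case 0
  then show ?case by (simp add: act_0)
next
  case (pCons a p)
  have "act p T = (\<lambda>\<phi>. poly p c * T \<phi>)" using pCons by auto
  then have "ddiff (act p T) \<phi> = poly p c * ddiff T \<phi>" by (simp add: ddiff_def)
  then show ?case using pCons.prems by (simp add: act_pCons algebra_simps)
qed

definition expd :: "real \<Rightarrow> distribution" where "expd c = reg (\<lambda>t. exp (c * t))"

lemma ddiff_expd: "ddiff (expd c) \<phi> = c * expd c \<phi>"
proof -
  have "ddiff (expd c) = reg (\<lambda>t. c * exp (c * t))"
    unfolding expd_def
    by (rule ddiff_reg_smooth)
      (auto intro!: smooth_exp smooth_mult smooth_const derivative_eq_intros)
  then show ?thesis by (simp add: reg_cmult act_const expd_def)
qed

lemma L2_smooth: "smooth a \<Longrightarrow> a \<in> L2"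
  by (intro L2_continuous smooth_continuous)

lemma expd_nonzero: "\<exists>\<phi>. expd c \<phi> \<noteq> 0"
proof (rule ccontr)
  assume "\<not> ?thesis"
  then have "reg (\<lambda>t. exp (c * t)) = 0" by (auto simp: expd_def fun_eq_iff)
  then have "AE t in lebesgue_on I. exp (c * t) = 0" by (intro reg_eq_0_imp_AE L2_smooth smooth_exp)
  then show False using AE_I_False by simp
qed

lemma poly_eq_0_by_values: "(\<And>x. poly p x = 0) \<Longrightarrow> p = (0 :: real poly)"
  by (metis ext poly_0 poly_eq_poly_eq_iff)

text \<open>The set of nonzeros is open and null, hence empty.\<close>

lemma AE_zero_continuous:
  fixes f :: "real \<Rightarrow> real"
  assumes "open S" "continuous_on S f" "AE t in lebesgue. t \<in> S \<longrightarrow> f t = 0" "t \<in> S"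
  shows "f t = 0"
proof (rule ccontr)
  assume "f t \<noteq> 0"
  let ?N = "{t \<in> S. f t \<noteq> 0}"
  have "?N = S \<inter> f -` (- {0})" by auto
  have "\<forall>B. open B \<longrightarrow> open (f -` B \<inter> S)"
    using continuous_on_open_vimage[OF assms(1), of f] assms(2) by simp
  then have "open (f -` (- {0}) \<inter> S)" by blast
  then have op: "open ?N" using \<open>?N = S \<inter> f -` (- {0})\<close> by (simp add: Int_commute)
  then have "?N \<in> sets lebesgue" by simp
  then have "?N \<in> null_sets lebesgue" using assms(3) by (subst AE_iff_null_sets) (auto elim: eventually_mono)
  then have "negligible ?N" by (simp add: negligible_iff_null_sets)
  then show False using open_not_negligible[OF op] \<open>f t \<noteq> 0\<close> assms(4) by auto
qed

text \<open>The equation is rewritten as a first order system for the distributional derivatives.\<close>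

lemma scalar_ode_smooth:
  assumes f: "f \<in> L2" and d: "d \<noteq> 0" and ode: "act d (reg f) = 0"
  obtains h where "smooth h" "AE t in lebesgue_on I. f t = h t"
proof (cases "degree d = 0")
  case True
  then obtain c where c: "d = [:c:]" by (rule degree_eq_zeroE)
  then have "reg f = 0" using ode d by (auto simp: act_const fun_eq_iff)
  then show ?thesis using that[OF smooth_const[of 0] reg_eq_0_imp_AE[OF f]] by simp
next
  case False
  define N where "N = degree d"
  have N: "0 < N" using False by (simp add: N_def)
  define T where "T i = (ddiff ^^ i) (reg f)" for i
  \<comment> \<open>The companion matrix of \<open>d\<close> after division by its leading
    coefficient.\<close>
  define A where "A i l = (if Suc i < N then idm (Suc i) l else - coeff d l / coeff d N)" for i l
  have lead: "coeff d N \<noteq> 0" using d by (simp add: N_def)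
  have lin: "linear (T i)" for i unfolding T_def by (rule linear_ddiff_pow[OF linear_reg[OF f]])
  have "ddiff (T i) \<phi> = (\<Sum>l<N. A i l * T l \<phi>)" if "i < N" for i \<phi>
  proof (cases "Suc i < N")
    case True
    then show ?thesis by (simp add: A_def sum_mult_idm) (simp add: T_def)
  next
    case False
    then have i: "Suc i = N" using that by simp
    have "0 = (\<Sum>l\<le>N. coeff d l * T l \<phi>)"
      using fun_cong[OF ode, of \<phi>] by (simp add: act_def N_def T_def)
    also have "\<dots> = (\<Sum>l<N. coeff d l * T l \<phi>) + coeff d N * T N \<phi>"
      by (simp add: lessThan_Suc_atMost[symmetric])
    finally have "T N \<phi> = (\<Sum>l<N. - coeff d l / coeff d N * T l \<phi>)"
      using lead by (simp add: sum_negf sum_divide_distrib[symmetric] field_simps)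
    moreover have "ddiff (T i) = T N" unfolding T_def i[symmetric] by simp
    ultimately show ?thesis using False by (simp add: A_def)
  qed
  from distribution_linear_system[OF lin this]
  obtain c where c: "\<forall>i<N. T i = reg (\<lambda>t. \<Sum>j<N. mexp N A i j t * c j)" ..
  let ?h = "\<lambda>t. \<Sum>j<N. mexp N A 0 j t * c j"
  have h: "smooth ?h" by (intro smooth_sum smooth_mult smooth_mexp smooth_const N)
  have "reg f = reg ?h" using c[rule_format, OF N] by (simp add: T_def)
  then show ?thesis by (intro that[OF h] reg_eq_imp_AE f L2_smooth h)
qed

lemma smooth_imp_smooth_clI: "smooth f \<Longrightarrow> f \<in> smooth_clI"
  unfolding smooth_clI_def
proof (intro CollectI exI[of _ "\<lambda>n. (deriv ^^ n) f"] conjI allI ballI)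
  fix n t assume f: "smooth f"
  then have "smooth ((deriv ^^ n) f)" by (induction n) (auto intro: smooth_deriv)
  then show "((deriv ^^ n) f has_real_derivative (deriv ^^ Suc n) f t) (at t within clI)"
    by (auto intro: has_field_derivative_at_within smooth_has_deriv)
qed simp

section \<open>Free responses and kernel representations\<close>

definition free_response where
  "free_response n A C x0 i t = (\<Sum>l<n. C i l * (\<Sum>j<n. mexp n A l j t * x0 j))"

lemma smooth_free_state: "l < n \<Longrightarrow> smooth (\<lambda>t. \<Sum>j<n. mexp n A l j t * x0 j)"
  by (intro smooth_sum smooth_mult smooth_mexp smooth_const)

lemma smooth_free_response: "smooth (free_response n A C x0 i)"
  unfolding free_response_def[abs_def] by (intro smooth_sum smooth_mult smooth_const smooth_free_state) auto

definition free_state where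
  "free_state n A x0 l = reg (\<lambda>t. \<Sum>j<n. mexp n A l j t * x0 j)"

lemma ddiff_free_state: "i < n \<Longrightarrow> ddiff (free_state n A x0 i) = mv n (cm A) (free_state n A x0) i"
proof -
  assume i: "i < n"
  have "ddiff (free_state n A x0 i) = reg (\<lambda>t. \<Sum>j<n. (\<Sum>l<n. A i l * mexp n A l j t) * x0 j)"
    unfolding free_state_def
    by (rule ddiff_reg_smooth)
      (auto intro!: smooth_sum smooth_mult smooth_const smooth_mexp i derivative_eq_intros mexp_has_deriv)
  also have "(\<lambda>t. \<Sum>j<n. (\<Sum>l<n. A i l * mexp n A l j t) * x0 j) = (\<lambda>t. \<Sum>l<n. A i l * (\<Sum>j<n. mexp n A l j t * x0 j))"
    unfolding sum_distrib_left sum_distrib_right by (subst sum.swap) (simp add: mult.assoc)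
  also have "reg \<dots> = (\<Sum>l<n. reg (\<lambda>t. A i l * (\<Sum>j<n. mexp n A l j t * x0 j)))"
    by (intro reg_sum L2_smooth smooth_mult smooth_const smooth_free_state) auto
  finally show ?thesis by (simp add: mv_def cm_def reg_cmult free_state_def)
qed

lemma reg_free_response: "reg (free_response n A C x0 i) = mv n (cm C) (free_state n A x0) i"
proof -
  have "reg (free_response n A C x0 i) = (\<Sum>l<n. reg (\<lambda>t. C i l * (\<Sum>j<n. mexp n A l j t * x0 j)))"
    unfolding free_response_def[abs_def]
    by (intro reg_sum L2_smooth smooth_mult smooth_const smooth_free_state) auto
  then show ?thesis by (simp add: mv_def cm_def reg_cmult free_state_def)
qed

text \<open>\<open>represents\<close> collects what the proof needs to know about a representation: every weak trajectory of
  the state equations lies in the kernel of \<open>(Ru, Ry)\<close>, certified by a polynomial identity, and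
  every smooth output compatible with zero input is a free response.\<close>

definition represents where
  "represents g m p Ru Ry n A B C D \<longleftrightarrow>
    (\<exists>Y. (\<forall>i<g. \<forall>j<n. mm n Y (pencil A) i j = mm p Ry (cm C) i j) \<and>
      (\<forall>i<g. \<forall>j<m. mm n Y (cm B) i j + Ru i j + mm p Ry (cm D) i j = 0)) \<and>
    (\<forall>z. (\<forall>i<p. z i \<in> smooth_clI) \<longrightarrow> (\<forall>i<g. mv p Ry (\<lambda>j. reg (z j)) i = 0) \<longrightarrow>
      (\<exists>x0. \<forall>i<p. \<forall>t\<in>clI. z i t = free_response n A C x0 i t))"

text \<open>Ry C x = Y (s I - A) x = Y B u along solutions, so the state drops out of the kernel
  equation and a polynomial matrix acting on the input alone remains.\<close>

lemma kernel_identity: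
  assumes Y: "\<forall>i<g. \<forall>j<n. mm n Y (pencil A) i j = mm p Ry (cm C) i j"
    and ode: "\<And>i. i < n \<Longrightarrow> ddiff (x i) = mv n (cm A) x i + mv m (cm B) u i"
    and i: "i < g"
  shows "mv m Ru u i + mv p Ry (\<lambda>a. mv n (cm C) x a + mv m (cm D) u a) i
    = mv m (\<lambda>i j. mm n Y (cm B) i j + Ru i j + mm p Ry (cm D) i j) u i"
proof -
  have "mv p Ry (mv n (cm C) x) i = mv n (mm n Y (pencil A)) x i"
    unfolding mv_mm using Y i by (intro mv_cong) auto
  also have "\<dots> = mv n Y (mv n (pencil A) x) i" by (rule mv_mm[symmetric])
  also have "\<dots> = mv n Y (mv m (cm B) u) i"
    by (intro mv_cong refl) (simp add: mv_pencil ode)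
  finally have e1: "mv p Ry (mv n (cm C) x) i = mv m (mm n Y (cm B)) u i" unfolding mv_mm .
  have e2: "mv p Ry (mv m (cm D) u) i = mv m (mm p Ry (cm D)) u i" by (rule mv_mm)
  show ?thesis
    unfolding mv_add_right mv_add_left e1 e2 by (simp only: add_ac)
qed

lemma represents_kernel:
  assumes "represents g m p Ru Ry n A B C D"
    and "\<And>i. i < n \<Longrightarrow> ddiff (x i) = mv n (cm A) x i + mv m (cm B) u i" "i < g"
  shows "mv m Ru u i + mv p Ry (\<lambda>a. mv n (cm C) x a + mv m (cm D) u a) i = 0"
proof -
  obtain Y where Y: "\<forall>i<g. \<forall>j<n. mm n Y (pencil A) i j = mm p Ry (cm C) i j"
    "\<forall>i<g. \<forall>j<m. mm n Y (cm B) i j + Ru i j + mm p Ry (cm D) i j = 0"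
    using assms(1) by (auto simp: represents_def)
  have "mv m (\<lambda>i j. mm n Y (cm B) i j + Ru i j + mm p Ry (cm D) i j) u i = 0"
    using Y(2) assms(3) by (simp add: mv_def)
  then show ?thesis using kernel_identity[OF Y(1) assms(2,3), of Ru D] by simp
qed

text \<open>Multiplying (s I - A) x = 0 by the adjugate gives d x = 0, with \<open>d\<close>
  independent of the initial state.\<close>

lemma free_state_annihilator:
  "\<exists>d. d \<noteq> 0 \<and> (\<forall>x0. \<forall>i<n. act d (free_state n A x0 i) = 0)"
proof -
  obtain d W where d: "d \<noteq> 0" "\<forall>i<n. \<forall>j<n. mm n W (pencil A) i j = d * idm i j \<and> mm n (pencil A) W i j = d * idm i j"
    using pencil_adjugate[of n A] by blast
  have "act d (free_state n A x0 i) = 0" if i: "i < n" for x0 i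
  proof -
    have "0 = mv n W (mv n (pencil A) (free_state n A x0)) i"
      by (rule mv_zero_right[symmetric]) (simp add: mv_pencil ddiff_free_state)
    also have "\<dots> = mv n (\<lambda>i j. d * idm i j) (free_state n A x0) i"
      unfolding mv_mm using d i by (intro mv_cong) auto
    also have "\<dots> = act d (mv n idm (free_state n A x0) i)"
      by (simp only: mv_def act.scale_sum_right act_mult)
    finally show ?thesis using i by (simp add: mv_idm)
  qed
  with d(1) show ?thesis by (intro exI[of _ d] conjI allI impI)
qed

text \<open>A polynomial vector c with Ry c = 0 yields for every real x the smooth zero-input output
  c(x) exp(x t). It is a free response, so a fixed nonzero \<open>d\<close> annihilates it and d(x)
  c(x) = 0 for all x. Hence Ry has full column rank, and the adjugate of its Gram matrix gives the
  left inverse.\<close>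

lemma represents_left_inverse:
  assumes represents: "represents g m p Ru Ry n A B C D"
  shows "\<exists>d F. d \<noteq> 0 \<and> (\<forall>i<p. \<forall>j<p. mm g F Ry i j = d * idm i j)"
proof -
  define M where "M = mm g (\<lambda>i j. Ry j i) Ry"
  have "\<not> (\<exists>c. (\<exists>i<p. c i \<noteq> 0) \<and> (\<forall>i<p. (\<Sum>j<p. M i j * c j) = 0))"
  proof (intro notI, elim exE conjE)
    fix c i assume c: "i < p" "c i \<noteq> 0" "\<forall>i<p. (\<Sum>j<p. M i j * c j) = 0"
    define y where "y l = (\<Sum>j<p. Ry l j * c j)" for l
    have "0 = (\<Sum>i<p. c i * (\<Sum>j<p. M i j * c j))" using c(3) by simp
    also have "\<dots> = (\<Sum>i<p. c i * (\<Sum>l<g. Ry l i * y l))"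
      unfolding M_def sum_mm_right y_def ..
    also have "\<dots> = (\<Sum>l<g. (y l)\<^sup>2)"
      unfolding power2_eq_square sum_distrib_left
      by (subst sum.swap) (simp add: y_def sum_distrib_right mult_ac)
    \<comment> \<open>A vanishing sum of squares of real polynomials has vanishing terms, as
      evaluation at real points shows.\<close>
    finally have sq: "(\<Sum>l<g. (y l)\<^sup>2) = 0" by simp
    have y: "poly (y l) x = 0" if "l < g" for l x
    proof -
      have "(\<Sum>l<g. (poly (y l) x)\<^sup>2) = 0" using arg_cong[OF sq, of "\<lambda>p. poly p x"] by (simp add: poly_sum)
      then have "\<forall>l<g. (poly (y l) x)\<^sup>2 = 0" using sum_nonneg_eq_0_iff[of "{..<g}" "\<lambda>l. (poly (y l) x)\<^sup>2"] by auto
      then show ?thesis using that by simp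
    qed
    obtain d where d: "d \<noteq> 0" "\<forall>x0. \<forall>i<n. act d (free_state n A x0 i) = 0"
      using free_state_annihilator[of n A] by blast
    have "poly (d * c i) x = 0" for x
    proof -
      define z where "z j t = poly (c j) x * exp (x * t)" for j t
      have regz: "reg (z j) = act [:poly (c j) x:] (expd x)" for j
        unfolding z_def[abs_def] by (simp add: reg_cmult expd_def)
      have "mv p Ry (\<lambda>j. reg (z j)) l = 0" if "l < g" for l
      proof
        fix \<phi>
        have "mv p Ry (\<lambda>j. reg (z j)) l \<phi> = (\<Sum>j<p. act (Ry l j * [:poly (c j) x:]) (expd x) \<phi>)"
          by (simp add: mv_def regz sum_fun_apply del: mult_pCons_right)
        also have "\<dots> = poly (y l) x * expd x \<phi>"
          by (simp only: act_eigen[OF ddiff_expd]) (simp add: y_def poly_sum sum_distrib_right sum_distrib_left mult_ac)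
        finally show "mv p Ry (\<lambda>j. reg (z j)) l \<phi> = 0 \<phi>" using y[OF that] by simp
      qed
      moreover have "z j \<in> smooth_clI" for j
        unfolding z_def[abs_def] by (intro smooth_imp_smooth_clI smooth_mult smooth_const smooth_exp)
      ultimately obtain x0 where x0: "\<forall>i<p. \<forall>t\<in>clI. z i t = free_response n A C x0 i t"
        using represents unfolding represents_def by blast
      have "reg (z i) = reg (free_response n A C x0 i)"
        using x0 c(1) by (intro reg_cong) auto
      then have "act d (reg (z i)) = act d (mv n (cm C) (free_state n A x0) i)"
        by (simp add: reg_free_response)
      also have "\<dots> = (\<Sum>l<n. act (cm C i l) (act d (free_state n A x0 l)))"
        by (simp add: mv_def act.scale_sum_right mult.commute)
      also have "\<dots> = 0" using d(2) by simp
      finally have "act (d * [:poly (c i) x:]) (expd x) = 0" by (simp only: regz act_mult)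
      then have "poly (d * [:poly (c i) x:]) x * expd x \<phi> = 0" for \<phi>
        using act_eigen[OF ddiff_expd, of "d * [:poly (c i) x:]" x \<phi>] by simp
      then show ?thesis using expd_nonzero[of x] by auto
    qed
    then have "d * c i = 0" by (rule poly_eq_0_by_values)
    with d(1) c(2) show False by simp
  qed
  then obtain d W where d: "d \<noteq> 0" "\<forall>i<p. \<forall>j<p. mm p W M i j = d * idm i j \<and> mm p M W i j = d * idm i j"
    using adjugate_or_kernel[of p M] by blast
  show ?thesis
    by (intro exI[of _ d] exI[of _ "mm p W (\<lambda>i j. Ry j i)"]) (use d in \<open>simp add: M_def mm_assoc\<close>)
qed

lemma mv_cm: "mv n (cm A) x i \<phi> = (\<Sum>l<n. A i l * x l \<phi>)"
  by (simp add: mv_def cm_def act_const sum_fun_apply)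

lemma cm_mm: "cm (mm n A B) i j = mm n (cm A) (cm B) i j"
  by (simp add: cm_def mm_def const_sum mult.commute)

text \<open>Divide Ry C by s I - A. Free responses force the remainder to vanish, and exponential
  solutions of every rate force the remaining input matrix \<open>K\<close> to vanish. The quotient
  is the required certificate.\<close>

lemma representsI:
  assumes free: "\<And>x0 i. i < g \<Longrightarrow> mv p Ry (\<lambda>a. reg (free_response n A C x0 a)) i = 0"
    and expo: "\<And>c x0 u0 i. (\<And>i. i < n \<Longrightarrow> c * x0 i = (\<Sum>l<n. A i l * x0 l) + (\<Sum>b<m. B i b * u0 b)) \<Longrightarrow> i < g \<Longrightarrow>
      mv m Ru (\<lambda>b. act [:u0 b:] (expd c)) i
      + mv p Ry (\<lambda>a. act [:(\<Sum>l<n. C a l * x0 l) + (\<Sum>b<m. D a b * u0 b):] (expd c)) i = 0"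
    and smooth: "\<And>z. (\<And>i. i < p \<Longrightarrow> z i \<in> smooth_clI) \<Longrightarrow> (\<And>i. i < g \<Longrightarrow> mv p Ry (\<lambda>j. reg (z j)) i = 0) \<Longrightarrow>
      \<exists>x0. \<forall>i<p. \<forall>t\<in>clI. z i t = free_response n A C x0 i t"
  shows "represents g m p Ru Ry n A B C D"
proof -
  have "\<exists>Y c. \<forall>j<n. mm p Ry (cm C) i j = (\<Sum>l<n. Y l * pencil A l j) + [:c j:]" for i
    by (rule pencil_division)
  then obtain Y where "\<forall>i. \<exists>c. \<forall>j<n. mm p Ry (cm C) i j = (\<Sum>l<n. Y i l * pencil A l j) + [:c j:]"
    using choice[of "\<lambda>i Y. \<exists>c. \<forall>j<n. mm p Ry (cm C) i j = (\<Sum>l<n. Y l * pencil A l j) + [:c j:]"] by auto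
  then obtain c where Y: "\<forall>i. \<forall>j<n. mm p Ry (cm C) i j = (\<Sum>l<n. Y i l * pencil A l j) + [:c i j:]"
    using choice[of "\<lambda>i c. \<forall>j<n. mm p Ry (cm C) i j = (\<Sum>l<n. Y i l * pencil A l j) + [:c j:]"] by auto
  \<comment> \<open>Apply both sides to the free state that starts at unit vector \<open>j\<close>.
    The pencil annihilates it, and the remainder leaves a free response with output matrix
    \<open>c\<close>, whose value at time 0 is \<open>c i j\<close>.\<close>
  have c0: "c i j = 0" if i: "i < g" and j: "j < n" for i j
  proof -
    let ?x = "free_state n A (idm j)"
    have "0 = mv p Ry (mv n (cm C) ?x) i"
      using free[OF i, of "idm j"] by (simp only: reg_free_response)
    also have "\<dots> = mv n (\<lambda>i j. mm n Y (pencil A) i j + cm c i j) ?x i"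
      unfolding mv_mm using Y by (intro mv_cong) (auto simp: mm_def cm_def)
    also have "\<dots> = mv n Y (mv n (pencil A) ?x) i + mv n (cm c) ?x i"
      by (simp only: mv_add_left mv_mm)
    also have "mv n Y (mv n (pencil A) ?x) i = 0"
      by (rule mv_zero_right) (simp add: mv_pencil ddiff_free_state)
    also have "0 + mv n (cm c) ?x i = reg (free_response n A c (idm j) i)"
      by (simp add: reg_free_response)
    finally have "reg (free_response n A c (idm j) i) = 0" by (rule sym)
    then have "AE t in lebesgue_on I. free_response n A c (idm j) i t = 0"
      by (intro reg_eq_0_imp_AE L2_smooth smooth_free_response)
    then have "AE t in lebesgue. t \<in> I \<longrightarrow> free_response n A c (idm j) i t = 0"
      unfolding AE_restrict_space_iff[of I lebesgue, simplified] by (auto elim: eventually_mono)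
    then have "free_response n A c (idm j) i 0 = 0"
      by (rule AE_zero_continuous[rotated 2]) (auto intro: smooth_continuous smooth_free_response)
    moreover have "(\<Sum>l<n. c i l * (\<Sum>q<n. idm l q * idm j q)) = c i j"
    proof -
      have "(\<Sum>q<n. idm l q * idm j q) = (idm l j :: real)" if "l < n" for l
        using that by (simp add: sum_mult_idm) (simp add: idm_def)
      then have "(\<Sum>l<n. c i l * (\<Sum>q<n. idm l q * idm j q)) = (\<Sum>l<n. c i l * idm l j)" by simp
      then show ?thesis using j by (simp add: sum_idm_mult)
    qed
    ultimately show ?thesis by (simp add: free_response_def mexp_0)
  qed
  have Y1: "\<forall>i<g. \<forall>j<n. mm n Y (pencil A) i j = mm p Ry (cm C) i j"
    using Y c0 by (simp add: mm_def)
  define K where "K = (\<lambda>i j. mm n Y (cm B) i j + Ru i j + mm p Ry (cm D) i j)"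
  have "K i b = 0" if i: "i < g" and b: "b < m" for i b
  proof -
    obtain d W where d: "d \<noteq> 0" "\<forall>i<n. \<forall>j<n. mm n W (pencil A) i j = d * idm i j \<and> mm n (pencil A) W i j = d * idm i j"
      using pencil_adjugate[of n A] by blast
    have "poly (d * K i b) s = 0" for s
    proof -
      \<comment> \<open>Input amplitude d(s) in component \<open>b\<close> and state amplitude W(s)
        B solve the equation without a division by d(s), so the argument covers every real
        \<open>s\<close>, including the zeros of \<open>d\<close>.\<close>
      define u0 where "u0 a = (if a = b then poly d s else 0)" for a
      define x0 where "x0 l = (\<Sum>r<n. poly (W l r) s * B r b)" for l
      have ode0: "s * x0 i = (\<Sum>l<n. A i l * x0 l) + (\<Sum>a<m. B i a * u0 a)" if i: "i < n" for i
      proof -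
        have "(\<Sum>l<n. poly (pencil A i l) s * x0 l) = (\<Sum>r<n. poly (mm n (pencil A) W i r) s * B r b)"
          unfolding x0_def mm_def poly_sum sum_distrib_left sum_distrib_right poly_mult
          by (subst sum.swap) (simp add: mult.assoc)
        also have "\<dots> = (\<Sum>r<n. poly d s * (idm i r * B r b))"
          using d(2) i by (intro sum.cong) (auto simp: idm_def)
        also have "\<dots> = poly d s * B i b" using i by (simp only: sum_distrib_left[symmetric] sum_mult_idm)
        also have "\<dots> = (\<Sum>a<m. B i a * u0 a)" using b by (simp add: u0_def if_distrib[of "\<lambda>x. _ * x"] cong: if_cong)
        finally have "(\<Sum>l<n. poly (pencil A i l) s * x0 l) = (\<Sum>a<m. B i a * u0 a)" .
        moreover have "(\<Sum>l<n. poly (pencil A i l) s * x0 l) = s * (\<Sum>l<n. idm i l * x0 l) - (\<Sum>l<n. A i l * x0 l)"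
        proof -
          have "poly (pencil A i l) s * x0 l = s * (idm i l * x0 l) - A i l * x0 l" for l
            by (simp add: pencil_def cm_def idm_def algebra_simps)
          then show ?thesis by (simp add: sum_subtractf sum_distrib_left)
        qed
        ultimately show ?thesis using i by (simp add: sum_mult_idm)
      qed
      define u where "u b = act [:u0 b:] (expd s)" for b
      define x where "x l = act [:x0 l:] (expd s)" for l
      have ode: "ddiff (x i) = mv n (cm A) x i + mv m (cm B) u i" if "i < n" for i
      proof
        fix \<phi>
        have "ddiff (x i) \<phi> = s * x0 i * expd s \<phi>"
        proof -
          have "ddiff (x i) \<phi> = x0 i * ddiff (expd s) \<phi>" by (simp add: x_def act_const ddiff_def)
          then show ?thesis by (simp add: ddiff_expd)
        qed
        then show "ddiff (x i) \<phi> = (mv n (cm A) x i + mv m (cm B) u i) \<phi>"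
          unfolding ode0[OF that]
          by (simp add: mv_cm x_def u_def act_const distrib_right sum_distrib_right mult.assoc)
      qed
      have y: "mv n (cm C) x a + mv m (cm D) u a = act [:(\<Sum>l<n. C a l * x0 l) + (\<Sum>b<m. D a b * u0 b):] (expd s)" for a
        by (rule ext) (simp add: mv_cm x_def u_def act_const distrib_right sum_distrib_right mult.assoc)
      have "mv m K u i = 0"
        using kernel_identity[OF Y1 ode i, of Ru D] expo[OF ode0 i] unfolding y u_def[symmetric] K_def by simp
      moreover have "mv m K u i \<phi> = poly (K i b) s * poly d s * expd s \<phi>" for \<phi>
      proof -
        have "mv m K u i \<phi> = (\<Sum>a<m. poly (K i a * [:u0 a:]) s * expd s \<phi>)"
          unfolding mv_def u_def sum_fun_apply act_mult[symmetric] act_eigen[OF ddiff_expd] ..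
        also have "\<dots> = (\<Sum>a<m. if a = b then poly (K i b) s * poly d s * expd s \<phi> else 0)"
          by (intro sum.cong refl) (auto simp: u0_def)
        finally show ?thesis using b by simp
      qed
      ultimately show ?thesis using expd_nonzero[of s] by auto
    qed
    then have "d * K i b = 0" by (rule poly_eq_0_by_values)
    with d(1) show ?thesis by simp
  qed
  then have "\<forall>i<g. \<forall>j<m. mm n Y (cm B) i j + Ru i j + mm p Ry (cm D) i j = 0" by (simp add: K_def)
  with Y1 smooth show ?thesis unfolding represents_def by blast
qed

text \<open>The projection of a free state solves the quotient equation, and
  \<open>mexp_unique\<close> identifies it by its value at time 0.\<close>

lemma free_response_quotient:
  assumes PA: "\<And>i j. i < k \<Longrightarrow> j < n \<Longrightarrow> mm n Pr A i j = mm k A' Pr i j"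
    and PC: "\<And>j. j < n \<Longrightarrow> C i j = mm k C' Pr i j"
    and t: "t \<in> clI"
  shows "free_response n A C x0 i t = free_response k A' C' (\<lambda>q. \<Sum>l<n. Pr q l * x0 l) i t"
proof -
  define xs where "xs l t = (\<Sum>j<n. mexp n A l j t * x0 j)" for l t
  define x where "x q t = (\<Sum>l<n. Pr q l * xs l t)" for q t
  have "(x q has_real_derivative (\<Sum>r<k. A' q r * x r t)) (at t within clI)" if q: "q < k" for q t
  proof -
    have "(xs l has_real_derivative (\<Sum>r<n. A l r * xs r t)) (at t within clI)" if "l < n" for l
    proof -
      have "(xs l has_real_derivative (\<Sum>j<n. (\<Sum>r<n. A l r * mexp n A r j t) * x0 j)) (at t within clI)"
        unfolding xs_def[abs_def] using that
        by (intro DERIV_sum DERIV_cmult_right has_field_derivative_at_within[OF mexp_has_deriv])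
      also have "(\<Sum>j<n. (\<Sum>r<n. A l r * mexp n A r j t) * x0 j) = (\<Sum>r<n. A l r * xs r t)"
        unfolding xs_def sum_distrib_left sum_distrib_right by (subst sum.swap) (simp add: mult.assoc)
      finally show ?thesis .
    qed
    then have "(x q has_real_derivative (\<Sum>l<n. Pr q l * (\<Sum>r<n. A l r * xs r t))) (at t within clI)"
      unfolding x_def[abs_def] by (intro DERIV_sum DERIV_cmult) auto
    also have "(\<Sum>l<n. Pr q l * (\<Sum>r<n. A l r * xs r t)) = (\<Sum>r<n. mm n Pr A q r * xs r t)"
      by (rule sum_mm_right[symmetric])
    also have "\<dots> = (\<Sum>r<n. mm k A' Pr q r * xs r t)" using PA[OF q] by simp
    also have "\<dots> = (\<Sum>r<k. A' q r * x r t)" unfolding x_def by (rule sum_mm_right)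
    finally show ?thesis .
  qed
  then have x: "x q t = (\<Sum>j<k. mexp k A' q j t * x j 0)" if "q < k" for q
    using mexp_unique[of k x A' q t] that t by blast
  have x00: "x j 0 = (\<Sum>l<n. Pr j l * x0 l)" for j
    by (simp add: x_def xs_def mexp_0 sum_mult_idm)
  have "free_response n A C x0 i t = (\<Sum>l<n. mm k C' Pr i l * xs l t)"
    using PC by (simp add: free_response_def xs_def)
  also have "\<dots> = (\<Sum>q<k. C' i q * x q t)" unfolding x_def by (rule sum_mm_right)
  also have "\<dots> = free_response k A' C' (\<lambda>q. \<Sum>l<n. Pr q l * x0 l) i t"
    by (simp add: free_response_def x x00)
  finally show ?thesis .
qed

text \<open>The quotient gets its own certificate by dividing Ry C' by s I - A'. Multiplied by
  \<open>Pr\<close>, this becomes a division of Ry C by s I - A, and uniqueness of division compares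
  it with the old certificate.\<close>

lemma represents_observable:
  assumes represents: "represents g m p Ru Ry n A B C D"
  shows "\<exists>k A' B' C'. k \<le> n \<and> represents g m p Ru Ry k A' B' C' D \<and> observable k p A' C'"
proof -
  obtain k Pr S A' C' where *: "k \<le> n" "\<forall>i<k. \<forall>j<n. mm n Pr A i j = mm k A' Pr i j"
    "\<forall>i<p. \<forall>j<n. C i j = mm k C' Pr i j" "\<forall>i<k. \<forall>j<k. mm n Pr S i j = idm i j"
    "observable k p A' C'"
    using observable_quotient[of n A p C] by blast
  note k = *(1) and PA = *(2)[rule_format] and PC = *(3)[rule_format] and PS = *(4)[rule_format] and obs = *(5)
  define B' where "B' = mm n Pr B"
  obtain Y where Y: "\<forall>i<g. \<forall>j<n. mm n Y (pencil A) i j = mm p Ry (cm C) i j"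
    "\<forall>i<g. \<forall>j<m. mm n Y (cm B) i j + Ru i j + mm p Ry (cm D) i j = 0"
    using represents by (auto simp: represents_def)
  have "\<exists>Y c. \<forall>j<k. mm p Ry (cm C') i j = (\<Sum>l<k. Y l * pencil A' l j) + [:c j:]" for i
    by (rule pencil_division)
  then obtain Y' where "\<forall>i. \<exists>c. \<forall>j<k. mm p Ry (cm C') i j = (\<Sum>l<k. Y' i l * pencil A' l j) + [:c j:]"
    using choice[of "\<lambda>i Y. \<exists>c. \<forall>j<k. mm p Ry (cm C') i j = (\<Sum>l<k. Y l * pencil A' l j) + [:c j:]"] by auto
  then obtain c where Y': "\<forall>i. \<forall>j<k. mm p Ry (cm C') i j = (\<Sum>l<k. Y' i l * pencil A' l j) + [:c i j:]"
    using choice[of "\<lambda>i c. \<forall>j<k. mm p Ry (cm C') i j = (\<Sum>l<k. Y' i l * pencil A' l j) + [:c j:]"] by auto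
  have res: "mm k (pencil A') (cm Pr) q j = mm n (cm Pr) (pencil A) q j" if "q < k" "j < n" for q j
  proof -
    have "mm k (pencil A') (cm Pr) q j = [:0, 1:] * (\<Sum>l<k. idm q l * cm Pr l j) - mm k (cm A') (cm Pr) q j"
      by (simp only: mm_def pencil_def left_diff_distrib sum_subtractf sum_distrib_left mult.assoc)
    moreover have "mm n (cm Pr) (pencil A) q j = [:0, 1:] * (\<Sum>l<n. cm Pr q l * idm l j) - mm n (cm Pr) (cm A) q j"
      by (simp only: mm_def pencil_def right_diff_distrib sum_subtractf sum_distrib_left mult.left_commute)
    moreover have "mm k (cm A') (cm Pr) q j = mm n (cm Pr) (cm A) q j"
      using PA[OF that] by (simp add: cm_mm[symmetric]) (simp add: cm_def)
    ultimately show ?thesis using that by (simp only: sum_mult_idm sum_idm_mult)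
  qed
  have diff: "(\<Sum>l<n. (Y i l - mm k Y' (cm Pr) i l) * pencil A l j) = [:\<Sum>l<k. c i l * Pr l j:]"
    if i: "i < g" and j: "j < n" for i j
  proof -
    have "mm n Y (pencil A) i j = mm p Ry (cm C) i j" using Y(1) i j by simp
    also have "\<dots> = mm p Ry (mm k (cm C') (cm Pr)) i j"
    proof (rule mm_cong)
      fix l assume "l < p"
      then show "cm C l j = mm k (cm C') (cm Pr) l j"
        unfolding cm_mm[symmetric] using PC[of l j] j by (simp add: cm_def)
    qed simp
    also have "\<dots> = mm k (\<lambda>i j. mm k Y' (pencil A') i j + cm c i j) (cm Pr) i j"
      unfolding mm_assoc using Y' by (intro mm_cong) (auto simp: mm_def cm_def)
    also have "\<dots> = mm k (mm k Y' (pencil A')) (cm Pr) i j + mm k (cm c) (cm Pr) i j"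
      by (simp add: mm_def[of k "\<lambda>i j. _ i j + _ i j"] mm_def[of k "cm c"] mm_def[of k "mm k Y' (pencil A')"] distrib_right sum.distrib)
    also have "mm k (mm k Y' (pencil A')) (cm Pr) i j = mm k Y' (mm n (cm Pr) (pencil A)) i j"
      unfolding mm_assoc[symmetric] using res j by (intro mm_cong) auto
    also have "\<dots> = mm n (mm k Y' (cm Pr)) (pencil A) i j" by (simp only: mm_assoc)
    finally have "mm n Y (pencil A) i j - mm n (mm k Y' (cm Pr)) (pencil A) i j = cm (mm k c Pr) i j"
      by (simp add: cm_mm)
    then show ?thesis
      by (simp add: mm_def[of n Y] mm_def[of n "mm k Y' (cm Pr)"] left_diff_distrib sum_subtractf)
        (simp add: cm_def mm_def)
  qed
  \<comment> \<open>Cancellation gives both facts at once: the old quotient is the new one times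
    \<open>Pr\<close>, and the new remainder times \<open>Pr\<close> is zero.\<close>
  have YY': "Y i l = mm k Y' (cm Pr) i l" if "i < g" "l < n" for i l
    using pencil_left_cancel(1)[OF diff[OF that(1)], of l] that by simp
  have cP: "(\<Sum>l<k. c i l * Pr l j) = 0" if "i < g" "j < n" for i j
    using pencil_left_cancel(2)[OF diff[OF that(1)], of j] that by simp
  \<comment> \<open>The right inverse \<open>S\<close> of \<open>Pr\<close> cancels the factor in c
    Pr = 0.\<close>
  have c0: "c i j = 0" if i: "i < g" and j: "j < k" for i j
  proof -
    have "c i j = mm k c (mm n Pr S) i j"
      using mm_idm_right[OF j, of c i] mm_cong[of k c i c "mm n Pr S" j idm] PS j by simp
    also have "\<dots> = mm n (mm k c Pr) S i j" by (simp only: mm_assoc)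
    also have "\<dots> = 0" unfolding mm_def[of n] using cP[OF i] by (intro sum.neutral) (simp add: mm_def)
    finally show ?thesis .
  qed
  have "represents g m p Ru Ry k A' B' C' D"
    unfolding represents_def
  proof (intro conjI exI[of _ Y'] allI impI)
    fix i j assume "i < g" "j < k"
    then show "mm k Y' (pencil A') i j = mm p Ry (cm C') i j" using Y' c0 by (simp add: mm_def)
  next
    fix i j assume ij: "i < g" "j < m"
    have "mm k Y' (cm B') i j = mm n (mm k Y' (cm Pr)) (cm B) i j"
      unfolding B'_def mm_assoc[symmetric] by (intro mm_cong refl) (simp add: cm_mm)
    also have "\<dots> = mm n Y (cm B) i j" using YY' ij by (intro mm_cong) auto
    finally show "mm k Y' (cm B') i j + Ru i j + mm p Ry (cm D) i j = 0" using Y(2) ij by simp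
  next
    fix z assume "\<forall>i<p. z i \<in> smooth_clI" "\<forall>i<g. mv p Ry (\<lambda>j. reg (z j)) i = 0"
    then obtain x0 where "\<forall>i<p. \<forall>t\<in>clI. z i t = free_response n A C x0 i t"
      using represents unfolding represents_def by blast
    then have "\<forall>i<p. \<forall>t\<in>clI. z i t = free_response k A' C' (\<lambda>q. \<Sum>l<n. Pr q l * x0 l) i t"
    proof (intro allI impI ballI)
      fix i t assume i: "i < p" and t: "t \<in> clI"
      then have "z i t = free_response n A C x0 i t" using \<open>\<forall>i<p. \<forall>t\<in>clI. z i t = _\<close> by blast
      also have "\<dots> = free_response k A' C' (\<lambda>q. \<Sum>l<n. Pr q l * x0 l) i t"
        by (rule free_response_quotient[of k n Pr A A' C i C' t x0]) (use PA PC i t in auto)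
      finally show "z i t = free_response k A' C' (\<lambda>q. \<Sum>l<n. Pr q l * x0 l) i t" .
    qed
    then show "\<exists>x0. \<forall>i<p. \<forall>t\<in>clI. z i t = free_response k A' C' x0 i t" by blast
  qed
  with k obs show ?thesis by blast
qed

lemma sum_vec_mat_vec:
  fixes a x :: "nat \<Rightarrow> 'a :: comm_ring_1"
  shows "(\<Sum>j<n. a j * (\<Sum>l<k. M j l * x l)) = (\<Sum>l<k. (\<Sum>j<n. a j * M j l) * x l)"
  unfolding sum_distrib_left sum_distrib_right by (subst sum.swap) (simp add: mult.assoc)

text \<open>Differentiating the zero output on the interval shows that C A^k annihilates the state
  for every k, so the state at the midpoint is zero; the inverse exponential carries this back to
  time 0.\<close>

lemma observable_free_response:
  assumes obs: "observable n p A C" and ab: "a < b"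
    and zero: "\<And>i t. i < p \<Longrightarrow> t \<in> {a<..<b} \<Longrightarrow> free_response n A C z i t = 0"
    and l: "l < n"
  shows "z l = 0"
proof -
  define w where "w l t = (\<Sum>j<n. mexp n A l j t * z j)" for l t
  have deriv: "(w l has_real_derivative (\<Sum>r<n. A l r * w r t)) (at t)" if "l < n" for l t
  proof -
    have "(w l has_real_derivative (\<Sum>j<n. (\<Sum>r<n. A l r * mexp n A r j t) * z j)) (at t)"
      unfolding w_def[abs_def] using that by (intro DERIV_sum DERIV_cmult_right mexp_has_deriv)
    also have "(\<Sum>j<n. (\<Sum>r<n. A l r * mexp n A r j t) * z j) = (\<Sum>r<n. A l r * w r t)"
      unfolding w_def sum_distrib_left sum_distrib_right by (subst sum.swap) (simp add: mult.assoc)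
    finally show ?thesis .
  qed
  have step: "(\<Sum>j<n. mm n C (mpow n A k) i j * w j t) = 0" if "i < p" "t \<in> {a<..<b}" for k i t
    using that
  proof (induction k arbitrary: t)
    case 0
    have "(\<Sum>j<n. mm n C (mpow n A 0) i j * w j t) = free_response n A C z i t"
      by (simp add: mm_idm_right free_response_def w_def)
    then show ?case using zero 0 by simp
  next
    case (Suc k)
    let ?f = "\<lambda>t. \<Sum>j<n. mm n C (mpow n A k) i j * w j t"
    have "(?f has_real_derivative (\<Sum>j<n. mm n C (mpow n A k) i j * (\<Sum>r<n. A j r * w r t))) (at t)"
      by (intro DERIV_sum DERIV_cmult deriv) auto
    moreover have "(?f has_real_derivative 0) (at t)"
      by (rule has_field_derivative_transform_within_open[where S = "{a<..<b}" and f = "\<lambda>_. 0"])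
        (use Suc in auto)
    ultimately have "0 = (\<Sum>j<n. mm n C (mpow n A k) i j * (\<Sum>r<n. A j r * w r t))"
      by (rule DERIV_unique[symmetric])
    also have "\<dots> = (\<Sum>r<n. mm n (mm n C (mpow n A k)) A i r * w r t)" by (rule sum_mm_right[symmetric])
    also have "\<dots> = (\<Sum>r<n. mm n C (mpow n A (Suc k)) i r * w r t)"
    proof (intro sum.cong refl arg_cong2[where f = "(*)"])
      fix r assume "r \<in> {..<n}"
      then show "mm n (mm n C (mpow n A k)) A i r = mm n C (mpow n A (Suc k)) i r"
        unfolding mm_assoc[symmetric] by (intro mm_cong mpow_Suc2[symmetric]) auto
    qed
    finally show ?case by simp
  qed
  define t where "t = (a + b) / 2"
  have t: "t \<in> {a<..<b}" using ab by (simp add: t_def)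
  have w0: "w j t = 0" if "j < n" for j
    using obs[unfolded observable_def, THEN spec[of _ "\<lambda>j. w j t"]] step t that by blast
  have "0 = (\<Sum>j<n. mexp n A l j (- t) * w j t)" using w0 by simp
  also have "\<dots> = (\<Sum>r<n. (\<Sum>j<n. mexp n A l j (- t) * mexp n A j r t) * z r)"
    unfolding w_def sum_distrib_left sum_distrib_right by (subst sum.swap) (simp add: mult.assoc)
  also have "\<dots> = (\<Sum>r<n. idm l r * z r)" using l by (intro sum.cong refl) (simp add: mexp_inverse')
  finally show ?thesis using l by (simp add: sum_mult_idm)
qed

section \<open>Responses to square-integrable inputs\<close>

definition response where
  "response n m A B C D x0 u i t =
     (\<Sum>l<n. C i l * trajectory n A x0 (\<lambda>l s. \<Sum>b<m. B l b * u b s) l t) + (\<Sum>b<m. D i b * u b t)"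

lemma mv_reg:
  assumes "\<And>l. l < n \<Longrightarrow> x l \<in> L2"
  shows "mv n (cm A) (\<lambda>l. reg (x l)) i = reg (\<lambda>t. \<Sum>l<n. A i l * x l t)"
proof -
  have "reg (\<lambda>t. \<Sum>l<n. A i l * x l t) = (\<Sum>l<n. reg (\<lambda>t. A i l * x l t))"
    by (intro reg_sum L2_cmult assms) auto
  then show ?thesis by (simp add: mv_def cm_def reg_cmult)
qed

lemma response_props:
  fixes n m :: nat and A B C D :: "nat \<Rightarrow> nat \<Rightarrow> real"
  assumes u: "\<And>b. b < m \<Longrightarrow> u b \<in> L2"
  defines "x \<equiv> \<lambda>x0. trajectory n A x0 (\<lambda>l s. \<Sum>b<m. B l b * u b s)"
  shows "l < n \<Longrightarrow> x x0 l \<in> L2"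
    "l < n \<Longrightarrow> ddiff (reg (x x0 l)) = mv n (cm A) (\<lambda>l. reg (x x0 l)) l + mv m (cm B) (\<lambda>b. reg (u b)) l"
    "response n m A B C D x0 u i \<in> L2"
    "reg (response n m A B C D x0 u i) = mv n (cm C) (\<lambda>l. reg (x x0 l)) i + mv m (cm D) (\<lambda>b. reg (u b)) i"
proof -
  have b: "(\<lambda>s. \<Sum>b<m. B l b * u b s) \<in> L2" for l by (intro L2_sum L2_cmult u) auto
  show x: "x x0 l \<in> L2" if "l < n" for l
    unfolding x_def by (rule trajectory_props(1)[OF b that])
  have "ddiff (reg (x x0 l)) = (\<Sum>r<n. act [:A l r:] (reg (x x0 r))) + reg (\<lambda>s. \<Sum>b<m. B l b * u b s)" if "l < n"
    unfolding x_def by (rule trajectory_props(2)[OF b that])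
  then show "ddiff (reg (x x0 l)) = mv n (cm A) (\<lambda>l. reg (x x0 l)) l + mv m (cm B) (\<lambda>b. reg (u b)) l" if "l < n"
    using that mv_reg[of m u B l] u by (simp only: mv_def[of n] cm_def)
  have 1: "(\<lambda>t. \<Sum>l<n. C i l * x x0 l t) \<in> L2" by (intro L2_sum L2_cmult x) auto
  have 2: "(\<lambda>t. \<Sum>b<m. D i b * u b t) \<in> L2" by (intro L2_sum L2_cmult u) auto
  show "response n m A B C D x0 u i \<in> L2"
    unfolding response_def[abs_def] by (rule L2_add[OF 1 2, unfolded x_def])
  show "reg (response n m A B C D x0 u i) = mv n (cm C) (\<lambda>l. reg (x x0 l)) i + mv m (cm D) (\<lambda>b. reg (u b)) i"
    unfolding response_def[abs_def] reg_add[OF 1 2, unfolded x_def]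
    using mv_reg[of n "x x0" C i] mv_reg[of m u D i] x u unfolding x_def by simp
qed

lemma response_initial: "response n m A B C D x0 u i t = response n m A B C D (\<lambda>_. 0) u i t + free_response n A C x0 i t"
  by (simp add: response_def trajectory_def free_response_def distrib_left sum.distrib)

text \<open>Subtracting a particular solution leaves a weak solution with zero input, which is smooth.\<close>

lemma kernel_imp_response:
  assumes represents: "represents g m p Ru Ry n A B C D"
    and u: "\<And>b. b < m \<Longrightarrow> u b \<in> L2" and y: "\<And>i. i < p \<Longrightarrow> y i \<in> L2"
    and ker: "\<And>i. i < g \<Longrightarrow> mv m Ru (\<lambda>b. reg (u b)) i + mv p Ry (\<lambda>a. reg (y a)) i = 0"
  shows "\<exists>x0. \<forall>i<p. AE t in lebesgue_on I. y i t = response n m A B C D x0 u i t"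
proof -
  let ?r = "response n m A B C D (\<lambda>_. 0) u"
  define z where "z i t = y i t + (-1) * ?r i t" for i t
  have r: "?r i \<in> L2" for i by (rule response_props(3)[OF u])
  have zL2: "z i \<in> L2" if "i < p" for i
    unfolding z_def[abs_def] by (intro L2_add L2_cmult r y that)
  have regz: "reg (z i) = reg (y i) - reg (?r i)" if "i < p" for i
  proof -
    have "reg (z i) = reg (y i) + reg (\<lambda>t. (-1) * ?r i t)"
      unfolding z_def[abs_def] by (intro reg_add L2_cmult r y that)
    then show ?thesis by (simp only: reg_cmult) (auto simp: act_const)
  qed
  have kz: "mv p Ry (\<lambda>j. reg (z j)) i = 0" if i: "i < g" for i
  proof -
    have "mv m Ru (\<lambda>b. reg (u b)) i + mv p Ry (\<lambda>a. reg (?r a)) i = 0"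
      proof -
      have r4: "reg (?r a) = mv n (cm C) (\<lambda>l. reg (trajectory n A (\<lambda>_. 0) (\<lambda>l s. \<Sum>b<m. B l b * u b s) l)) a
          + mv m (cm D) (\<lambda>b. reg (u b)) a" for a
        by (rule response_props(4)) (rule u)
      show ?thesis
        unfolding r4 by (rule represents_kernel[OF represents _ i], rule response_props(2), rule u)
    qed
    moreover have "mv p Ry (\<lambda>j. reg (z j)) i = mv p Ry (\<lambda>j. reg (y j) - reg (?r j)) i"
      by (intro mv_cong refl regz)
    ultimately show ?thesis using ker[OF i] by (simp only: mv_diff_right) (simp add: eq_neg_iff_add_eq_0[symmetric] add_eq_0_iff)
  qed
  \<comment> \<open>The left inverse decouples the kernel equation: each component of
    \<open>z\<close> satisfies the scalar equation given by \<open>d\<close>.\<close>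
  obtain d F where d: "d \<noteq> 0" "\<forall>i<p. \<forall>j<p. mm g F Ry i j = d * idm i j"
    using represents_left_inverse[OF represents] by blast
  have "\<exists>h. smooth h \<and> (AE t in lebesgue_on I. z i t = h t)" if i: "i < p" for i
  proof -
    have "0 = mv g F (mv p Ry (\<lambda>j. reg (z j))) i" by (rule mv_zero_right[symmetric]) (rule kz)
    also have "\<dots> = mv p (\<lambda>i j. d * idm i j) (\<lambda>j. reg (z j)) i"
      unfolding mv_mm using d i by (intro mv_cong) auto
    also have "\<dots> = act d (mv p idm (\<lambda>j. reg (z j)) i)"
      by (simp only: mv_def act.scale_sum_right act_mult)
    also have "\<dots> = act d (reg (z i))" by (simp only: mv_idm[OF i])
    finally have "act d (reg (z i)) = 0" by (rule sym)
    from scalar_ode_smooth[OF zL2[OF i] d(1) this] show ?thesis by blast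
  qed
  then have "\<forall>i. \<exists>h. i < p \<longrightarrow> smooth h \<and> (AE t in lebesgue_on I. z i t = h t)" by blast
  then obtain h where h: "\<forall>i. i < p \<longrightarrow> smooth (h i) \<and> (AE t in lebesgue_on I. z i t = h i t)"
    using choice[of "\<lambda>i h. i < p \<longrightarrow> smooth h \<and> (AE t in lebesgue_on I. z i t = h t)"] by blast
  have regh: "reg (h i) = reg (z i)" if "i < p" for i
  proof (rule reg_cong_AE[symmetric])
    show "z i \<in> L2" by (rule zL2[OF that])
    show "h i \<in> L2" "AE t in lebesgue_on I. z i t = h i t" using h that L2_smooth by auto
  qed
  have "mv p Ry (\<lambda>j. reg (h j)) i = 0" if i: "i < g" for i
    using kz[OF i] mv_cong[of p Ry i Ry "\<lambda>j. reg (h j)" "\<lambda>j. reg (z j)"] regh by simp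
  moreover have "\<forall>i<p. h i \<in> smooth_clI" using h smooth_imp_smooth_clI by blast
  ultimately obtain x0 where x0: "\<forall>i<p. \<forall>t\<in>clI. h i t = free_response n A C x0 i t"
    using represents unfolding represents_def by blast
  have "AE t in lebesgue_on I. y i t = response n m A B C D x0 u i t" if i: "i < p" for i
  proof -
    have "AE t in lebesgue_on I. z i t = h i t" using h i by blast
    moreover have "AE t in lebesgue_on I. t \<in> I" by (rule AE_I2) simp
    ultimately show ?thesis
    proof eventually_elim
      case (elim t)
      then have "h i t = free_response n A C x0 i t" using x0 i by auto
      then show ?case using elim(1) by (subst response_initial) (simp add: z_def)
    qed
  qed
  then show ?thesis by blast
qed

section \<open>From controllability of the behavior to reachability of the pair\<close>

lemma AE_Ioo: "{a<..<b} \<subseteq> I \<Longrightarrow> (AE t in lebesgue_on I. P t) \<Longrightarrow> AE t in lebesgue. t \<in> {a<..<b} \<longrightarrow> P t"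
  by (auto simp: AE_restrict_space_iff[of I lebesgue, simplified] elim!: eventually_mono)

text \<open>Let c annihilate all A^k B, and steer from rest to the free response with state c at
  time \<open>t1\<close>. Observability turns the outputs before 0 and after \<open>t1\<close> into
  states, so c is the integral of exp((t1 - s) A) B u(s). Its inner product with c vanishes, hence c
  = 0.\<close>

lemma represents_reachable:
  assumes represents: "represents g m p Ru Ry n A B C D" and obs: "observable n p A C"
    and ctrl: "\<And>x0. \<exists>t1 u y. 0 < t1 \<and> t1 < 1 \<and> (\<forall>b<m. u b \<in> L2) \<and> (\<forall>i<p. y i \<in> L2) \<and>
      (\<forall>i<g. mv m Ru (\<lambda>b. reg (u b)) i + mv p Ry (\<lambda>a. reg (y a)) i = 0) \<and>
      (AE t in lebesgue. t \<in> {-1<..<0} \<longrightarrow> (\<forall>b<m. u b t = 0) \<and> (\<forall>i<p. y i t = 0)) \<and>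
      (AE t in lebesgue. t \<in> {t1<..<1} \<longrightarrow> (\<forall>b<m. u b t = 0) \<and> (\<forall>i<p. y i t = free_response n A C x0 i (t - t1)))"
  shows "reachable n m A B"
  unfolding reachable_def
proof (intro allI impI)
  fix c i0 assume c: "\<forall>k. \<forall>j<m. (\<Sum>i<n. c i * mm n (mpow n A k) B i j) = 0" and i0: "i0 < n"
  obtain t1 u y where t1: "0 < t1" "t1 < 1" and u: "\<forall>b<m. u b \<in> L2" and y: "\<forall>i<p. y i \<in> L2"
    and ker: "\<forall>i<g. mv m Ru (\<lambda>b. reg (u b)) i + mv p Ry (\<lambda>a. reg (y a)) i = 0"
    and past: "AE t in lebesgue. t \<in> {-1<..<0} \<longrightarrow> (\<forall>b<m. u b t = 0) \<and> (\<forall>i<p. y i t = 0)"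
    and future: "AE t in lebesgue. t \<in> {t1<..<1} \<longrightarrow> (\<forall>b<m. u b t = 0) \<and> (\<forall>i<p. y i t = free_response n A C c i (t - t1))"
    using ctrl[of c] by blast
  obtain x0 where x0: "\<forall>i<p. AE t in lebesgue_on I. y i t = response n m A B C D x0 u i t"
    using kernel_imp_response[OF represents, of u y] u y ker by blast
  define h where "h j s = (\<Sum>l<n. mexp n A j l (- s) * (\<Sum>b<m. B l b * u b s))" for j s
  have hL2: "h j \<in> L2" if "j < n" for j
    unfolding h_def[abs_def] using u that by (intro L2_sum L2_smooth_mult smooth_mexp_neg L2_cmult) auto
  have h0: "h j s = 0" if "\<forall>b<m. u b s = 0" for j s using that by (simp add: h_def)
  have resp: "response n m A B C D x0 u i t = (\<Sum>l<n. C i l * (\<Sum>j<n. mexp n A l j t * (x0 j + primitive (h j) t)))"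
    if "\<forall>b<m. u b t = 0" for i t
    using that by (simp add: response_def trajectory_def h_def[abs_def])
  have prim_past: "primitive (h j) t = 0" if "t \<in> {-1<..<0}" for j t
    unfolding primitive_def
  proof (rule integral_eq_zero_AE)
    have "AE s in lebesgue. s \<in> I \<longrightarrow> h j s * indicator {..<t} s = 0"
      using past by eventually_elim (use that h0 in \<open>auto simp: indicator_def\<close>)
    then show "AE s in lebesgue_on I. h j s * indicator {..<t} s = 0"
      by (simp add: AE_restrict_space_iff[of I lebesgue, simplified])
  qed
  \<comment> \<open>The input is zero after \<open>t1\<close>, so the integral in the variation of
    constants keeps this value from then on.\<close>
  define ze where "ze j = primitive (h j) t1" for j
  have prim_future: "primitive (h j) t = ze j" if t: "t \<in> {t1<..<1}" and j: "j < n" for j t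
    unfolding primitive_def ze_def
  proof (rule integral_cong_AE)
    have m: "(\<lambda>s. indicator {..<t} s :: real) \<in> borel_measurable (lebesgue_on I)" for t
      by (intro measurable_restrict_space1 borel_measurable_indicator) auto
    show "(\<lambda>s. h j s * indicator {..<t} s) \<in> borel_measurable (lebesgue_on I)" for t
      by (intro borel_measurable_times m L2_measurable hL2 j)
    show "(\<lambda>s. h j s * indicator {..<t} s) \<in> borel_measurable (lebesgue_on I)" for t
      by (intro borel_measurable_times m L2_measurable hL2 j)
    have "AE s in lebesgue. s \<noteq> t1" using AE_completion[OF AE_lborel_singleton[of t1]] .
    with future have "AE s in lebesgue. s \<in> I \<longrightarrow> h j s * indicator {..<t} s = h j s * indicator {..<t1} s"
      by eventually_elim (use t h0 in \<open>auto simp: indicator_def\<close>)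
    then show "AE s in lebesgue_on I. h j s * indicator {..<t} s = h j s * indicator {..<t1} s"
      by (simp add: AE_restrict_space_iff[of I lebesgue, simplified])
  qed
  \<comment> \<open>Before time 0 the input and its integral vanish, so the output is the free
    response of \<open>x0\<close>, and it is zero almost everywhere.\<close>
  have "free_response n A C x0 i t = 0" if i: "i < p" and t: "t \<in> {-1<..<0}" for i t
  proof (rule AE_zero_continuous[OF _ _ _ t])
    have "AE t in lebesgue. t \<in> {-1<..<0} \<longrightarrow> y i t = response n m A B C D x0 u i t"
      using x0 i by (intro AE_Ioo) auto
    with past show "AE t in lebesgue. t \<in> {-1<..<0} \<longrightarrow> free_response n A C x0 i t = 0"
    proof eventually_elim
      case (elim t)
      show ?case
      proof
        assume t: "t \<in> {-1<..<0}"
        then have "0 = response n m A B C D x0 u i t" using elim i by auto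
        also have "\<dots> = free_response n A C x0 i t"
          using resp[of t i] elim(1) t prim_past by (auto simp: free_response_def)
        finally show "free_response n A C x0 i t = 0" by simp
      qed
    qed
  qed (auto intro: smooth_continuous smooth_free_response)
  then have x00: "x0 j = 0" if "j < n" for j
    using observable_free_response[OF obs, of "-1" 0 x0 j] that by auto
  \<comment> \<open>The difference between the vector produced by the input and c moved back from
    \<open>t1\<close> to time 0. Both have the same output after \<open>t1\<close>.\<close>
  define z where "z j = ze j - (\<Sum>l<n. mexp n A j l (- t1) * c l)" for j
  have shift: "free_response n A C (\<lambda>j. \<Sum>l<n. mexp n A j l (- t1) * c l) i t = free_response n A C c i (t - t1)" for i t
  proof -
    have "(\<Sum>j<n. mexp n A l j t * (\<Sum>r<n. mexp n A j r (- t1) * c r)) = (\<Sum>r<n. mexp n A l r (t - t1) * c r)" if "l < n" for l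
    proof -
      have "(\<Sum>j<n. mexp n A l j t * (\<Sum>r<n. mexp n A j r (- t1) * c r)) = (\<Sum>r<n. (\<Sum>j<n. mexp n A l j t * mexp n A j r (- t1)) * c r)"
        unfolding sum_distrib_left sum_distrib_right by (subst sum.swap) (simp add: mult.assoc)
      then show ?thesis using that by (simp add: mexp_add)
    qed
    then show ?thesis by (simp add: free_response_def)
  qed
  have "free_response n A C z i t = 0" if i: "i < p" and t: "t \<in> {t1<..<1}" for i t
  proof (rule AE_zero_continuous[OF _ _ _ t])
    have "AE t in lebesgue. t \<in> {t1<..<1} \<longrightarrow> y i t = response n m A B C D x0 u i t"
      using x0 i t1 by (intro AE_Ioo) auto
    with future show "AE t in lebesgue. t \<in> {t1<..<1} \<longrightarrow> free_response n A C z i t = 0"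
    proof eventually_elim
      case (elim t)
      show ?case
      proof
        assume t: "t \<in> {t1<..<1}"
        have "free_response n A C z i t = free_response n A C ze i t - free_response n A C c i (t - t1)"
          unfolding shift[symmetric] by (simp add: free_response_def z_def right_diff_distrib sum_subtractf)
        moreover have "free_response n A C c i (t - t1) = response n m A B C D x0 u i t"
          using elim t i by auto
        moreover have "response n m A B C D x0 u i t = free_response n A C ze i t"
          using resp[of t i] elim(1) t prim_future[OF t] x00 by (auto simp: free_response_def)
        ultimately show "free_response n A C z i t = 0" by simp
      qed
    qed
  qed (auto intro: smooth_continuous smooth_free_response)
  then have z0: "z j = 0" if "j < n" for j
    using observable_free_response[OF obs t1(2), of z j] that by auto
  have zeta: "(\<Sum>j<n. mexp n A i j t1 * ze j) = c i" if "i < n" for i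
  proof -
    have "(\<Sum>j<n. mexp n A i j t1 * ze j) = (\<Sum>j<n. mexp n A i j t1 * (\<Sum>l<n. mexp n A j l (- t1) * c l))"
      using z0 by (intro sum.cong refl) (simp add: z_def)
    also have "\<dots> = (\<Sum>l<n. (\<Sum>j<n. mexp n A i j t1 * mexp n A j l (- t1)) * c l)"
      unfolding sum_distrib_left sum_distrib_right by (subst sum.swap) (simp add: mult.assoc)
    finally show ?thesis using that by (simp add: mexp_inverse sum_mult_idm)
  qed
  \<comment> \<open>One factor c is replaced by the integral that reaches it. Under the integral the
    other factor meets exp((t1 - s) A) B, which it annihilates.\<close>
  have "(\<Sum>i<n. (c i)\<^sup>2) = (\<Sum>i<n. c i * (\<Sum>j<n. mexp n A i j t1 * ze j))"
    by (simp add: zeta power2_eq_square)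
  also have "\<dots> = (\<Sum>j<n. (\<Sum>i<n. c i * mexp n A i j t1) * ze j)"
    unfolding sum_distrib_left sum_distrib_right by (subst sum.swap) (simp add: mult.assoc)
  also have "\<dots> = integral_I (\<lambda>s. \<Sum>j<n. (\<Sum>i<n. c i * mexp n A i j t1) * (h j s * indicator {..<t1} s))"
  proof -
    have m: "(\<lambda>s. indicator {..<t1} s :: real) \<in> borel_measurable (lebesgue_on I)"
      by (intro measurable_restrict_space1 borel_measurable_indicator) auto
    have "(\<lambda>s. indicator {..<t1} s * h j s) \<in> L2" if "j < n" for j
      by (rule L2_bounded_mult[OF hL2[OF that] m, of 1]) (auto simp: indicator_def)
    then have "integrable (lebesgue_on I) (\<lambda>s. h j s * indicator {..<t1} s)" if "j < n" for j
      using L2_integrable that by (simp add: mult.commute)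
    then show ?thesis by (simp add: ze_def primitive_def)
  qed
  also have "(\<lambda>s. \<Sum>j<n. (\<Sum>i<n. c i * mexp n A i j t1) * (h j s * indicator {..<t1} s)) = (\<lambda>_. 0)"
  proof
    fix s
    have "(\<Sum>j<n. (\<Sum>i<n. c i * mexp n A i j t1) * h j s) = 0"
    proof -
      have 1: "(\<Sum>j<n. (\<Sum>i<n. c i * mexp n A i j t1) * mexp n A j l (- s)) = (\<Sum>i<n. c i * mexp n A i l (t1 - s))"
        if "l < n" for l
      proof -
        have "(\<Sum>j<n. (\<Sum>i<n. c i * mexp n A i j t1) * mexp n A j l (- s)) = (\<Sum>i<n. c i * (\<Sum>j<n. mexp n A i j t1 * mexp n A j l (- s)))"
          unfolding sum_distrib_left sum_distrib_right by (subst sum.swap) (simp add: mult.assoc)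
        then show ?thesis using that by (simp add: mexp_add)
      qed
      have 2: "(\<Sum>l<n. (\<Sum>i<n. c i * mexp n A i l (t1 - s)) * B l b) = 0" if b: "b < m" for b
      proof -
        have "(\<Sum>l<n. (\<Sum>i<n. c i * mexp n A i l (t1 - s)) * B l b) = (\<Sum>i<n. \<Sum>l<n. c i * mexp n A i l (t1 - s) * B l b)"
          unfolding sum_distrib_right by (rule sum.swap)
        also have "\<dots> = (\<Sum>k. (\<Sum>i<n. \<Sum>l<n. c i * mpow n A k i l * B l b) / fact k * (t1 - s) ^ k)"
          by (rule mexp_bilinear)
        also have "\<dots> = 0"
          using c b by (simp add: mm_def sum_distrib_left mult.assoc)
        finally show ?thesis .
      qed
      have "(\<Sum>j<n. (\<Sum>i<n. c i * mexp n A i j t1) * h j s)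
          = (\<Sum>l<n. (\<Sum>j<n. (\<Sum>i<n. c i * mexp n A i j t1) * mexp n A j l (- s)) * (\<Sum>b<m. B l b * u b s))"
        unfolding h_def by (rule sum_vec_mat_vec)
      also have "\<dots> = (\<Sum>l<n. (\<Sum>i<n. c i * mexp n A i l (t1 - s)) * (\<Sum>b<m. B l b * u b s))"
        by (intro sum.cong refl) (simp add: 1)
      also have "\<dots> = (\<Sum>b<m. (\<Sum>l<n. (\<Sum>i<n. c i * mexp n A i l (t1 - s)) * B l b) * u b s)"
        by (rule sum_vec_mat_vec)
      also have "\<dots> = 0" by (intro sum.neutral) (simp add: 2)
      finally show ?thesis .
    qed
    then show "(\<Sum>j<n. (\<Sum>i<n. c i * mexp n A i j t1) * (h j s * indicator {..<t1} s)) = 0"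
      by (simp only: mult.assoc[symmetric] sum_distrib_right[symmetric] mult_zero_left)
  qed
  finally have "(\<Sum>i<n. (c i)\<^sup>2) = 0" by simp
  then have "\<forall>i<n. (c i)\<^sup>2 = 0" using sum_nonneg_eq_0_iff[of "{..<n}" "\<lambda>i. (c i)\<^sup>2"] by auto
  then show "c i0 = 0" using i0 by simp
qed

section \<open>The latent variable\<close>

lemma mv_ddiff: "mv n P (\<lambda>b. ddiff (x b)) i = mv n (\<lambda>i b. [:0, 1:] * P i b) x i"
  unfolding mv_def act_s[symmetric] by (simp only: act_mult[symmetric] mult.commute)

lemma ddiff_pow_mv: "(ddiff ^^ j) (mv n P x i) = mv n P (\<lambda>l. (ddiff ^^ j) (x l)) i"
  unfolding mv_def act_s_pow[symmetric] act.scale_sum_right by (simp only: act_mult[symmetric] mult.commute)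

text \<open>The matrix C X + D U, which takes the flat output to the output.\<close>

definition output_matrix where
  "output_matrix n m C D X U i b = mm n (cm C) X i b + mm m (cm D) U i b"

lemma mv_output_matrix:
  "mv m (output_matrix n m C D X U) l i = mv n (cm C) (mv m X l) i + mv m (cm D) (mv m U l) i"
  unfolding output_matrix_def[abs_def] mv_add_left mv_mm ..

definition is_L2 :: "distribution \<Rightarrow> bool" where "is_L2 T \<longleftrightarrow> (\<exists>f\<in>L2. T = reg f)"

lemma is_L2_mv: "(\<And>l. l < n \<Longrightarrow> is_L2 (x l)) \<Longrightarrow> is_L2 (mv n (cm A) x i)"
proof -
  assume "\<And>l. l < n \<Longrightarrow> is_L2 (x l)"
  then have "\<forall>l. \<exists>f. l < n \<longrightarrow> f \<in> L2 \<and> x l = reg f" by (auto simp: is_L2_def)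
  then obtain f where f: "\<forall>l. l < n \<longrightarrow> f l \<in> L2 \<and> x l = reg (f l)"
    using choice[of "\<lambda>l f. l < n \<longrightarrow> f \<in> L2 \<and> x l = reg f"] by blast
  have "mv n (cm A) x i = mv n (cm A) (\<lambda>l. reg (f l)) i" using f by (intro mv_cong) auto
  also have "\<dots> = reg (\<lambda>t. \<Sum>l<n. A i l * f l t)" using f by (intro mv_reg) auto
  finally show ?thesis unfolding is_L2_def using f by (auto intro!: bexI L2_sum L2_cmult)
qed

lemma is_L2_add: "is_L2 S \<Longrightarrow> is_L2 T \<Longrightarrow> is_L2 (S + T)"
  unfolding is_L2_def using reg_add L2_add by metis

locale flat_system =
  fixes g m p n :: nat and Ru Ry X U :: "nat \<Rightarrow> nat \<Rightarrow> real poly" and A B C D Lx Lu :: "nat \<Rightarrow> nat \<Rightarrow> real"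
  assumes represents: "represents g m p Ru Ry n A B C D" and obs: "observable n p A C"
    and flat: "flat_data n m A B X U Lx Lu"
begin

abbreviation "Yp \<equiv> output_matrix n m C D X U"

text \<open>The input and output blocks of the image equation. The factor \<open>[:0, 1:]\<close>
  passes from the latent variable to its derivative, the flat output.\<close>

definition latent_eq :: "(nat \<Rightarrow> distribution) \<Rightarrow> (nat \<Rightarrow> distribution) \<Rightarrow> (nat \<Rightarrow> distribution) \<Rightarrow> bool" where
  "latent_eq l u y \<longleftrightarrow> (\<forall>b<m. u b = mv m (\<lambda>i b. [:0, 1:] * U i b) l b) \<and>
     (\<forall>i<p. y i = mv m (\<lambda>i b. [:0, 1:] * Yp i b) l i)"

definition kernel :: "(nat \<Rightarrow> distribution) \<Rightarrow> (nat \<Rightarrow> distribution) \<Rightarrow> bool" where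
  "kernel u y \<longleftrightarrow> (\<forall>i<g. mv m Ru u i + mv p Ry y i = 0)"

lemmas flat_state = flat[unfolded flat_data_def, THEN conjunct2, THEN conjunct2, THEN conjunct1, rule_format]
lemmas flat_output = flat[unfolded flat_data_def, THEN conjunct2, THEN conjunct2, THEN conjunct2, THEN conjunct1, rule_format]
lemmas flat_injective = flat[unfolded flat_data_def, THEN conjunct2, THEN conjunct2, THEN conjunct2, THEN conjunct2, THEN spec, THEN spec, THEN mp, THEN mp]

lemma latent_ode:
  assumes i: "i < n"
  shows "ddiff (mv m X l i) = mv n (cm A) (mv m X l) i + mv m (cm B) (mv m U l) i"
proof -
  have "mv n (pencil A) (mv m X l) i = mv m (cm B) (mv m U l) i"
    unfolding mv_mm by (intro mv_cong flat_state[OF i] refl)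
  then show ?thesis unfolding mv_pencil[OF i] by (simp only: diff_eq_eq add.commute)
qed

lemma flat_left_inverse:
  assumes "i < m"
  shows "mv n (cm Lx) (mv m X l) i + mv m (cm Lu) (mv m U l) i = l i"
proof -
  have "mv n (cm Lx) (mv m X l) i + mv m (cm Lu) (mv m U l) i = mv m (\<lambda>i b. mm n (cm Lx) X i b + mm m (cm Lu) U i b) l i"
    by (simp only: mv_mm mv_add_left)
  also have "\<dots> = mv m idm l i" by (intro mv_cong flat_output[OF assms] refl)
  finally show ?thesis by (simp only: mv_idm[OF assms])
qed

lemma latent_imp_kernel:
  assumes "latent_eq l u y" shows "kernel u y"
  unfolding kernel_def
proof (intro allI impI)
  fix i assume i: "i < g"
  let ?l = "\<lambda>b. ddiff (l b)"
  have u: "u b = mv m U ?l b" if "b < m" for b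
    using assms that unfolding latent_eq_def mv_ddiff by blast
  have y: "y a = mv n (cm C) (mv m X ?l) a + mv m (cm D) (mv m U ?l) a" if "a < p" for a
    using assms that unfolding latent_eq_def mv_output_matrix[symmetric] mv_ddiff by blast
  have "mv m Ru u i + mv p Ry y i = mv m Ru (mv m U ?l) i + mv p Ry (\<lambda>a. mv n (cm C) (mv m X ?l) a + mv m (cm D) (mv m U ?l) a) i"
    using u y by (intro arg_cong2[where f = "(+)"] mv_cong) auto
  also have "\<dots> = 0" by (rule represents_kernel[OF represents latent_ode i])
  finally show "mv m Ru u i + mv p Ry y i = 0" .
qed

lemma kernel_imp_state:
  assumes u: "\<And>b. b < m \<Longrightarrow> u b \<in> L2" and y: "\<And>i. i < p \<Longrightarrow> y i \<in> L2"
    and ker: "kernel (\<lambda>b. reg (u b)) (\<lambda>i. reg (y i))"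
  shows "\<exists>x. (\<forall>l<n. x l \<in> L2) \<and>
    (\<forall>l<n. ddiff (reg (x l)) = mv n (cm A) (\<lambda>l. reg (x l)) l + mv m (cm B) (\<lambda>b. reg (u b)) l) \<and>
    (\<forall>i<p. reg (y i) = mv n (cm C) (\<lambda>l. reg (x l)) i + mv m (cm D) (\<lambda>b. reg (u b)) i)"
proof -
  have "\<exists>x0. \<forall>i<p. AE t in lebesgue_on I. y i t = response n m A B C D x0 u i t"
    by (rule kernel_imp_response[OF represents]) (use u y ker in \<open>auto simp: kernel_def\<close>)
  then obtain x0 where x0: "\<forall>i<p. AE t in lebesgue_on I. y i t = response n m A B C D x0 u i t" ..
  let ?x = "trajectory n A x0 (\<lambda>l s. \<Sum>b<m. B l b * u b s)"
  have r: "response n m A B C D x0 u i \<in> L2" for i by (rule response_props(3)) (rule u)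
  have 1: "?x l \<in> L2" if "l < n" for l by (rule response_props(1)[OF u that])
  have 2: "ddiff (reg (?x l)) = mv n (cm A) (\<lambda>l. reg (?x l)) l + mv m (cm B) (\<lambda>b. reg (u b)) l" if "l < n" for l
    by (rule response_props(2)[OF u that])
  have 3: "reg (y i) = mv n (cm C) (\<lambda>l. reg (?x l)) i + mv m (cm D) (\<lambda>b. reg (u b)) i" if i: "i < p" for i
  proof -
    have "reg (y i) = reg (response n m A B C D x0 u i)"
      using x0 i by (intro reg_cong_AE y r) auto
    also have "\<dots> = mv n (cm C) (\<lambda>l. reg (?x l)) i + mv m (cm D) (\<lambda>b. reg (u b)) i"
      by (rule response_props(4)) (rule u)
    finally show ?thesis .
  qed
  show ?thesis by (intro exI[of _ ?x] conjI allI impI 1 2 3)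
qed

text \<open>The flat output \<open>Lx x + Lu u\<close> is the derivative of the latent variable.\<close>

lemma state_imp_flat:
  assumes ode: "\<And>l. l < n \<Longrightarrow> ddiff (x l) = mv n (cm A) x l + mv m (cm B) u l"
  defines "f \<equiv> \<lambda>i. mv n (cm Lx) x i + mv m (cm Lu) u i"
  shows "\<And>l. l < n \<Longrightarrow> x l = mv m X f l" "\<And>b. b < m \<Longrightarrow> u b = mv m U f b"
proof -
  define dx where "dx l = x l - mv m X f l" for l
  define du where "du b = u b - mv m U f b" for b
  have "ddiff (dx l) = mv n (cm A) dx l + mv m (cm B) du l" if l: "l < n" for l
  proof -
    have "ddiff (dx l) = ddiff (x l) - ddiff (mv m X f l)" by (auto simp: dx_def ddiff_def)
    then show ?thesis
      unfolding dx_def[abs_def] du_def[abs_def] mv_diff_right ode[OF l] latent_ode[OF l] by (simp only: add_diff_add)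
  qed
  then have 1: "\<forall>i<n. \<forall>\<phi>. ddiff (dx i) \<phi> = (\<Sum>l<n. A i l * dx l \<phi>) + (\<Sum>b<m. B i b * du b \<phi>)"
    by (simp add: mv_cm)
  have "mv n (cm Lx) dx i + mv m (cm Lu) du i = 0" if "i < m" for i
  proof -
    have "mv n (cm Lx) dx i + mv m (cm Lu) du i = f i - (mv n (cm Lx) (mv m X f) i + mv m (cm Lu) (mv m U f) i)"
      unfolding dx_def[abs_def] du_def[abs_def] mv_diff_right f_def by (simp only: add_diff_add)
    then show ?thesis unfolding flat_left_inverse[OF that] by simp
  qed
  note L = this
  have 2: "\<forall>i<m. \<forall>\<phi>. (\<Sum>l<n. Lx i l * dx l \<phi>) + (\<Sum>b<m. Lu i b * du b \<phi>) = 0"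
  proof (intro allI impI)
    fix i \<phi> assume "i < m"
    from fun_cong[OF L[OF this], of \<phi>]
    show "(\<Sum>l<n. Lx i l * dx l \<phi>) + (\<Sum>b<m. Lu i b * du b \<phi>) = 0" by (simp add: mv_cm)
  qed
  have z: "(\<forall>i<n. dx i = 0) \<and> (\<forall>b<m. du b = 0)" by (rule flat_injective[OF 1 2])
  show "x l = mv m X f l" if "l < n" for l
    using z[THEN conjunct1, rule_format, OF that] unfolding dx_def right_minus_eq .
  show "u b = mv m U f b" if "b < m" for b
    using z[THEN conjunct2, rule_format, OF that] unfolding du_def right_minus_eq .
qed

lemma state_imp_latent:
  assumes ode: "\<And>l. l < n \<Longrightarrow> ddiff (x l) = mv n (cm A) x l + mv m (cm B) u l"
    and out: "\<And>i. i < p \<Longrightarrow> y i = mv n (cm C) x i + mv m (cm D) u i"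
    and l: "\<And>i. i < m \<Longrightarrow> ddiff (l i) = mv n (cm Lx) x i + mv m (cm Lu) u i"
  shows "latent_eq l u y"
proof -
  let ?f = "\<lambda>i. mv n (cm Lx) x i + mv m (cm Lu) u i"
  have x: "x i = mv m X ?f i" if "i < n" for i by (rule state_imp_flat(1)[OF ode that])
  have u: "u i = mv m U ?f i" if "i < m" for i by (rule state_imp_flat(2)[OF ode that])
  have lf: "mv m P ?f i = mv m P (\<lambda>b. ddiff (l b)) i" for P i
    by (intro mv_cong) (simp_all only: l)
  have "y i = mv m Yp ?f i" if "i < p" for i
    unfolding out[OF that] mv_output_matrix
    by (intro arg_cong2[where f = "(+)"] mv_cong refl) (rule x u, assumption)+
  then show ?thesis
    unfolding latent_eq_def mv_ddiff[symmetric] lf[symmetric] using u by simp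
qed

text \<open>Observability makes the latent variable unique up to constants.\<close>

lemma latent_unique:
  assumes U0: "\<And>b. b < m \<Longrightarrow> mv m U d b = 0" and Y0: "\<And>i. i < p \<Longrightarrow> mv m Yp d i = 0"
    and i: "i < m"
  shows "d i = 0"
proof -
  define z where "z = mv m X d"
  have ode: "ddiff (z l) = mv n (cm A) z l" if "l < n" for l
    unfolding z_def latent_ode[OF that] using mv_zero_right[of m "mv m U d" "cm B" l] U0 by simp
  have out: "mv n (cm C) z i = 0" if "i < p" for i
    using Y0[OF that] mv_zero_right[of m "mv m U d" "cm D" i] U0 unfolding mv_output_matrix z_def by simp
  \<comment> \<open>Differentiation only changes the test function, so the induction runs over all
    test functions. For each of them the values of \<open>z\<close> form a vector in the
    unobservable subspace.\<close>
  have "(\<Sum>l<n. mm n C (mpow n A k) i l * z l \<phi>) = 0" if "i < p" for i k \<phi>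
    using that
  proof (induction k arbitrary: \<phi>)
    case 0
    then show ?case using fun_cong[OF out[OF 0], of \<phi>] by (simp add: mv_cm mm_idm_right)
  next
    case (Suc k)
    have "0 = - (\<Sum>l<n. mm n C (mpow n A k) i l * z l (dtest \<phi>))" using Suc by simp
    also have "\<dots> = (\<Sum>l<n. mm n C (mpow n A k) i l * ddiff (z l) \<phi>)" by (simp add: ddiff_def sum_negf)
    also have "\<dots> = (\<Sum>l<n. mm n C (mpow n A k) i l * (\<Sum>r<n. A l r * z r \<phi>))"
      by (intro sum.cong refl) (simp add: ode mv_cm)
    also have "\<dots> = (\<Sum>r<n. mm n (mm n C (mpow n A k)) A i r * z r \<phi>)" by (rule sum_mm_right[symmetric])
    also have "\<dots> = (\<Sum>r<n. mm n C (mpow n A (Suc k)) i r * z r \<phi>)"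
    proof (intro sum.cong refl arg_cong2[where f = "(*)"])
      fix r assume "r \<in> {..<n}"
      then show "mm n (mm n C (mpow n A k)) A i r = mm n C (mpow n A (Suc k)) i r"
        unfolding mm_assoc[symmetric] by (intro mm_cong mpow_Suc2[symmetric]) auto
    qed
    finally show ?case by simp
  qed
  then have "z l \<phi> = 0" if "l < n" for l \<phi>
    using obs[unfolded observable_def, THEN spec[of _ "\<lambda>l. z l \<phi>"]] that by blast
  then have z0: "z l = 0" if "l < n" for l using that by (auto simp: fun_eq_iff)
  have "mv n (cm Lx) (mv m X d) i + mv m (cm Lu) (mv m U d) i = 0"
    using mv_zero_right[of n "mv m X d" "cm Lx" i] mv_zero_right[of m "mv m U d" "cm Lu" i] z0 U0
    unfolding z_def by simp
  then show ?thesis unfolding flat_left_inverse[OF i] .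
qed

lemma flat_latent:
  assumes u: "\<And>b. b < m \<Longrightarrow> u b \<in> L2" and y: "\<And>i. i < p \<Longrightarrow> y i \<in> L2"
    and ker: "kernel (\<lambda>b. reg (u b)) (\<lambda>i. reg (y i))"
  shows "\<exists>l x. (\<forall>i<m. l i \<in> L2) \<and> latent_eq (\<lambda>i. reg (l i)) (\<lambda>b. reg (u b)) (\<lambda>i. reg (y i)) \<and>
    (\<forall>r<n. x r \<in> L2) \<and>
    (\<forall>r<n. ddiff (reg (x r)) = mv n (cm A) (\<lambda>l. reg (x l)) r + mv m (cm B) (\<lambda>b. reg (u b)) r) \<and>
    (\<forall>i<m. ddiff (reg (l i)) = mv n (cm Lx) (\<lambda>l. reg (x l)) i + mv m (cm Lu) (\<lambda>b. reg (u b)) i)"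
proof -
  obtain x where x: "\<forall>l<n. x l \<in> L2"
    "\<forall>l<n. ddiff (reg (x l)) = mv n (cm A) (\<lambda>l. reg (x l)) l + mv m (cm B) (\<lambda>b. reg (u b)) l"
    "\<forall>i<p. reg (y i) = mv n (cm C) (\<lambda>l. reg (x l)) i + mv m (cm D) (\<lambda>b. reg (u b)) i"
    using kernel_imp_state[of u y] u y ker by blast
  define f where "f i t = (\<Sum>l<n. Lx i l * x l t) + (\<Sum>b<m. Lu i b * u b t)" for i t
  have f1: "(\<lambda>t. \<Sum>l<n. Lx i l * x l t) \<in> L2" for i using x(1) by (intro L2_sum L2_cmult) auto
  have f2: "(\<lambda>t. \<Sum>b<m. Lu i b * u b t) \<in> L2" for i using u by (intro L2_sum L2_cmult) auto
  have fL2: "f i \<in> L2" for i unfolding f_def[abs_def] by (rule L2_add[OF f1 f2])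
  have regf: "reg (f i) = mv n (cm Lx) (\<lambda>l. reg (x l)) i + mv m (cm Lu) (\<lambda>b. reg (u b)) i" for i
    unfolding f_def[abs_def] reg_add[OF f1 f2] using mv_reg[of n x Lx i] mv_reg[of m u Lu i] x(1) u by simp
  let ?l = "\<lambda>i. primitive (f i)"
  have l: "?l i \<in> L2" "ddiff (reg (?l i)) = mv n (cm Lx) (\<lambda>l. reg (x l)) i + mv m (cm Lu) (\<lambda>b. reg (u b)) i" for i
    using primitive_props[OF fL2[of i]] unfolding regf by auto
  have "latent_eq (\<lambda>i. reg (?l i)) (\<lambda>b. reg (u b)) (\<lambda>i. reg (y i))"
    by (rule state_imp_latent[of "\<lambda>l. reg (x l)"]) (use x l in auto)
  with l x(1,2) show ?thesis by (intro exI[of _ ?l] exI[of _ x] conjI allI impI) auto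
qed

lemma kernel_imp_latent:
  assumes "\<And>b. b < m \<Longrightarrow> u b \<in> L2" "\<And>i. i < p \<Longrightarrow> y i \<in> L2"
    and "kernel (\<lambda>b. reg (u b)) (\<lambda>i. reg (y i))"
  shows "\<exists>l. (\<forall>i<m. l i \<in> L2) \<and> latent_eq (\<lambda>i. reg (l i)) (\<lambda>b. reg (u b)) (\<lambda>i. reg (y i))"
  using flat_latent[of u y] assms by blast

text \<open>The derivative of any latent variable is a constant combination of state and input. By
  the state equation, derivative j + 1 of the state involves derivative j of state and input only,
  so these are regular up to order k, and the latent variable gains one order.\<close>

lemma latent_regularity:
  assumes u: "\<And>b. b < m \<Longrightarrow> u b \<in> L2" and y: "\<And>i. i < p \<Longrightarrow> y i \<in> L2" and l: "\<And>i. i < m \<Longrightarrow> l i \<in> L2"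
    and lat: "latent_eq (\<lambda>i. reg (l i)) (\<lambda>b. reg (u b)) (\<lambda>i. reg (y i))"
    and uk: "\<And>b j. b < m \<Longrightarrow> j \<le> k \<Longrightarrow> is_L2 ((ddiff ^^ j) (reg (u b)))"
    and i: "i < m" and j: "j \<le> k + 1"
  shows "is_L2 ((ddiff ^^ j) (reg (l i)))"
proof -
  have "kernel (\<lambda>b. reg (u b)) (\<lambda>i. reg (y i))" by (rule latent_imp_kernel[OF lat])
  then obtain l' x where l': "\<forall>i<m. l' i \<in> L2" "latent_eq (\<lambda>i. reg (l' i)) (\<lambda>b. reg (u b)) (\<lambda>i. reg (y i))"
    and x: "\<forall>r<n. x r \<in> L2"
    and ode: "\<forall>r<n. ddiff (reg (x r)) = mv n (cm A) (\<lambda>l. reg (x l)) r + mv m (cm B) (\<lambda>b. reg (u b)) r"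
    and dl': "\<forall>i<m. ddiff (reg (l' i)) = mv n (cm Lx) (\<lambda>l. reg (x l)) i + mv m (cm Lu) (\<lambda>b. reg (u b)) i"
    using flat_latent[of u y] u y by blast
  \<comment> \<open>The given latent variable and the one from \<open>flat_latent\<close> have the
    same image, so uniqueness applies to the difference of their derivatives.\<close>
  have "ddiff (reg (l b)) - ddiff (reg (l' b)) = 0" if "b < m" for b
  proof (rule latent_unique[where d = "\<lambda>b. ddiff (reg (l b)) - ddiff (reg (l' b))", OF _ _ that])
    show "mv m U (\<lambda>b. ddiff (reg (l b)) - ddiff (reg (l' b))) b = 0" if "b < m" for b
      unfolding mv_diff_right mv_ddiff
        lat[unfolded latent_eq_def, THEN conjunct1, rule_format, OF that, symmetric]
        l'(2)[unfolded latent_eq_def, THEN conjunct1, rule_format, OF that, symmetric]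
      by (rule diff_self)
    show "mv m Yp (\<lambda>b. ddiff (reg (l b)) - ddiff (reg (l' b))) i = 0" if "i < p" for i
      unfolding mv_diff_right mv_ddiff
        lat[unfolded latent_eq_def, THEN conjunct2, rule_format, OF that, symmetric]
        l'(2)[unfolded latent_eq_def, THEN conjunct2, rule_format, OF that, symmetric]
      by (rule diff_self)
  qed
  then have dl: "ddiff (reg (l i)) = mv n (cm Lx) (\<lambda>l. reg (x l)) i + mv m (cm Lu) (\<lambda>b. reg (u b)) i"
    using dl'[rule_format, OF i] i unfolding right_minus_eq by simp
  have xk: "\<forall>r<n. is_L2 ((ddiff ^^ j) (reg (x r)))" if "j \<le> k" for j
    using that
  proof (induction j)
    case 0
    then show ?case using x by (auto simp: is_L2_def)
  next
    case (Suc j)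
    show ?case
    proof (intro allI impI)
      fix r assume r: "r < n"
      have "(ddiff ^^ Suc j) (reg (x r)) = (ddiff ^^ j) (mv n (cm A) (\<lambda>l. reg (x l)) r + mv m (cm B) (\<lambda>b. reg (u b)) r)"
        using ode r by (simp only: funpow_Suc_right o_apply)
      also have "\<dots> = mv n (cm A) (\<lambda>l. (ddiff ^^ j) (reg (x l))) r + mv m (cm B) (\<lambda>b. (ddiff ^^ j) (reg (u b))) r"
        by (simp only: ddiff_pow_add ddiff_pow_mv)
      finally show "is_L2 ((ddiff ^^ Suc j) (reg (x r)))"
        using Suc uk by (simp only:) (intro is_L2_add is_L2_mv; auto)
    qed
  qed
  show ?thesis
  proof (cases j)
    case 0
    then show ?thesis using l[OF i] by (auto simp: is_L2_def)
  next
    case (Suc q)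
    have "(ddiff ^^ Suc q) (reg (l i)) = (ddiff ^^ q) (mv n (cm Lx) (\<lambda>l. reg (x l)) i + mv m (cm Lu) (\<lambda>b. reg (u b)) i)"
      by (simp only: funpow_Suc_right o_apply dl)
    also have "\<dots> = mv n (cm Lx) (\<lambda>l. (ddiff ^^ q) (reg (x l))) i + mv m (cm Lu) (\<lambda>b. (ddiff ^^ q) (reg (u b))) i"
      by (simp only: ddiff_pow_add ddiff_pow_mv)
    finally show ?thesis
      unfolding Suc using xk[of q] uk[of _ q] j Suc by (simp only:) (intro is_L2_add is_L2_mv; auto)
  qed
qed

end

lemma all_testfn: "(\<forall>\<phi>. P (Rep_testfn \<phi>)) \<longleftrightarrow> (\<forall>\<phi>\<in>test_fun. P \<phi>)"
proof (intro iffI ballI allI)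
  fix \<phi> assume P: "\<forall>\<phi>. P (Rep_testfn \<phi>)" and "\<phi> \<in> test_fun"
  then have "Rep_testfn (Abs_testfn \<phi>) = \<phi>" by (simp add: Abs_testfn_inverse)
  with P[rule_format, of "Abs_testfn \<phi>"] show "P \<phi>" by simp
next
  fix \<phi> assume "\<forall>\<phi>\<in>test_fun. P \<phi>"
  then show "P (Rep_testfn \<phi>)" using Rep_testfn by blast
qed

lemma sobolev_iff: "f \<in> sobolev k \<longleftrightarrow> f \<in> L2 \<and> (\<forall>j\<le>k. is_L2 ((ddiff ^^ j) (reg f)))"
proof -
  have "(ddiff ^^ j) (reg f) = reg h \<longleftrightarrow>
      (\<forall>\<phi>\<in>test_fun. integral_I (\<lambda>t. h t * \<phi> t) = (-1) ^ j * integral_I (\<lambda>t. f t * (deriv ^^ j) \<phi> t))" for h j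
    unfolding all_testfn[symmetric] fun_eq_iff ddiff_pow reg_def Rep_dtest_pow by (simp only: eq_commute)
  then show ?thesis unfolding sobolev_def is_L2_def by simp
qed

section \<open>Matrices and vectors\<close>

definition test_vec :: "nat \<Rightarrow> nat \<Rightarrow> testfn \<Rightarrow> real \<Rightarrow> real Matrix.vec" where
  "test_vec d i \<phi> t = Matrix.vec d (\<lambda>j. if j = i then Rep_testfn \<phi> t else 0)"

lemma linear_cmult: "linear T \<Longrightarrow> linear (\<lambda>\<phi>. c * T \<phi>)" for T :: distribution
  by (intro linearI) (simp_all add: linear_add linear_scale algebra_simps)

lemma degree_le_degree_mat:
  assumes "P \<in> carrier_mat r c" "i < r" "j < c" shows "degree (P $$ (i, j)) \<le> degree_mat P"
proof -
  have "finite (elements_mat P)" unfolding elements_mat_def by simp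
  moreover have "P $$ (i, j) \<in> elements_mat P" using assms by (intro elements_matI) auto
  ultimately show ?thesis unfolding degree_mat_def by (intro Max_ge) auto
qed

lemma degree_mat_le:
  assumes "P \<in> carrier_mat r c" "\<And>i j. i < r \<Longrightarrow> j < c \<Longrightarrow> degree (P $$ (i, j)) \<le> N"
  shows "degree_mat P \<le> N"
proof -
  have "finite (elements_mat P)" unfolding elements_mat_def by simp
  then show ?thesis unfolding degree_mat_def using assms
    by (subst Max_le_iff) (auto simp: elements_mat_def)
qed

lemma L2_deriv_integrable:
  assumes "f \<in> L2" shows "integrable (lebesgue_on I) (\<lambda>t. f t * (deriv ^^ i) (Rep_testfn \<phi>) t)"
  using L2_test_integrable[OF assms, of "(dtest ^^ i) \<phi>"] by (simp add: Rep_dtest_pow)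

text \<open>The passage from vectors and integrals to the polynomial module. Both sides are sums
  over rows, each a distribution applied to one component of the test vector, and the components can
  be chosen independently.\<close>

lemma weak_diff_eq_iff:
  assumes P: "P \<in> carrier_mat r c" and l: "l \<in> L2_vec c" and w: "w \<in> L2_vec r"
  shows "weak_diff_eq P l w \<longleftrightarrow>
    (\<forall>a<r. reg (\<lambda>t. w t $ a) = mv c (\<lambda>a b. P $$ (a, b)) (\<lambda>b. reg (\<lambda>t. l t $ b)) a)"
proof -
  let ?N = "degree_mat P"
  have lL2: "(\<lambda>t. l t $ b) \<in> L2" if "b < c" for b using l that by (auto simp: L2_vec_def)
  have wL2: "(\<lambda>t. w t $ a) \<in> L2" if "a < r" for a using w that by (auto simp: L2_vec_def)
  define comp where "comp \<phi> a = Abs_testfn (\<lambda>t. \<phi> t $ a)" for \<phi> :: "real \<Rightarrow> real Matrix.vec" and a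
  have comp: "Rep_testfn (comp \<phi> a) = (\<lambda>t. \<phi> t $ a)" if "\<phi> \<in> test_fun_vec r" "a < r" for \<phi> a
    unfolding comp_def using that by (intro Abs_testfn_inverse) (auto simp: test_fun_vec_def)
  have lhs: "integral_I (\<lambda>t. w t \<bullet> \<phi> t) = (\<Sum>a<r. reg (\<lambda>t. w t $ a) (comp \<phi> a))"
    if \<phi>: "\<phi> \<in> test_fun_vec r" for \<phi>
  proof -
    have "integral_I (\<lambda>t. w t \<bullet> \<phi> t) = integral_I (\<lambda>t. \<Sum>a<r. w t $ a * Rep_testfn (comp \<phi> a) t)"
    proof (intro Bochner_Integration.integral_cong refl)
      fix t
      have "dim_vec (\<phi> t) = r" using \<phi> by (auto simp: test_fun_vec_def)
      then show "w t \<bullet> \<phi> t = (\<Sum>a<r. w t $ a * Rep_testfn (comp \<phi> a) t)"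
        using comp[OF \<phi>] by (simp add: scalar_prod_def atLeast0LessThan)
    qed
    then show ?thesis using wL2 L2_test_integrable by (simp add: reg_def)
  qed
  have rhs: "(\<Sum>i\<le>?N. (-1) ^ i * integral_I (\<lambda>t. l t \<bullet> (transpose_mat (coeff_mat P i) *\<^sub>v deriv_vec i \<phi> t)))
      = (\<Sum>a<r. mv c (\<lambda>a b. P $$ (a, b)) (\<lambda>b. reg (\<lambda>t. l t $ b)) a (comp \<phi> a))"
    if \<phi>: "\<phi> \<in> test_fun_vec r" for \<phi>
  proof -
    have int: "integral_I (\<lambda>t. l t \<bullet> (transpose_mat (coeff_mat P i) *\<^sub>v deriv_vec i \<phi> t))
        = (\<Sum>a<r. \<Sum>b<c. coeff (P $$ (a, b)) i * integral_I (\<lambda>t. l t $ b * (deriv ^^ i) (Rep_testfn (comp \<phi> a)) t))" for i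
    proof -
      have "integral_I (\<lambda>t. l t \<bullet> (transpose_mat (coeff_mat P i) *\<^sub>v deriv_vec i \<phi> t))
          = integral_I (\<lambda>t. \<Sum>a<r. \<Sum>b<c. coeff (P $$ (a, b)) i * (l t $ b * (deriv ^^ i) (Rep_testfn (comp \<phi> a)) t))"
      proof (intro Bochner_Integration.integral_cong refl)
        fix t
        have dim: "dim_vec (\<phi> t) = r" using \<phi> by (auto simp: test_fun_vec_def)
        have "l t \<bullet> (transpose_mat (coeff_mat P i) *\<^sub>v deriv_vec i \<phi> t)
            = (\<Sum>b<c. l t $ b * (\<Sum>a<r. coeff (P $$ (a, b)) i * (deriv ^^ i) (Rep_testfn (comp \<phi> a)) t))"
          using P dim comp[OF \<phi>]
          by (simp add: scalar_prod_def atLeast0LessThan coeff_mat_def deriv_vec_def)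
        also have "\<dots> = (\<Sum>a<r. \<Sum>b<c. coeff (P $$ (a, b)) i * (l t $ b * (deriv ^^ i) (Rep_testfn (comp \<phi> a)) t))"
          unfolding sum_distrib_left by (subst sum.swap) (simp add: mult_ac)
        finally show "l t \<bullet> (transpose_mat (coeff_mat P i) *\<^sub>v deriv_vec i \<phi> t)
          = (\<Sum>a<r. \<Sum>b<c. coeff (P $$ (a, b)) i * (l t $ b * (deriv ^^ i) (Rep_testfn (comp \<phi> a)) t))" .
      qed
      also have "\<dots> = (\<Sum>a<r. \<Sum>b<c. coeff (P $$ (a, b)) i * integral_I (\<lambda>t. l t $ b * (deriv ^^ i) (Rep_testfn (comp \<phi> a)) t))"
      proof -
        have 1: "integrable (lebesgue_on I) (\<lambda>t. coeff (P $$ (a, b)) i * (l t $ b * (deriv ^^ i) (Rep_testfn (comp \<phi> a)) t))"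
          if "b \<in> {..<c}" for a b
          using that by (intro integrable_mult_right L2_deriv_integrable lL2) auto
        have 2: "integrable (lebesgue_on I) (\<lambda>t. \<Sum>b<c. coeff (P $$ (a, b)) i * (l t $ b * (deriv ^^ i) (Rep_testfn (comp \<phi> a)) t))" for a
          by (intro Bochner_Integration.integrable_sum 1)
        show ?thesis
          by (subst Bochner_Integration.integral_sum[OF 2], intro sum.cong refl,
              subst Bochner_Integration.integral_sum[OF 1]) (simp_all only: integral_mult_right_zero)
      qed
      finally show ?thesis .
    qed
    have "(\<Sum>i\<le>?N. (-1) ^ i * integral_I (\<lambda>t. l t \<bullet> (transpose_mat (coeff_mat P i) *\<^sub>v deriv_vec i \<phi> t)))
        = (\<Sum>a<r. \<Sum>b<c. \<Sum>i\<le>?N. coeff (P $$ (a, b)) i * (ddiff ^^ i) (reg (\<lambda>t. l t $ b)) (comp \<phi> a))"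
      unfolding int sum_distrib_left
      by (rule trans[OF sum.swap], rule sum.cong[OF refl], rule trans[OF sum.swap], rule sum.cong[OF refl],
          rule sum.cong[OF refl]) (simp add: ddiff_pow reg_def Rep_dtest_pow)
    also have "\<dots> = (\<Sum>a<r. \<Sum>b<c. act (P $$ (a, b)) (reg (\<lambda>t. l t $ b)) (comp \<phi> a))"
      by (intro sum.cong refl act_bound[symmetric] degree_le_degree_mat[OF P]) auto
    finally show ?thesis by (simp add: mv_def sum_fun_apply)
  qed
  show ?thesis
  proof
    assume weak: "weak_diff_eq P l w"
    show "\<forall>a<r. reg (\<lambda>t. w t $ a) = mv c (\<lambda>a b. P $$ (a, b)) (\<lambda>b. reg (\<lambda>t. l t $ b)) a"
    proof (intro allI impI ext)
      fix a \<phi> assume a: "a < r"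
      \<comment> \<open>A test vector with one nonzero component extracts row \<open>a\<close>; the
        other rows are evaluated at 0 and vanish by linearity.\<close>
      have tv: "test_vec r a \<phi> \<in> test_fun_vec r"
      proof -
        have "(\<lambda>t. if i = a then Rep_testfn \<phi> t else 0) \<in> test_fun" for i
          using Rep_testfn[of \<phi>] test_fun_zero by (cases "i = a") simp_all
        then show ?thesis by (simp add: test_fun_vec_def test_vec_def)
      qed
      have c: "comp (test_vec r a \<phi>) b = (if b = a then \<phi> else 0)" if "b < r" for b
        using that by (auto simp: comp_def test_vec_def Rep_testfn_inverse zero_testfn_def)
      have lin0: "linear (\<lambda>\<phi>. mv c (\<lambda>a b. P $$ (a, b)) (\<lambda>b. reg (\<lambda>t. l t $ b)) b \<phi>)" for b
        unfolding mv_def sum_fun_apply act_def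
        by (intro linear_compose_sum ballI linear_cmult linear_ddiff_pow linear_reg lL2) auto
      have "test_vec r a \<phi> \<in> test_fun_vec (dim_row P)" using tv P by simp
      note E = weak[unfolded weak_diff_eq_def, THEN bspec, OF this, unfolded lhs[OF tv] rhs[OF tv]]
      have cc: "(\<Sum>b<r. T b (comp (test_vec r a \<phi>) b)) = (\<Sum>b<r. T b (if b = a then \<phi> else 0))"
        for T :: "nat \<Rightarrow> distribution"
        by (intro sum.cong refl arg_cong[where f = "T _"] c) simp
      have "(\<Sum>b<r. reg (\<lambda>t. w t $ b) (if b = a then \<phi> else 0))
          = (\<Sum>b<r. mv c (\<lambda>a b. P $$ (a, b)) (\<lambda>b. reg (\<lambda>t. l t $ b)) b (if b = a then \<phi> else 0))"
        using E unfolding cc[of "\<lambda>b. reg (\<lambda>t. w t $ b)"]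
          cc[of "mv c (\<lambda>a b. P $$ (a, b)) (\<lambda>b. reg (\<lambda>t. l t $ b))"] .
      moreover have "(\<Sum>b<r. reg (\<lambda>t. w t $ b) (if b = a then \<phi> else 0)) = (\<Sum>b<r. if b = a then reg (\<lambda>t. w t $ b) \<phi> else 0)"
        using linear_0[OF linear_reg[OF wL2]] by (intro sum.cong refl) auto
      moreover have "(\<Sum>b<r. mv c (\<lambda>a b. P $$ (a, b)) (\<lambda>b. reg (\<lambda>t. l t $ b)) b (if b = a then \<phi> else 0))
          = (\<Sum>b<r. if b = a then mv c (\<lambda>a b. P $$ (a, b)) (\<lambda>b. reg (\<lambda>t. l t $ b)) b \<phi> else 0)"
        using linear_0[OF lin0] by (intro sum.cong refl) auto
      ultimately show "reg (\<lambda>t. w t $ a) \<phi> = mv c (\<lambda>a b. P $$ (a, b)) (\<lambda>b. reg (\<lambda>t. l t $ b)) a \<phi>"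
        using a by simp
    qed
  next
    assume eq: "\<forall>a<r. reg (\<lambda>t. w t $ a) = mv c (\<lambda>a b. P $$ (a, b)) (\<lambda>b. reg (\<lambda>t. l t $ b)) a"
    show "weak_diff_eq P l w"
      unfolding weak_diff_eq_def
    proof
      fix \<phi> assume "\<phi> \<in> test_fun_vec (dim_row P)"
      then have \<phi>: "\<phi> \<in> test_fun_vec r" using P by simp
      show "integral_I (\<lambda>t. w t \<bullet> \<phi> t) = (\<Sum>i\<le>degree_mat P. (-1) ^ i *
          integral_I (\<lambda>t. l t \<bullet> (transpose_mat (coeff_mat P i) *\<^sub>v deriv_vec i \<phi> t)))"
        unfolding lhs[OF \<phi>] rhs[OF \<phi>] using eq by (intro sum.cong) auto
    qed
  qed
qed

lemma mv_split:
  "mv (m + p) P x i = mv m P x i + mv p (\<lambda>i j. P i (m + j)) (\<lambda>j. x (m + j)) i"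
  unfolding mv_def by (induction p) (simp_all add: add.assoc)

lemma smooth_clI_L2:
  assumes "f \<in> smooth_clI" shows "f \<in> L2"
proof -
  obtain F where F: "\<forall>t\<in>clI. F 0 t = f t"
    "\<forall>n. \<forall>t\<in>clI. (F n has_real_derivative F (Suc n) t) (at t within clI)"
    using assms by (auto simp: smooth_clI_def)
  have "continuous_on clI (F 0)"
    using F(2) by (auto simp: continuous_on_eq_continuous_within intro!: DERIV_continuous)
  then have "continuous_on clI f" by (rule continuous_on_eq) (use F(1) in auto)
  then show ?thesis by (rule L2_continuous)
qed

lemma weak_kernel_iff:
  assumes R: "R \<in> carrier_mat g (m + p)" and w: "w \<in> L2_vec (m + p)"
  shows "weak_diff_eq R w (\<lambda>t. 0\<^sub>v g) \<longleftrightarrow>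
    (\<forall>i<g. mv m (\<lambda>i j. R $$ (i, j)) (\<lambda>b. reg (\<lambda>t. w t $ b)) i
      + mv p (\<lambda>i j. R $$ (i, m + j)) (\<lambda>a. reg (\<lambda>t. w t $ (m + a))) i = 0)"
proof -
  have "(\<lambda>t. 0\<^sub>v g) \<in> L2_vec g" by (auto simp: L2_vec_def L2_const)
  then have "weak_diff_eq R w (\<lambda>t. 0\<^sub>v g) \<longleftrightarrow> (\<forall>i<g. reg (\<lambda>t. 0\<^sub>v g $ i) =
      mv (m + p) (\<lambda>a b. R $$ (a, b)) (\<lambda>b. reg (\<lambda>t. w t $ b)) i)"
    by (rule weak_diff_eq_iff[OF R w])
  also have "\<dots> \<longleftrightarrow> (\<forall>i<g. 0 = mv (m + p) (\<lambda>a b. R $$ (a, b)) (\<lambda>b. reg (\<lambda>t. w t $ b)) i)"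
    by (simp add: reg_zero)
  finally show ?thesis unfolding mv_split by (simp only: eq_commute)
qed

section \<open>Representations and controllability in components\<close>

lemma real_mult_mat_vec:
  "M \<in> carrier_mat r c \<Longrightarrow> v \<in> carrier_vec c \<Longrightarrow> i < r \<Longrightarrow> (M *\<^sub>v v) $ i = (\<Sum>l<c. M $$ (i, l) * v $ l)"
  by (auto simp: scalar_prod_def atLeast0LessThan)

text \<open>Links the kernel equations for distributions with the classical state equations.
  Functions smooth on the closed interval lie in \<open>L2\<close>, so both readings apply to
  them.\<close>

lemma iso_representation_components:
  assumes R: "R \<in> carrier_mat g (m + p)" and B: "\<BB> = {w \<in> L2_vec (m + p). weak_diff_eq R w (\<lambda>t. 0\<^sub>v g)}"
    and iso: "iso_representation m p \<BB> n A B C D"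
    and u: "\<And>b. b < m \<Longrightarrow> u b \<in> smooth_clI" and y: "\<And>a. a < p \<Longrightarrow> y a \<in> smooth_clI"
  shows "(\<forall>i<g. mv m (\<lambda>i j. R $$ (i, j)) (\<lambda>b. reg (u b)) i + mv p (\<lambda>i j. R $$ (i, m + j)) (\<lambda>a. reg (y a)) i = 0) \<longleftrightarrow>
    (\<exists>x. (\<forall>l<n. x l \<in> smooth_clI) \<and> (\<forall>t\<in>clI.
      (\<forall>i<n. (x i has_real_derivative (\<Sum>l<n. A $$ (i, l) * x l t) + (\<Sum>b<m. B $$ (i, b) * u b t)) (at t within clI)) \<and>
      (\<forall>a<p. y a t = (\<Sum>l<n. C $$ (a, l) * x l t) + (\<Sum>b<m. D $$ (a, b) * u b t))))"
    (is "?ker \<longleftrightarrow> ?traj")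
proof -
  have mats: "A \<in> carrier_mat n n" "B \<in> carrier_mat n m" "C \<in> carrier_mat p n" "D \<in> carrier_mat p m"
    using iso by (auto simp: iso_representation_def)
  define uv where "uv t = Matrix.vec m (\<lambda>b. u b t)" for t
  define yv where "yv t = Matrix.vec p (\<lambda>a. y a t)" for t
  let ?w = "\<lambda>t. uv t @\<^sub>v yv t"
  have comp: "?w t $ b = u b t" "?w t $ (m + a) = y a t" if "b < m" "a < p" for t a b
    using that by (auto simp: uv_def yv_def)
  have comp1: "?w t $ b = u b t" if "b < m" for t b using that by (auto simp: uv_def yv_def)
  have comp2: "?w t $ (m + a) = y a t" if "a < p" for t a using that by (auto simp: uv_def yv_def)
  have wL2: "?w \<in> L2_vec (m + p)"
    unfolding L2_vec_def
  proof (intro CollectI conjI ballI allI impI)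
    fix i assume i: "i < m + p"
    show "(\<lambda>t. ?w t $ i) \<in> L2"
    proof (cases "i < m")
      case True
      then show ?thesis using smooth_clI_L2[OF u] by (simp only: comp1)
    next
      case False
      then obtain a where "i = m + a" "a < p" using i by (metis add_less_cancel_left le_Suc_ex not_less)
      then show ?thesis using smooth_clI_L2[OF y] by (simp only: comp2)
    qed
  qed (auto simp: uv_def yv_def)
  have sm: "uv \<in> smooth_clI_vec m" "yv \<in> smooth_clI_vec p"
    using u y by (auto simp: smooth_clI_vec_def uv_def yv_def)
  have "?ker \<longleftrightarrow> ?w \<in> \<BB>"
  proof -
    have "?w \<in> \<BB> \<longleftrightarrow> (\<forall>i<g. mv m (\<lambda>i j. R $$ (i, j)) (\<lambda>b. reg (\<lambda>t. ?w t $ b)) i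
        + mv p (\<lambda>i j. R $$ (i, m + j)) (\<lambda>a. reg (\<lambda>t. ?w t $ (m + a))) i = 0)"
      unfolding B using wL2 weak_kernel_iff[OF R wL2] by simp
    moreover have "mv m (\<lambda>i j. R $$ (i, j)) (\<lambda>b. reg (\<lambda>t. ?w t $ b)) i = mv m (\<lambda>i j. R $$ (i, j)) (\<lambda>b. reg (u b)) i" for i
      by (intro mv_cong refl) (simp only: comp1)
    moreover have "mv p (\<lambda>i j. R $$ (i, m + j)) (\<lambda>a. reg (\<lambda>t. ?w t $ (m + a))) i = mv p (\<lambda>i j. R $$ (i, m + j)) (\<lambda>a. reg (y a)) i" for i
      by (intro mv_cong refl) (simp only: comp2)
    ultimately show ?thesis by simp
  qed
  also have "\<dots> \<longleftrightarrow> (\<exists>x\<in>smooth_clI_vec n. \<forall>t\<in>clI.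
           (\<forall>i<n. ((\<lambda>s. x s $ i) has_real_derivative (A *\<^sub>v x t + B *\<^sub>v uv t) $ i) (at t within clI)) \<and>
           yv t = C *\<^sub>v x t + D *\<^sub>v uv t)" (is "_ \<longleftrightarrow> (\<exists>x\<in>_. ?P x)")
    using iso sm unfolding iso_representation_def by blast
  also have "\<dots> \<longleftrightarrow> ?traj"
  proof
    assume "\<exists>x\<in>smooth_clI_vec n. ?P x"
    then obtain x where x: "x \<in> smooth_clI_vec n" "?P x" by blast
    show ?traj
    proof (intro exI[of _ "\<lambda>l t. x t $ l"] conjI allI impI ballI)
      show "(\<lambda>t. x t $ l) \<in> smooth_clI" if "l < n" for l using x(1) that by (auto simp: smooth_clI_vec_def)
      fix t assume t: "t \<in> clI"
      then have xc: "x t \<in> carrier_vec n" using x(1) by (auto simp: smooth_clI_vec_def)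
      have uc: "uv t \<in> carrier_vec m" by (simp add: uv_def)
      have uv: "uv t $ b = u b t" if "b < m" for b using that by (simp add: uv_def)
      show "((\<lambda>t. x t $ i) has_real_derivative (\<Sum>l<n. A $$ (i, l) * x t $ l) + (\<Sum>b<m. B $$ (i, b) * u b t)) (at t within clI)"
        if "i < n" for i
      proof -
        have "(A *\<^sub>v x t + B *\<^sub>v uv t) $ i = (\<Sum>l<n. A $$ (i, l) * x t $ l) + (\<Sum>b<m. B $$ (i, b) * u b t)"
          using that mats uv real_mult_mat_vec[OF mats(1) xc that] real_mult_mat_vec[OF mats(2) uc that] by simp
        then show ?thesis using x(2) t that by metis
      qed
      show "y a t = (\<Sum>l<n. C $$ (a, l) * x t $ l) + (\<Sum>b<m. D $$ (a, b) * u b t)" if "a < p" for a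
      proof -
        have "y a t = (C *\<^sub>v x t + D *\<^sub>v uv t) $ a" using x(2) t that by (metis yv_def index_vec)
        then show ?thesis
          using that mats uv real_mult_mat_vec[OF mats(3) xc that] real_mult_mat_vec[OF mats(4) uc that] by simp
      qed
    qed
  next
    assume ?traj
    then obtain x where x: "\<forall>l<n. x l \<in> smooth_clI"
      and ode: "\<And>t i. t \<in> clI \<Longrightarrow> i < n \<Longrightarrow> (x i has_real_derivative (\<Sum>l<n. A $$ (i, l) * x l t) + (\<Sum>b<m. B $$ (i, b) * u b t)) (at t within clI)"
      and out: "\<And>t a. t \<in> clI \<Longrightarrow> a < p \<Longrightarrow> y a t = (\<Sum>l<n. C $$ (a, l) * x l t) + (\<Sum>b<m. D $$ (a, b) * u b t)"
      by blast
    define xv where "xv t = Matrix.vec n (\<lambda>l. x l t)" for t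
    have xv: "xv t \<in> carrier_vec n" "\<And>l. l < n \<Longrightarrow> xv t $ l = x l t" for t by (auto simp: xv_def)
    have uv: "uv t \<in> carrier_vec m" "\<And>b. b < m \<Longrightarrow> uv t $ b = u b t" for t by (auto simp: uv_def)
    show "\<exists>x\<in>smooth_clI_vec n. ?P x"
    proof (intro bexI[of _ xv] ballI conjI allI impI)
      show "xv \<in> smooth_clI_vec n" using x by (auto simp: smooth_clI_vec_def xv_def)
      fix t assume t: "t \<in> clI"
      show "((\<lambda>s. xv s $ i) has_real_derivative (A *\<^sub>v xv t + B *\<^sub>v uv t) $ i) (at t within clI)" if "i < n" for i
      proof -
        have "(A *\<^sub>v xv t + B *\<^sub>v uv t) $ i = (\<Sum>l<n. A $$ (i, l) * x l t) + (\<Sum>b<m. B $$ (i, b) * u b t)"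
          using that mats uv xv real_mult_mat_vec[OF mats(1) xv(1) that] real_mult_mat_vec[OF mats(2) uv(1) that] by simp
        then show ?thesis using ode[OF t that] that by (simp add: xv)
      qed
      show "yv t = C *\<^sub>v xv t + D *\<^sub>v uv t"
      proof (rule eq_vecI)
        show "dim_vec (yv t) = dim_vec (C *\<^sub>v xv t + D *\<^sub>v uv t)" using mats by (simp add: yv_def)
        fix a assume "a < dim_vec (C *\<^sub>v xv t + D *\<^sub>v uv t)"
        then have a: "a < p" using mats by simp
        have "(C *\<^sub>v xv t + D *\<^sub>v uv t) $ a = (\<Sum>l<n. C $$ (a, l) * x l t) + (\<Sum>b<m. D $$ (a, b) * u b t)"
          using a mats uv xv real_mult_mat_vec[OF mats(3) xv(1) a] real_mult_mat_vec[OF mats(4) uv(1) a] by simp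
        then show "yv t $ a = (C *\<^sub>v xv t + D *\<^sub>v uv t) $ a" using out[OF t a] a by (simp add: yv_def)
      qed
    qed
  qed
  finally show ?thesis .
qed

text \<open>Free responses and exponential solutions are smooth, so the assumed equivalence puts
  them into the kernel. In the other direction it gives a smooth zero-input output a state, and
  uniqueness turns the output into a free response.\<close>

lemma iso_representation_represents:
  assumes R: "R \<in> carrier_mat g (m + p)" and B: "\<BB> = {w \<in> L2_vec (m + p). weak_diff_eq R w (\<lambda>t. 0\<^sub>v g)}"
    and iso: "iso_representation m p \<BB> n A B C D"
  shows "represents g m p (\<lambda>i j. R $$ (i, j)) (\<lambda>i j. R $$ (i, m + j)) n
    (\<lambda>i j. A $$ (i, j)) (\<lambda>i j. B $$ (i, j)) (\<lambda>i j. C $$ (i, j)) (\<lambda>i j. D $$ (i, j))"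
    (is "represents g m p ?Ru ?Ry n ?A ?B ?C ?D")
proof (rule representsI)
  have zero: "(\<lambda>_. 0) \<in> smooth_clI" by (rule smooth_imp_smooth_clI[OF smooth_const])
  have mv0: "mv m ?Ru (\<lambda>b. reg (\<lambda>_. 0)) i = 0" for i by (simp add: mv_def reg_zero)
  {
    fix x0 :: "nat \<Rightarrow> real" and i assume i: "i < g"
    have "\<forall>i<g. mv m ?Ru (\<lambda>b. reg (\<lambda>_. 0)) i + mv p ?Ry (\<lambda>a. reg (free_response n ?A ?C x0 a)) i = 0"
      unfolding iso_representation_components[OF R B iso zero smooth_imp_smooth_clI[OF smooth_free_response]]
    proof (intro exI[of _ "\<lambda>l t. \<Sum>j<n. mexp n ?A l j t * x0 j"] conjI allI impI ballI)
      fix l assume "l < n"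
      then show "(\<lambda>t. \<Sum>j<n. mexp n ?A l j t * x0 j) \<in> smooth_clI"
        by (intro smooth_imp_smooth_clI smooth_free_state)
    next
      fix t l assume l: "l < n"
      have "((\<lambda>t. \<Sum>j<n. mexp n ?A l j t * x0 j) has_real_derivative (\<Sum>j<n. (\<Sum>r<n. ?A l r * mexp n ?A r j t) * x0 j)) (at t within clI)"
        using l by (intro DERIV_sum DERIV_cmult_right has_field_derivative_at_within[OF mexp_has_deriv])
      then show "((\<lambda>t. \<Sum>j<n. mexp n ?A l j t * x0 j) has_real_derivative
          (\<Sum>r<n. A $$ (l, r) * (\<Sum>j<n. mexp n ?A r j t * x0 j)) + (\<Sum>b<m. B $$ (l, b) * 0)) (at t within clI)"
        by (simp add: sum_vec_mat_vec)
    next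
      fix t a
      show "free_response n ?A ?C x0 a t = (\<Sum>l<n. C $$ (a, l) * (\<Sum>j<n. mexp n ?A l j t * x0 j)) + (\<Sum>b<m. D $$ (a, b) * 0)"
        by (simp add: free_response_def)
    qed
    then show "mv p ?Ry (\<lambda>a. reg (free_response n ?A ?C x0 a)) i = 0" using i mv0 by simp
  next
    fix c :: real and x0 u0 :: "nat \<Rightarrow> real" and i
    assume ode: "\<And>i. i < n \<Longrightarrow> c * x0 i = (\<Sum>l<n. ?A i l * x0 l) + (\<Sum>b<m. ?B i b * u0 b)" and i: "i < g"
    let ?y0 = "\<lambda>a. (\<Sum>l<n. ?C a l * x0 l) + (\<Sum>b<m. ?D a b * u0 b)"
    have sm: "(\<lambda>t. k * exp (c * t)) \<in> smooth_clI" for k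
      by (intro smooth_imp_smooth_clI smooth_mult smooth_const smooth_exp)
    have "\<forall>i<g. mv m ?Ru (\<lambda>b. reg (\<lambda>t. u0 b * exp (c * t))) i + mv p ?Ry (\<lambda>a. reg (\<lambda>t. ?y0 a * exp (c * t))) i = 0"
      unfolding iso_representation_components[OF R B iso sm sm]
    proof (intro exI[of _ "\<lambda>l t. x0 l * exp (c * t)"] conjI allI impI ballI sm)
      fix t l assume l: "l < n"
      have "((\<lambda>t. x0 l * exp (c * t)) has_real_derivative (c * x0 l) * exp (c * t)) (at t within clI)"
        by (auto intro!: derivative_eq_intros)
      then show "((\<lambda>t. x0 l * exp (c * t)) has_real_derivative
          (\<Sum>r<n. A $$ (l, r) * (x0 r * exp (c * t))) + (\<Sum>b<m. B $$ (l, b) * (u0 b * exp (c * t)))) (at t within clI)"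
        unfolding ode[OF l] by (simp add: distrib_right sum_distrib_right mult.assoc)
    next
      fix t a
      show "?y0 a * exp (c * t) = (\<Sum>l<n. C $$ (a, l) * (x0 l * exp (c * t))) + (\<Sum>b<m. D $$ (a, b) * (u0 b * exp (c * t)))"
        by (simp add: distrib_right sum_distrib_right mult.assoc)
    qed
    then show "mv m ?Ru (\<lambda>b. act [:u0 b:] (expd c)) i + mv p ?Ry (\<lambda>a. act [:?y0 a:] (expd c)) i = 0"
      using i unfolding reg_cmult expd_def by blast
  next
    fix z assume z: "\<And>i. i < p \<Longrightarrow> z i \<in> smooth_clI" and "\<And>i. i < g \<Longrightarrow> mv p ?Ry (\<lambda>j. reg (z j)) i = 0"
    then have "\<forall>i<g. mv m ?Ru (\<lambda>b. reg (\<lambda>_. 0)) i + mv p ?Ry (\<lambda>a. reg (z a)) i = 0" using mv0 by simp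
    then have "\<exists>x. \<forall>t\<in>clI. (\<forall>i<n. (x i has_real_derivative (\<Sum>l<n. A $$ (i, l) * x l t)) (at t within clI)) \<and>
        (\<forall>a<p. z a t = (\<Sum>l<n. C $$ (a, l) * x l t))"
      using iso_representation_components[OF R B iso, of "\<lambda>_ _. 0" z, OF zero z] by auto
    then obtain x where x': "\<forall>t\<in>clI. (\<forall>i<n. (x i has_real_derivative (\<Sum>l<n. A $$ (i, l) * x l t)) (at t within clI)) \<and>
        (\<forall>a<p. z a t = (\<Sum>l<n. C $$ (a, l) * x l t))" ..
    have x: "(x i has_real_derivative (\<Sum>l<n. A $$ (i, l) * x l t)) (at t within clI)" if "t \<in> clI" "i < n" for t i
      using x' that by blast
    have out: "z a t = (\<Sum>l<n. C $$ (a, l) * x l t)" if "t \<in> clI" "a < p" for t a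
      using x' that by blast
    have "x l t = (\<Sum>j<n. mexp n ?A l j t * x j 0)" if "l < n" "t \<in> clI" for l t
      using mexp_unique[of n x ?A l t] x that by simp
    then have "\<forall>i<p. \<forall>t\<in>clI. z i t = free_response n ?A ?C (\<lambda>j. x j 0) i t"
      unfolding free_response_def
      by (intro allI impI ballI, subst out) (auto intro!: sum.cong)
    then show "\<exists>x0. \<forall>i<p. \<forall>t\<in>clI. z i t = free_response n ?A ?C x0 i t" by blast
  }
qed

text \<open>Controllability is applied with the zero trajectory as past and the free response of
  \<open>x0\<close> under zero input as future.\<close>

lemma controllable_reachable:
  assumes R: "R \<in> carrier_mat g (m + p)" and B: "\<BB> = {w \<in> L2_vec (m + p). weak_diff_eq R w (\<lambda>t. 0\<^sub>v g)}"
    and ctrl: "controllable \<BB>"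
    and represents: "represents g m p (\<lambda>i j. R $$ (i, j)) (\<lambda>i j. R $$ (i, m + j)) n A B C D"
    and obs: "observable n p A C"
  shows "reachable n m A B"
proof (rule represents_reachable[OF represents obs])
  fix x0
  let ?Ru = "\<lambda>i j. R $$ (i, j)" and ?Ry = "\<lambda>i j. R $$ (i, m + j)"
  define w1 where "w1 t = Matrix.vec (m + p) (\<lambda>i. if i < m then 0 else free_response n A C x0 (i - m) t)" for t
  have w1L2: "w1 \<in> L2_vec (m + p)"
    unfolding L2_vec_def
  proof (intro CollectI conjI ballI allI impI)
    fix i assume i: "i < m + p"
    show "(\<lambda>t. w1 t $ i) \<in> L2"
    proof (cases "i < m")
      case True
      then show ?thesis by (simp add: w1_def L2_const)
    next
      case False
      then show ?thesis using i by (simp add: w1_def L2_smooth smooth_free_response)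
    qed
  qed (simp add: w1_def)
  have "w1 \<in> \<BB>"
  proof -
    have "mv m ?Ru (\<lambda>b. reg (\<lambda>t. w1 t $ b)) i + mv p ?Ry (\<lambda>a. reg (\<lambda>t. w1 t $ (m + a))) i = 0" if i: "i < g" for i
    proof -
      have u: "mv m ?Ru (\<lambda>b. reg (\<lambda>t. w1 t $ b)) i = mv m ?Ru (\<lambda>_. 0) i"
        by (intro mv_cong refl) (simp add: w1_def reg_zero)
      have y: "mv p ?Ry (\<lambda>a. reg (\<lambda>t. w1 t $ (m + a))) i = mv p ?Ry (\<lambda>a. mv n (cm C) (free_state n A x0) a + mv m (cm D) (\<lambda>_. 0) a) i"
        by (intro mv_cong refl) (simp add: w1_def reg_free_response mv_zero_right flip: free_response_def)
      show ?thesis unfolding u y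
        by (rule represents_kernel[OF represents _ i]) (simp add: ddiff_free_state mv_zero_right)
    qed
    then show ?thesis unfolding B using w1L2 weak_kernel_iff[OF R w1L2] by simp
  qed
  have "(\<lambda>_. 0\<^sub>v (m + p)) \<in> \<BB>"
  proof -
    have z: "(\<lambda>_. 0\<^sub>v (m + p)) \<in> L2_vec (m + p)" by (auto simp: L2_vec_def L2_const)
    have "mv m ?Ru (\<lambda>b. reg (\<lambda>t. 0\<^sub>v (m + p) $ b)) i = 0" "mv p ?Ry (\<lambda>a. reg (\<lambda>t. 0\<^sub>v (m + p) $ (m + a))) i = 0" for i
      by (rule mv_zero_right, simp add: reg_zero)+
    then show ?thesis unfolding B using z weak_kernel_iff[OF R z] by simp
  qed
  from ctrl[unfolded controllable_def, THEN bspec, OF this, THEN bspec, OF \<open>w1 \<in> \<BB>\<close>]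
  obtain t1 w where t1: "t1 \<in> {0<..<1}" and w: "w \<in> \<BB>"
    and past: "AE t in lebesgue_on {-1<..0}. w t = 0\<^sub>v (m + p)"
    and future: "AE t in lebesgue_on {t1..<1}. w t = w1 (t - t1)"
    by blast
  have wL2: "w \<in> L2_vec (m + p)" using w by (simp add: B)
  show "\<exists>t1 u y. 0 < t1 \<and> t1 < 1 \<and> (\<forall>b<m. u b \<in> L2) \<and> (\<forall>i<p. y i \<in> L2) \<and>
      (\<forall>i<g. mv m ?Ru (\<lambda>b. reg (u b)) i + mv p ?Ry (\<lambda>a. reg (y a)) i = 0) \<and>
      (AE t in lebesgue. t \<in> {-1<..<0} \<longrightarrow> (\<forall>b<m. u b t = 0) \<and> (\<forall>i<p. y i t = 0)) \<and>
      (AE t in lebesgue. t \<in> {t1<..<1} \<longrightarrow> (\<forall>b<m. u b t = 0) \<and> (\<forall>i<p. y i t = free_response n A C x0 i (t - t1)))"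
  proof (rule exI[of _ t1], rule exI[of _ "\<lambda>b t. w t $ b"], rule exI[of _ "\<lambda>a t. w t $ (m + a)"], intro conjI)
    show "\<forall>i<g. mv m ?Ru (\<lambda>b. reg (\<lambda>t. w t $ b)) i + mv p ?Ry (\<lambda>a. reg (\<lambda>t. w t $ (m + a))) i = 0"
      using w weak_kernel_iff[OF R wL2] by (simp add: B)
    have "AE t in lebesgue. t \<in> {-1<..0} \<longrightarrow> w t = 0\<^sub>v (m + p)"
      using past by (simp add: AE_restrict_space_iff)
    then show "AE t in lebesgue. t \<in> {-1<..<0} \<longrightarrow> (\<forall>b<m. w t $ b = 0) \<and> (\<forall>i<p. w t $ (m + i) = 0)"
      by eventually_elim auto
    have "AE t in lebesgue. t \<in> {t1..<1} \<longrightarrow> w t = w1 (t - t1)"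
      using future by (simp add: AE_restrict_space_iff)
    then show "AE t in lebesgue. t \<in> {t1<..<1} \<longrightarrow> (\<forall>b<m. w t $ b = 0) \<and> (\<forall>i<p. w t $ (m + i) = free_response n A C x0 i (t - t1))"
      by eventually_elim (auto simp: w1_def)
  qed (use t1 wL2 in \<open>auto simp: L2_vec_def\<close>)
qed

theorem lemma5:
  fixes m p :: nat and \<BB> :: "(real \<Rightarrow> real Matrix.vec) set"
  assumes behavior: "linear_differential_behavior (m + p) \<BB>"
    and io: "\<exists>n. has_iso_representation m p \<BB> n"
    and ctrl: "controllable \<BB>"
  shows "\<exists>M \<in> carrier_mat (m + p) m.
           degree_mat M \<le> mcmillan_degree m p \<BB> + 1 \<and>
           \<BB> = {w \<in> L2_vec (m + p). \<exists>l \<in> L2_vec m. weak_diff_eq M l w} \<and>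
           (\<forall>k. \<forall>w \<in> sobolev_vec k (m + p). \<forall>l \<in> L2_vec m.
              weak_diff_eq M l w \<longrightarrow> l \<in> sobolev_vec (k + 1) m)"
proof -
  obtain g R where R: "R \<in> carrier_mat g (m + p)" and B: "\<BB> = {w \<in> L2_vec (m + p). weak_diff_eq R w (\<lambda>t. 0\<^sub>v g)}"
    using behavior by (auto simp: linear_differential_behavior_def)
  define N where "N = mcmillan_degree m p \<BB>"
  have "has_iso_representation m p \<BB> N"
    unfolding N_def mcmillan_degree_def using io by (rule LeastI_ex)
  then obtain A0 B0 C0 D0 where iso: "iso_representation m p \<BB> N A0 B0 C0 D0"
    unfolding has_iso_representation_def by (elim exE)
  let ?Ru = "\<lambda>i j. R $$ (i, j)" and ?Ry = "\<lambda>i j. R $$ (i, m + j)"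
  \<comment> \<open>The quotient may have fewer states than the McMillan degree; the bound uses
    \<open>n \<le> N\<close>.\<close>
  obtain n A B' C where n: "n \<le> N" and represents: "represents g m p ?Ru ?Ry n A B' C (\<lambda>i j. D0 $$ (i, j))"
    and obs: "observable n p A C"
    using represents_observable[OF iso_representation_represents[OF R B iso]] by (elim exE conjE)
  define D where "D = (\<lambda>i j. D0 $$ (i, j))"
  note represents = represents[folded D_def]
  have "reachable n m A B'" by (rule controllable_reachable[OF R B ctrl represents obs])
  from flat_data_exists[OF this] obtain X U Lx Lu where flat: "flat_data n m A B' X U Lx Lu" by (elim exE)
  interpret flat_system g m p n ?Ru ?Ry X U A B' C D Lx Lu
    using represents obs flat by (rule flat_system.intro)
  \<comment> \<open>The rows of s U stacked over those of s (C X + D U), matching the order of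
    inputs and outputs in w.\<close>
  define M where "M = mat (m + p) m (\<lambda>(i, b). [:0, 1:] * (if i < m then U i b else Yp (i - m) b))"
  have M: "M \<in> carrier_mat (m + p) m" by (simp add: M_def)
  have degX: "degree (X i b) \<le> n" if "i < n" "b < m" for i b
    using flat[unfolded flat_data_def, THEN conjunct1] that by blast
  have degU: "degree (U i b) \<le> n" if "i < m" "b < m" for i b
    using flat[unfolded flat_data_def, THEN conjunct2, THEN conjunct1] that by blast
  have degc: "degree ([:c:] * q) \<le> n" if "degree q \<le> n" for c and q :: "real poly"
    using degree_mult_le[of "[:c:]" q] that by simp
  have degY: "degree (Yp i b) \<le> n" if "b < m" for i b
    unfolding output_matrix_def mm_def cm_def
    by (intro degree_add_le degree_lessThan_sum_le degc degX degU that)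
  have "degree (M $$ (i, b)) \<le> N + 1" if "i < m + p" "b < m" for i b
  proof -
    let ?q = "if i < m then U i b else Yp (i - m) b"
    have "degree ?q \<le> n" using degU degY that by auto
    then have "degree ([:0, 1:] * ?q) \<le> n + 1" using degree_mult_le[of "[:0, 1:]" ?q] by simp
    then show ?thesis using that n by (simp add: M_def)
  qed
  then have deg: "degree_mat M \<le> N + 1" by (rule degree_mat_le[OF M])
  have split: "(\<forall>i<m + p. Q i) \<longleftrightarrow> (\<forall>i<m. Q i) \<and> (\<forall>i<p. Q (m + i))" for Q :: "nat \<Rightarrow> bool"
  proof (intro iffI conjI allI impI)
    fix i assume Q: "(\<forall>i<m. Q i) \<and> (\<forall>i<p. Q (m + i))" and i: "i < m + p"
    show "Q i"
    proof (cases "i < m")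
      case False
      then have "Q (m + (i - m))" using Q i by (intro Q[THEN conjunct2, rule_format]) simp
      then show ?thesis using False by simp
    qed (use Q in blast)
  qed auto
  have weak: "weak_diff_eq M l w \<longleftrightarrow>
      latent_eq (\<lambda>b. reg (\<lambda>t. l t $ b)) (\<lambda>b. reg (\<lambda>t. w t $ b)) (\<lambda>a. reg (\<lambda>t. w t $ (m + a)))"
    if "l \<in> L2_vec m" "w \<in> L2_vec (m + p)" for l w
  proof -
    have "mv m (\<lambda>a b. M $$ (a, b)) x i = mv m (\<lambda>i b. [:0, 1:] * U i b) x i" if "i < m" for i x
      using that by (intro mv_cong refl) (simp add: M_def)
    moreover have "mv m (\<lambda>a b. M $$ (a, b)) x (m + i) = mv m (\<lambda>i b. [:0, 1:] * Yp i b) x i" if "i < p" for i x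
      unfolding mv_def using that by (intro sum.cong refl) (simp add: M_def)
    ultimately show ?thesis
      unfolding weak_diff_eq_iff[OF M that] latent_eq_def split by simp
  qed
  have kernel_iff: "w \<in> \<BB> \<longleftrightarrow> kernel (\<lambda>b. reg (\<lambda>t. w t $ b)) (\<lambda>a. reg (\<lambda>t. w t $ (m + a)))"
    if "w \<in> L2_vec (m + p)" for w
    unfolding B kernel_def using that weak_kernel_iff[OF R that] by simp
  have wu: "(\<lambda>t. w t $ b) \<in> L2" if "w \<in> L2_vec (m + p)" "b < m" for w b
    using that by (auto simp: L2_vec_def)
  have wy: "(\<lambda>t. w t $ (m + a)) \<in> L2" if "w \<in> L2_vec (m + p)" "a < p" for w a
    using that by (auto simp: L2_vec_def)
  have image: "\<BB> = {w \<in> L2_vec (m + p). \<exists>l \<in> L2_vec m. weak_diff_eq M l w}"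
  proof (intro equalityI subsetI CollectI conjI)
    fix w assume w: "w \<in> \<BB>"
    then show wL2: "w \<in> L2_vec (m + p)" by (simp add: B)
    have "kernel (\<lambda>b. reg (\<lambda>t. w t $ b)) (\<lambda>a. reg (\<lambda>t. w t $ (m + a)))"
      using w kernel_iff[OF wL2] by simp
    from kernel_imp_latent[OF wu[OF wL2] wy[OF wL2] this]
    obtain l where l: "\<forall>i<m. l i \<in> L2"
      "latent_eq (\<lambda>i. reg (l i)) (\<lambda>b. reg (\<lambda>t. w t $ b)) (\<lambda>a. reg (\<lambda>t. w t $ (m + a)))" by auto
    define lv where "lv t = Matrix.vec m (\<lambda>i. l i t)" for t
    have lv: "lv \<in> L2_vec m" using l(1) by (auto simp: L2_vec_def lv_def)
    have "latent_eq (\<lambda>b. reg (\<lambda>t. lv t $ b)) (\<lambda>b. reg (\<lambda>t. w t $ b)) (\<lambda>a. reg (\<lambda>t. w t $ (m + a)))"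
    proof -
      have "mv m P (\<lambda>b. reg (\<lambda>t. lv t $ b)) i = mv m P (\<lambda>b. reg (l b)) i" for P i
        by (intro mv_cong refl) (simp add: lv_def)
      then show ?thesis using l(2) unfolding latent_eq_def by simp
    qed
    then show "\<exists>l \<in> L2_vec m. weak_diff_eq M l w" using weak[OF lv wL2] lv by blast
  next
    fix w assume "w \<in> {w \<in> L2_vec (m + p). \<exists>l \<in> L2_vec m. weak_diff_eq M l w}"
    then obtain l where w: "w \<in> L2_vec (m + p)" and l: "l \<in> L2_vec m" "weak_diff_eq M l w" by blast
    have "latent_eq (\<lambda>b. reg (\<lambda>t. l t $ b)) (\<lambda>b. reg (\<lambda>t. w t $ b)) (\<lambda>a. reg (\<lambda>t. w t $ (m + a)))"
      using weak[OF l(1) w] l(2) by simp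
    then show "w \<in> \<BB>" unfolding kernel_iff[OF w] by (rule latent_imp_kernel)
  qed
  have reg: "l \<in> sobolev_vec (k + 1) m"
    if wk: "w \<in> sobolev_vec k (m + p)" and l: "l \<in> L2_vec m" and eq: "weak_diff_eq M l w" for k w l
  proof -
    have sob: "(\<lambda>t. w t $ i) \<in> sobolev k" if "i < m + p" for i using wk that by (auto simp: sobolev_vec_def)
    have wL2: "w \<in> L2_vec (m + p)"
      using wk sob by (auto simp: sobolev_vec_def L2_vec_def sobolev_iff)
    have lL2: "(\<lambda>t. l t $ i) \<in> L2" if "i < m" for i using l that by (auto simp: L2_vec_def)
    have lat: "latent_eq (\<lambda>b. reg (\<lambda>t. l t $ b)) (\<lambda>b. reg (\<lambda>t. w t $ b)) (\<lambda>a. reg (\<lambda>t. w t $ (m + a)))"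
      using weak[OF l wL2] eq by simp
    have uk: "is_L2 ((ddiff ^^ j) (reg (\<lambda>t. w t $ b)))" if "b < m" "j \<le> k" for b j
      using sob[of b] that by (simp add: sobolev_iff)
    have "is_L2 ((ddiff ^^ j) (reg (\<lambda>t. l t $ i)))" if "i < m" "j \<le> k + 1" for i j
      by (rule latent_regularity[OF wu[OF wL2] wy[OF wL2] lL2 lat uk that])
    then have "(\<lambda>t. l t $ i) \<in> sobolev (k + 1)" if "i < m" for i
      using lL2 that by (simp add: sobolev_iff)
    then show ?thesis using l by (auto simp: sobolev_vec_def L2_vec_def)
  qed
  show ?thesis
  proof (rule bexI[OF _ M], intro conjI allI ballI impI)
    show "degree_mat M \<le> mcmillan_degree m p \<BB> + 1" by (rule deg[unfolded N_def])
  qed (fact image, rule reg)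
qed

end
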